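(* Assume that $$\rho>\mu+\sigma\quad\text{and}\quad\mu-\sigma<0.$$ Then $$u_+=a\,\frac{\rho}{\rho-\mu-\sigma},$$ and, with $$C=\frac{1-b}{\Omega\,u_+^{\Omega-1}},\qquad \hat a=a\left[\frac{1-\frac{\lambda}{\lambda+\rho}\,\omega_-}{1-b\,\omega_-}\right],$$ $u_-$ is the smallest solution $u\in[0,\infty)$ of the equation $$u-\frac{C\omega_-}{1-b\omega_-}\,u^{\Omega}=\hat a .$$ Moreover, with $$C_-=\frac{u_--a}{\omega_-u_-^{\Omega_-}},$$ the value function is given by $$g(y,-1)=\begin{cases}C_-\omega_-y^{\Omega_-},&0\le y\le u_-,\\ y-a,&y\ge u_-,\end{cases}\qquad g(y,+1)=\begin{cases}C_-y^{\Omega_-},&0\le y\le u_-,\\ by-a\frac{\lambda}{\lambda+\rho}+Cy^{\Omega},&u_-\le y\le u_+,\\ y-a,&y\ge u_+.\end{cases}$$ (That is, in the general representation of $g$ given in the context, $C_+=0$.)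
   Context: Fix real parameters $\lambda>0$, $\mu>0$, $\sigma>0$, $a>0$, $\rho>0$. Let $(\xi(t),t\ge 0)$ be the continuous-time Markov chain with (right-continuous) piecewise constant paths in $S=\{-1,+1\}$, which jumps from each state to the other at rate $\lambda$ (infinitesimal generator $\begin{pmatrix}-\lambda&\lambda\\ \lambda&-\lambda\end{pmatrix}$). For $Y_0\ge 0$, let $Y_t=Y_0\exp\left(\mu t+\sigma\int_0^t\xi(u)\,du\right)$, i.e. $dY_t/dt=(\mu+\sigma\xi(t))Y_t$. Let $(\mathcal F_t)$ be the completed natural filtration of $(\xi(t))$. $P_{y,s}$ and $E_{y,s}$ denote probability and expectation given $Y_0=y$, $\xi(0)=s$. The reward process is $X_t=e^{-\rho t}(Y_t-a)$ for $0\le t<\infty$, and $X_{+\infty}=0$. The value function is $g(y,s)=\sup_\tau E_{y,s}(X_\tau)$, the supremum being over all $(\mathcal F_t)$-stopping times $\tau$ with values in $[0,\infty]$. For $s=\pm1$, the set $\{y\in\mathbb R_+=[0,\infty): g(y,s)=y-a\}$ is an interval $[u_s,+\infty)$, which defines $u_\pm:=u_{\pm 1}\in[0,+\infty]$ (with $u_s=+\infty$ if the set is empty). (The condition $\rho>\mu-\lambda+\sqrt{\sigma^2+\lambda^2}$, which guarantees finiteness of $g$, is automatically satisfied when $\rho>\mu+\sigma$.) Constants: $b=\lambda(\lambda+\rho-\mu-\sigma)^{-1}$, $\Omega=(\lambda+\rho)(\mu+\sigma)^{-1}$, $$\Omega_\pm=\frac{(\lambda+\rho)\mu\pm\sqrt{\lambda^2\mu^2+\sigma^2(\rho^2+2\lambda\rho)}}{\mu^2-\sigma^2},\qquad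 \omega_\pm=1+\frac{\rho}{\lambda}-\frac{\mu+\sigma}{\lambda}\Omega_\pm.$$ General representation: there are constants $C_-,C_+,C$ such that $g(y,-1)=C_-\omega_-y^{\Omega_-}+C_+\omega_+y^{\Omega_+}$ and $g(y,+1)=C_-y^{\Omega_-}+C_+y^{\Omega_+}$ for $0\le y\le u_-$ (terms with $C_+=0$ being read as $0$), and $g(y,+1)=by-a\frac{\lambda}{\lambda+\rho}+Cy^{\Omega}$ for all finite $y$ with $u_-\le y\le u_+$. *)

theory Defs
  imports "HOL-Probability.Probability"
begin

section \<open>The two-state Markov chain\<close>

text \<open>The states are the real numbers \<open>-1\<close> and \<open>1\<close>. Matrices indexed by the states are functions
  of two state arguments that are only relevant on \<open>states\<close>.\<close>

definition states :: "real set" where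
  "states = {- 1, 1}"

definition generator :: "real \<Rightarrow> real \<Rightarrow> real \<Rightarrow> real" where
  "generator lam i j = (if i = j then - lam else lam)"

fun generator_pow :: "real \<Rightarrow> nat \<Rightarrow> real \<Rightarrow> real \<Rightarrow> real" where
  "generator_pow lam 0 i j = (if i = j then 1 else 0)"
| "generator_pow lam (Suc n) i j = (\<Sum>k\<in>states. generator lam i k * generator_pow lam n k j)"

text \<open>The transition matrices are the matrix exponentials of \<open>h\<close> times the generator.\<close>

definition transition :: "real \<Rightarrow> real \<Rightarrow> real \<Rightarrow> real \<Rightarrow> real" where
  "transition lam h i j = (\<Sum>n. h ^ n / fact n * generator_pow lam n i j)"

lemma generator_pow_closed_form:
  assumes "i \<in> states" "j \<in> states"
  shows "generator_pow lam n i j = (0 ^ n + (if i = j then 1 else - 1) * (- 2 * lam) ^ n) / 2"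
  using assms
proof (induction n arbitrary: i)
  case 0
  then show ?case by simp
next
  case (Suc n)
  have "(- 1 :: real) \<in> states" "(1 :: real) \<in> states"
    by (auto simp: states_def)
  then have IH: "generator_pow lam n (- 1) j = (0 ^ n + (if - 1 = j then 1 else - 1) * (- 2 * lam) ^ n) / 2"
    "generator_pow lam n 1 j = (0 ^ n + (if 1 = j then 1 else - 1) * (- 2 * lam) ^ n) / 2"
    using Suc.IH Suc.prems(2) by blast+
  have "generator_pow lam (Suc n) i j
      = generator lam i (- 1) * generator_pow lam n (- 1) j + generator lam i 1 * generator_pow lam n 1 j"
    by (simp add: states_def)
  also have "\<dots> = (if i = j then 1 else - 1) * (- 2 * lam) ^ Suc n / 2"
  proof -
    have "i = - 1 \<or> i = 1" "j = - 1 \<or> j = 1"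
      using Suc.prems by (simp_all add: states_def)
    then show ?thesis
      unfolding IH by (elim disjE) (simp_all add: generator_def algebra_simps add_divide_distrib diff_divide_distrib)
  qed
  finally show ?case by simp
qed

lemma transition_closed_form:
  assumes "i \<in> states" "j \<in> states"
  shows "transition lam h i j = (1 + (if i = j then 1 else - 1) * exp (- 2 * lam * h)) / 2"
proof -
  let ?s = "(if i = j then 1 else - 1) :: real"
  have z: "(\<lambda>n. 0 ^ n / fact n :: real) sums exp 0"
    using exp_converges[of "0 :: real"] by (simp add: divide_inverse mult.commute)
  have e: "(\<lambda>n. (- 2 * lam * h) ^ n / fact n) sums exp (- 2 * lam * h)"
    using exp_converges[of "- 2 * lam * h"] by (simp add: divide_inverse mult.commute)
  have "h ^ n / fact n * generator_pow lam n i j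
      = (0 ^ n / fact n + ?s * ((- 2 * lam * h) ^ n / fact n)) / 2" for n
  proof -
    have p: "(- 2 * lam * h) ^ n = h ^ n * (- 2 * lam) ^ n"
      by (subst power_mult_distrib) (rule mult.commute)
    have q: "h ^ n * 0 ^ n = (0 :: real) ^ n"
      by (cases n) simp_all
    have r: "x / f * ((z + s * w) / 2) = (x * z / f + s * (x * w / f)) / 2"
      for x f z s w :: real
      by (simp add: distrib_left add_divide_distrib)
    show ?thesis
      by (simp only: generator_pow_closed_form[OF assms] r p q)
  qed
  then have "(\<lambda>n. h ^ n / fact n * generator_pow lam n i j)
      sums ((exp 0 + ?s * exp (- 2 * lam * h)) / 2)"
    using sums_divide[OF sums_add[OF z sums_mult[OF e, of ?s]], of 2] by (simp only:)
  then show ?thesis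
    unfolding transition_def by (simp only: sums_unique[symmetric] exp_zero)
qed

text \<open>Time ranges over \<open>[0, \<infinity>]\<close>, so that \<^const>\<open>stopping_time\<close> applies to random times that may
  take the value \<open>\<infinity>\<close>; at time \<open>\<infinity>\<close> the \<open>\<sigma>\<close>-algebra is generated by the whole path. The process itself is indexed by
  real numbers, of which only the nonnegative ones matter.\<close>

definition natural_filtration :: "'a measure \<Rightarrow> (real \<Rightarrow> 'a \<Rightarrow> real) \<Rightarrow> ennreal \<Rightarrow> 'a measure" where
  "natural_filtration M \<xi> t =
     sigma (space M) {\<xi> u -` B \<inter> space M |u B. 0 \<le> u \<and> ennreal u \<le> t \<and> B \<in> sets borel}"

definition completed_filtration :: "'a measure \<Rightarrow> (real \<Rightarrow> 'a \<Rightarrow> real) \<Rightarrow> ennreal \<Rightarrow> 'a measure" where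
  "completed_filtration M \<xi> t =
     sigma (space M) (sets (natural_filtration M \<xi> t) \<union> null_sets (completion M))"

text \<open>\<open>switching_chain lam s M \<xi>\<close>: under the probability measure \<open>M\<close>, the process \<open>\<xi>\<close> is the chain
  started in \<open>s\<close>. In the fourth condition \<open>D\<close> contains the jump times up to time \<open>T\<close>.\<close>

definition switching_chain :: "real \<Rightarrow> real \<Rightarrow> 'a measure \<Rightarrow> (real \<Rightarrow> 'a \<Rightarrow> real) \<Rightarrow> bool" where
  "switching_chain lam s M \<xi> \<longleftrightarrow>
     prob_space M \<and>
     (\<forall>t\<ge>0. \<xi> t \<in> borel_measurable M \<and> (\<forall>\<omega>\<in>space M. \<xi> t \<omega> \<in> states)) \<and>
     (\<forall>\<omega>\<in>space M. \<forall>t\<ge>0. continuous (at_right t) (\<lambda>u. \<xi> u \<omega>)) \<and>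
     (\<forall>\<omega>\<in>space M. \<forall>T\<ge>0. \<exists>D. finite D \<and>
        (\<forall>u v. 0 \<le> u \<and> u \<le> v \<and> v \<le> T \<and> {u..v} \<inter> D = {} \<longrightarrow> \<xi> u \<omega> = \<xi> v \<omega>)) \<and>
     (AE \<omega> in M. \<xi> 0 \<omega> = s) \<and>
     (\<forall>t\<ge>0. \<forall>h\<ge>0. \<forall>j\<in>states. AE \<omega> in M.
        real_cond_exp M (natural_filtration M \<xi> (ennreal t))
          (indicator {\<omega> \<in> space M. \<xi> (t + h) \<omega> = j}) \<omega> = transition lam h (\<xi> t \<omega>) j)"

section \<open>The stopping problem\<close>

definition price :: "real \<Rightarrow> real \<Rightarrow> (real \<Rightarrow> 'a \<Rightarrow> real) \<Rightarrow> real \<Rightarrow> real \<Rightarrow> 'a \<Rightarrow> real" where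
  "price \<mu> \<sigma> \<xi> y t \<omega> = y * exp (\<mu> * t + \<sigma> * (LINT u:{0..t}|lborel. \<xi> u \<omega>))"

definition reward ::
  "real \<Rightarrow> real \<Rightarrow> real \<Rightarrow> real \<Rightarrow> (real \<Rightarrow> 'a \<Rightarrow> real) \<Rightarrow> real \<Rightarrow> ennreal \<Rightarrow> 'a \<Rightarrow> real" where
  "reward \<mu> \<sigma> \<rho> a \<xi> y t \<omega> =
     (if t = \<infinity> then 0
      else exp (- \<rho> * enn2real t) * (price \<mu> \<sigma> \<xi> y (enn2real t) \<omega> - a))"

text \<open>\<open>P s\<close> is the law under which the chain starts in \<open>s\<close>. The initial price \<open>y\<close> is deterministic,
  so it is a parameter of the reward and not of the measure.\<close>

definition value_function ::
  "real \<Rightarrow> real \<Rightarrow> real \<Rightarrow> real \<Rightarrow> (real \<Rightarrow> 'a measure) \<Rightarrow> (real \<Rightarrow> 'a \<Rightarrow> real) \<Rightarrow> real \<Rightarrow> real \<Rightarrow> ereal"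
where
  "value_function \<mu> \<sigma> \<rho> a P \<xi> y s =
     (SUP \<tau> \<in> {\<tau>. stopping_time (completed_filtration (P s) \<xi>) \<tau>}.
        ereal (\<integral>\<omega>. reward \<mu> \<sigma> \<rho> a \<xi> y (\<tau> \<omega>) \<omega> \<partial>completion (P s)))"

text \<open>The left end point \<open>u\<close> of the interval \<open>[u, \<infinity>)\<close> on which \<open>g \<cdot> s\<close> agrees with the immediate
  reward; it is \<open>\<infinity>\<close> if they agree nowhere.\<close>

definition threshold :: "real \<Rightarrow> (real \<Rightarrow> real \<Rightarrow> ereal) \<Rightarrow> real \<Rightarrow> ereal" where
  "threshold a g s = Inf (ereal ` {y. 0 \<le> y \<and> g y s = ereal (y - a)})"

section \<open>Constants\<close>

definition b_const :: "real \<Rightarrow> real \<Rightarrow> real \<Rightarrow> real \<Rightarrow> real" where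
  "b_const lam \<mu> \<sigma> \<rho> = lam / (lam + \<rho> - \<mu> - \<sigma>)"

definition Omega :: "real \<Rightarrow> real \<Rightarrow> real \<Rightarrow> real \<Rightarrow> real" where
  "Omega lam \<mu> \<sigma> \<rho> = (lam + \<rho>) / (\<mu> + \<sigma>)"

definition Omega_minus :: "real \<Rightarrow> real \<Rightarrow> real \<Rightarrow> real \<Rightarrow> real" where
  "Omega_minus lam \<mu> \<sigma> \<rho> =
     ((lam + \<rho>) * \<mu> - sqrt (lam\<^sup>2 * \<mu>\<^sup>2 + \<sigma>\<^sup>2 * (\<rho>\<^sup>2 + 2 * lam * \<rho>))) / (\<mu>\<^sup>2 - \<sigma>\<^sup>2)"

definition Omega_plus :: "real \<Rightarrow> real \<Rightarrow> real \<Rightarrow> real \<Rightarrow> real" where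
  "Omega_plus lam \<mu> \<sigma> \<rho> =
     ((lam + \<rho>) * \<mu> + sqrt (lam\<^sup>2 * \<mu>\<^sup>2 + \<sigma>\<^sup>2 * (\<rho>\<^sup>2 + 2 * lam * \<rho>))) / (\<mu>\<^sup>2 - \<sigma>\<^sup>2)"

definition omega_minus :: "real \<Rightarrow> real \<Rightarrow> real \<Rightarrow> real \<Rightarrow> real" where
  "omega_minus lam \<mu> \<sigma> \<rho> = 1 + \<rho> / lam - (\<mu> + \<sigma>) / lam * Omega_minus lam \<mu> \<sigma> \<rho>"

definition omega_plus :: "real \<Rightarrow> real \<Rightarrow> real \<Rightarrow> real \<Rightarrow> real" where
  "omega_plus lam \<mu> \<sigma> \<rho> = 1 + \<rho> / lam - (\<mu> + \<sigma>) / lam * Omega_plus lam \<mu> \<sigma> \<rho>"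

text \<open>The general form of the value function below the thresholds \<open>um\<close> (state \<open>-1\<close>) and \<open>up\<close>
  (state \<open>1\<close>), with constants \<open>Cm\<close>, \<open>Cp\<close>, \<open>C\<close>. Note that \<open>0 powr r = 0\<close> for every \<open>r\<close>.\<close>

definition general_representation ::
  "real \<Rightarrow> real \<Rightarrow> real \<Rightarrow> real \<Rightarrow> real \<Rightarrow> (real \<Rightarrow> real \<Rightarrow> ereal) \<Rightarrow> ereal \<Rightarrow> ereal \<Rightarrow>
   real \<Rightarrow> real \<Rightarrow> real \<Rightarrow> bool" where
  "general_representation lam \<mu> \<sigma> \<rho> a g um up Cm Cp C \<longleftrightarrow>
     (\<forall>y\<ge>0. ereal y \<le> um \<longrightarrow>
        g y (- 1) = ereal (Cm * omega_minus lam \<mu> \<sigma> \<rho> * y powr Omega_minus lam \<mu> \<sigma> \<rho>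
                         + Cp * omega_plus lam \<mu> \<sigma> \<rho> * y powr Omega_plus lam \<mu> \<sigma> \<rho>) \<and>
        g y 1 = ereal (Cm * y powr Omega_minus lam \<mu> \<sigma> \<rho> + Cp * y powr Omega_plus lam \<mu> \<sigma> \<rho>)) \<and>
     (\<forall>y\<ge>0. um \<le> ereal y \<and> ereal y \<le> up \<longrightarrow>
        g y 1 = ereal (b_const lam \<mu> \<sigma> \<rho> * y - a * (lam / (lam + \<rho>)) + C * y powr Omega lam \<mu> \<sigma> \<rho>))"

end

theory Submission
  imports Defs "HOL-Real_Asymp.Real_Asymp"
begin

text \<open>Let \<open>v\<close> be the claimed value function. Over a time step of length \<open>h\<close> the expected change of
  \<open>Z t = exp (- \<rho> * t) * v (Y t) (\<xi> t)\<close>, restricted to an event of the past, is at most \<open>O(h\<^sup>2)\<close>,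
  and at least \<open>- O(h\<^sup>2)\<close> if \<open>Y t\<close> lies below the threshold of the state \<open>\<xi> t\<close> on that event. The
  Markov property at a single time suffices for this: replacing \<open>Y\<close> over the step by the flow with
  frozen state costs the integral of \<open>E \<bar>\<xi> u - \<xi> t\<bar>\<close> over the step, which is \<open>O(h\<^sup>2)\<close>. Summing over
  a grid, every stopping time earns at most \<open>v\<close>, and stopping at the first grid point in the stopping
  region earns \<open>v\<close> up to errors that vanish with \<open>h\<close>.

  On the analytic side, the lower threshold is a root of a concave function \<open>H\<close>, and for the smallest
  root the derivative of \<open>H\<close> is nonnegative. This is equivalent to the left slope of \<open>v\<close> in state \<open>-1\<close>
  being at most 1 at the threshold, which gives both \<open>v > y - a\<close> below it and the generator inequality
  above it. Smooth fit is not needed in state \<open>-1\<close>, because the drift \<open>\<mu> - \<sigma>\<close> is negative there.\<close>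

section \<open>Calculus along exponential flows\<close>

text \<open>The chain is given only through its transition probabilities relative to the natural
  filtration, so neither a martingale problem nor a strong Markov property is at hand. On a grid
  this is no obstacle: \<open>k * h < \<tau>\<close> is an event of the past at time
  \<open>k * h\<close>, and errors \<open>K * h\<^sup>2\<close> over \<open>T / h\<close> steps add
  up to \<open>T * K * h\<close>. As \<open>K\<close> depends on the horizon \<open>T\<close>, the
  mesh must tend to 0 before \<open>T\<close> grows. Truncation at \<open>T\<close> is harmless
  because \<open>\<rho> > \<mu> + \<sigma>\<close> makes the discounted price decay at a
  deterministic rate.

  The constants come from matching: in value and slope at \<open>up\<close>, but only in value at
  the lower threshold, where the component of state -1 may have a kink. All analytic estimates
  therefore concern continuous functions that are differentiable off \<open>{um, up}\<close>. Since
  \<open>\<mu> < \<sigma>\<close>, the exponent \<open>Omega_minus\<close> exceeds 1 and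
  \<open>Omega_plus\<close> is negative; that the second coefficient vanishes is read off from the
  value function once it is known.\<close>

lemma abs_exp_diff_le: "\<bar>exp p - exp q\<bar> \<le> max (exp p) (exp q) * \<bar>p - q\<bar>" for p q :: real
proof -
  have *: "exp x - exp y \<le> exp x * (x - y)" for x y :: real
    using mult_left_mono[OF exp_ge_add_one_self[of "y - x"], of "exp x"]
    by (simp add: exp_diff algebra_simps)
  show ?thesis
    using *[of p q] *[of q p] exp_le_cancel_iff[of p q] exp_le_cancel_iff[of q p] by (cases "p \<le> q") (auto simp: max_def abs_if not_le)
qed

text \<open>The candidate is only piecewise smooth, so the mean value bound must survive finitely
  many exceptional points; splitting at one of them and adding the two estimates is the induction
  step. The bound is one-sided because the generator inequalities are.\<close>

lemma mvt_upper_finite: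
  fixes w :: "real \<Rightarrow> real"
  assumes "finite S" "p \<le> q" "continuous_on {p..q} w"
    and "\<And>t. t \<in> {p<..<q} - S \<Longrightarrow> \<exists>D. (w has_real_derivative D) (at t) \<and> D \<le> C"
  shows "w q - w p \<le> C * (q - p)"
  using assms
proof (induction S arbitrary: p q rule: finite_induct)
  case empty
  show ?case
  proof (cases "p = q")
    case False
    then have "p < q" using empty by simp
    moreover have "w differentiable (at x)" if "p < x" "x < q" for x
      using empty(3)[of x] that by (auto simp: real_differentiable_def)
    ultimately obtain l z where z: "p < z" "z < q" "(w has_real_derivative l) (at z)" "w q - w p = (q - p) * l"
      using MVT[of p q w] empty(2) by auto
    obtain D where D: "(w has_real_derivative D) (at z)" "D \<le> C"
      using empty(3)[of z] z by auto
    have "l = D" using DERIV_unique[OF z(3) D(1)] .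
    then show ?thesis using z(4) D(2) \<open>p < q\<close> by (simp add: mult.commute)
  qed simp
next
  case (insert c S)
  show ?case
  proof (cases "p < c \<and> c < q")
    case True
    have "w c - w p \<le> C * (c - p)"
      using True insert.prems by (intro insert.IH) (auto intro: continuous_on_subset)
    moreover have "w q - w c \<le> C * (q - c)"
      using True insert.prems by (intro insert.IH) (auto intro: continuous_on_subset)
    ultimately show ?thesis by (simp add: algebra_simps)
  next
    case False
    then show ?thesis using insert.prems by (intro insert.IH) auto
  qed
qed

lemma lipschitz_finite:
  fixes w w' :: "real \<Rightarrow> real"
  assumes S: "finite S" and cont: "continuous_on {0..} w"
    and deriv: "\<And>x. 0 < x \<Longrightarrow> x \<notin> S \<Longrightarrow> (w has_real_derivative w' x) (at x)"
    and bound: "\<And>x. 0 < x \<Longrightarrow> x \<notin> S \<Longrightarrow> \<bar>w' x\<bar> \<le> L"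
    and x: "0 \<le> x" "0 \<le> x'"
  shows "\<bar>w x - w x'\<bar> \<le> L * \<bar>x - x'\<bar>"
proof -
  have *: "\<bar>w q - w p\<bar> \<le> L * (q - p)" if pq: "0 \<le> p" "p \<le> q" for p q
  proof -
    have c: "continuous_on {p..q} w" using cont pq by (auto intro: continuous_on_subset)
    have "w q - w p \<le> L * (q - p)"
      using pq bound by (intro mvt_upper_finite[OF S pq(2) c]) (auto intro!: exI deriv simp: abs_le_iff)
    moreover have "(- w q) - (- w p) \<le> L * (q - p)"
    proof (intro mvt_upper_finite[OF S pq(2) continuous_on_minus[OF c]])
      fix t assume t: "t \<in> {p<..<q} - S"
      then have "((\<lambda>x. - w x) has_real_derivative - w' t) (at t)" "- w' t \<le> L"
        using DERIV_minus[OF deriv[of t]] bound[of t] pq by auto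
      then show "\<exists>D. ((\<lambda>x. - w x) has_real_derivative D) (at t) \<and> D \<le> L" by blast
    qed
    ultimately show ?thesis by (simp add: abs_le_iff)
  qed
  show ?thesis
    using *[of x x'] *[of x' x] x by (cases "x \<le> x'") (auto simp: abs_minus_commute)
qed

text \<open>Along \<open>t \<mapsto> x * exp (c * t)\<close> the derivative of \<open>\<phi>\<close>
  is \<open>c * X * \<phi>' X\<close>. A differential inequality with right-hand side
  \<open>R\<close> thus integrates to \<open>h * R x\<close>, and freezing \<open>R\<close> at the
  start costs \<open>L * \<bar>X - x\<bar>\<close>, which is \<open>O(h)\<close> over a time of
  length \<open>h\<close>. The slack \<open>E * h\<close> admits a defect of the same order, as
  arises when a flow crosses a threshold within the step. Negated functions give lower
  bounds.\<close>

lemma flow_step: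
  fixes \<phi> \<phi>' R :: "real \<Rightarrow> real"
  assumes S: "finite S" and c: "c \<noteq> 0" and cont: "continuous_on {0..} \<phi>"
    and deriv: "\<And>X. 0 < X \<Longrightarrow> X \<notin> S \<Longrightarrow> (\<phi> has_real_derivative \<phi>' X) (at X)"
    and lip: "\<And>X. 0 \<le> X \<Longrightarrow> \<bar>R X - R x\<bar> \<le> L * \<bar>X - x\<bar>" and L: "0 \<le> L"
    and x: "0 < x" "x \<le> B" and h: "0 \<le> h" "h \<le> 1"
    and ineq: "\<And>t. 0 < t \<Longrightarrow> t < h \<Longrightarrow> x * exp (c * t) \<notin> S \<Longrightarrow>
       c * (x * exp (c * t)) * \<phi>' (x * exp (c * t)) \<le> R (x * exp (c * t)) + E * h"
  shows "\<phi> (x * exp (c * h)) \<le> \<phi> x + h * R x + (E + L * (B * exp \<bar>c\<bar> * \<bar>c\<bar>)) * h\<^sup>2"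
proof -
  define w where "w t = \<phi> (x * exp (c * t))" for t
  \<comment> \<open>With \<open>c \<noteq> 0\<close> and \<open>x > 0\<close> the flow meets every
    kink at most once, so the set of exceptional times is finite.\<close>
  have "inj (\<lambda>t. x * exp (c * t))" using x c by (auto simp: inj_on_def)
  then have fin: "finite ((\<lambda>t. x * exp (c * t)) -` S)" using S by (rule finite_vimageI[rotated])
  have "w h - w 0 \<le> (R x + (E + L * (B * exp \<bar>c\<bar> * \<bar>c\<bar>)) * h) * (h - 0)"
  proof (rule mvt_upper_finite[OF fin h(1)])
    show "continuous_on {0..h} w"
      unfolding w_def using x
      by (intro continuous_on_compose2[OF cont] continuous_intros) auto
    fix t assume t: "t \<in> {0<..<h} - (\<lambda>t. x * exp (c * t)) -` S"
    define X where "X = x * exp (c * t)"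
    have X: "0 < X" "X \<notin> S" using t x by (auto simp: X_def)
    have g: "((\<lambda>t. x * exp (c * t)) has_real_derivative x * (exp (c * t) * c)) (at t)"
      by (auto intro!: derivative_eq_intros)
    have "(\<phi> has_real_derivative \<phi>' X) (at ((\<lambda>t. x * exp (c * t)) t))"
      using deriv[OF X] by (simp add: X_def)
    from DERIV_chain2[where g = "\<lambda>t. x * exp (c * t)", OF this g]
    have "(w has_real_derivative \<phi>' X * (x * (exp (c * t) * c))) (at t)"
      by (simp add: w_def[abs_def])
    then have dw: "(w has_real_derivative c * X * \<phi>' X) (at t)"
      by (simp add: X_def mult_ac)
    have ct: "\<bar>c * t\<bar> \<le> \<bar>c\<bar> * h" "\<bar>c\<bar> * h \<le> \<bar>c\<bar>"
      using t h by (auto simp: abs_mult intro!: mult_left_mono mult_left_le)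
    have "\<bar>exp (c * t) - exp 0\<bar> \<le> max (exp (c * t)) (exp 0) * \<bar>c * t - 0\<bar>"
      by (rule abs_exp_diff_le)
    also have "\<dots> \<le> exp \<bar>c\<bar> * (\<bar>c\<bar> * h)"
    proof (rule mult_mono)
      have "c * t \<le> \<bar>c\<bar>" using ct by linarith
      then show "max (exp (c * t)) (exp 0) \<le> exp \<bar>c\<bar>" by simp
    qed (use ct h in auto)
    finally have "\<bar>exp (c * t) - 1\<bar> \<le> exp \<bar>c\<bar> * (\<bar>c\<bar> * h)" by simp
    then have "x * \<bar>exp (c * t) - 1\<bar> \<le> B * (exp \<bar>c\<bar> * (\<bar>c\<bar> * h))"
      using x h by (intro mult_mono) auto
    moreover have "\<bar>X - x\<bar> = x * \<bar>exp (c * t) - 1\<bar>"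
    proof -
      have "X - x = x * (exp (c * t) - 1)" by (simp add: X_def algebra_simps)
      then show ?thesis using x by (simp add: abs_mult)
    qed
    ultimately have "\<bar>X - x\<bar> \<le> B * exp \<bar>c\<bar> * \<bar>c\<bar> * h" by (simp add: mult_ac)
    then have "L * \<bar>X - x\<bar> \<le> L * (B * exp \<bar>c\<bar> * \<bar>c\<bar> * h)" using L by (rule mult_left_mono)
    then have "R X \<le> R x + L * (B * exp \<bar>c\<bar> * \<bar>c\<bar>) * h"
      using lip[of X] X(1) by (simp add: mult.assoc)
    moreover have "c * X * \<phi>' X \<le> R X + E * h"
      using ineq[of t] t X(2) unfolding X_def by auto
    ultimately have "c * X * \<phi>' X \<le> R x + (E + L * (B * exp \<bar>c\<bar> * \<bar>c\<bar>)) * h"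
      by (simp add: algebra_simps)
    with dw show "\<exists>D. (w has_real_derivative D) (at t) \<and> D \<le> R x + (E + L * (B * exp \<bar>c\<bar> * \<bar>c\<bar>)) * h"
      by blast
  qed
  then show ?thesis by (simp add: w_def power2_eq_square algebra_simps)
qed

text \<open>The condition \<open>k < n\<close> says that stopping has not occurred by step
  \<open>k\<close>. As an indicator it is an event of the past at that step, so each summand can be
  estimated separately.\<close>

lemma sum_telescope_stopped:
  fixes f :: "nat \<Rightarrow> real"
  assumes "n \<le> N"
  shows "(\<Sum>k<N. if k < n then f (Suc k) - f k else 0) = f n - f 0"
proof -
  have "(\<Sum>k<N. if k < n then f (Suc k) - f k else 0) = (\<Sum>k<n. f (Suc k) - f k)"
    using assms by (intro sum.mono_neutral_cong_right) auto
  then show ?thesis by (simp add: sum_lessThan_telescope)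
qed

text \<open>Stated for an arbitrary probability space because it is applied both to \<open>M\<close>
  and to its completion.\<close>

lemma (in prob_space) integral_add_sum:
  fixes f :: "'a \<Rightarrow> real" and c :: real
  assumes f: "integrable M f" and g: "\<And>k. k < (n :: nat) \<Longrightarrow> integrable M (g k)"
  shows "integrable M (\<lambda>x. f x + (\<Sum>k<n. g k x) + c)"
    and "(\<integral>x. f x + (\<Sum>k<n. g k x) + c \<partial>M) = (\<integral>x. f x \<partial>M) + (\<Sum>k<n. \<integral>x. g k x \<partial>M) + c"
proof -
  have s: "integrable M (\<lambda>x. \<Sum>k<n. g k x)"
    using g by (intro Bochner_Integration.integrable_sum) auto
  show "integrable M (\<lambda>x. f x + (\<Sum>k<n. g k x) + c)"
    using f s by simp
  have "(\<integral>x. f x + (\<Sum>k<n. g k x) + c \<partial>M) = (\<integral>x. f x \<partial>M) + (\<integral>x. (\<Sum>k<n. g k x) \<partial>M) + c"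
    using f s by (simp add: prob_space)
  also have "(\<integral>x. (\<Sum>k<n. g k x) \<partial>M) = (\<Sum>k<n. \<integral>x. g k x \<partial>M)"
    using g by (intro Bochner_Integration.integral_sum) auto
  finally show "(\<integral>x. f x + (\<Sum>k<n. g k x) + c \<partial>M) = (\<integral>x. f x \<partial>M) + (\<Sum>k<n. \<integral>x. g k x \<partial>M) + c" .
qed

section \<open>The switching chain\<close>

lemma mem_states_iff: "s \<in> states \<longleftrightarrow> s = -1 \<or> s = 1"
  by (auto simp: states_def)

locale switching =
  fixes lam s :: real and M :: "'a measure" and \<xi> :: "real \<Rightarrow> 'a \<Rightarrow> real"
  assumes chain: "switching_chain lam s M \<xi>" and lam_pos: "lam > 0"
begin

lemma prob_space_M: "prob_space M"
  using chain by (simp add: switching_chain_def)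

sublocale prob_space M
  by (rule prob_space_M)

lemma xi_measurable: "0 \<le> t \<Longrightarrow> \<xi> t \<in> borel_measurable M"
  using chain by (simp add: switching_chain_def)

lemma xi_states: "0 \<le> t \<Longrightarrow> \<omega> \<in> space M \<Longrightarrow> \<xi> t \<omega> \<in> states"
  using chain by (simp add: switching_chain_def)

lemma abs_xi: "0 \<le> t \<Longrightarrow> \<omega> \<in> space M \<Longrightarrow> \<bar>\<xi> t \<omega>\<bar> = 1"
  using xi_states[of t \<omega>] by (auto simp: mem_states_iff)

lemma xi_right_tendsto:
  assumes "0 \<le> t" "\<omega> \<in> space M"
  shows "((\<lambda>u. \<xi> u \<omega>) \<longlongrightarrow> \<xi> t \<omega>) (at t within {t..})"
proof -
  have "continuous (at_right t) (\<lambda>u. \<xi> u \<omega>)"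
    using chain assms by (simp add: switching_chain_def)
  then have "((\<lambda>u. \<xi> u \<omega>) \<longlongrightarrow> \<xi> t \<omega>) (at_right t)"
    by (simp add: continuous_within)
  then show ?thesis
    by (simp add: at_within_Ici_at_right)
qed

lemma AE_xi_0: "AE \<omega> in M. \<xi> 0 \<omega> = s"
  using chain by (simp add: switching_chain_def)

section \<open>The natural filtration and measurability of the paths\<close>

abbreviation F :: "real \<Rightarrow> 'a measure" where
  "F t \<equiv> natural_filtration M \<xi> (ennreal t)"

lemma space_natural_filtration [simp]: "space (natural_filtration M \<xi> t) = space M"
  unfolding natural_filtration_def by (intro space_measure_of) auto

lemma sets_natural_filtration:
  "sets (natural_filtration M \<xi> t) =
     sigma_sets (space M) {\<xi> u -` B \<inter> space M |u B. 0 \<le> u \<and> ennreal u \<le> t \<and> B \<in> sets borel}"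
  unfolding natural_filtration_def by (intro sets_measure_of) auto

lemma sets_natural_filtration_le: "sets (natural_filtration M \<xi> t) \<subseteq> sets M"
  unfolding sets_natural_filtration
  by (intro sets.sigma_sets_subset) (use xi_measurable in \<open>auto intro: measurable_sets\<close>)

lemma sets_natural_filtration_mono:
  "t \<le> t' \<Longrightarrow> sets (natural_filtration M \<xi> t) \<subseteq> sets (natural_filtration M \<xi> t')"
  unfolding sets_natural_filtration by (intro sigma_sets_mono') (auto intro: order_trans)

lemma subalgebra_F: "subalgebra M (F t)"
  using sets_natural_filtration_le by (simp add: subalgebra_def)

lemma measurable_F_imp: "f \<in> borel_measurable (F t) \<Longrightarrow> f \<in> borel_measurable M"
  by (rule measurable_from_subalg[OF subalgebra_F])

lemma id_measurable_F: "(\<lambda>\<omega>. \<omega>) \<in> measurable M (F t)"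
proof (rule measurableI)
  fix B assume "B \<in> sets (F t)"
  then have "B \<in> sets M" using sets_natural_filtration_le by blast
  then show "(\<lambda>\<omega>. \<omega>) -` B \<inter> space M \<in> sets M" by (simp add: sets.Int)
qed simp

lemma xi_measurable_F:
  assumes "0 \<le> u" "u \<le> t"
  shows "\<xi> u \<in> borel_measurable (F t)"
proof (rule measurableI)
  fix B :: "real set" assume "B \<in> sets borel"
  then show "\<xi> u -` B \<inter> space (F t) \<in> sets (F t)"
    unfolding sets_natural_filtration using assms
    by (auto intro!: sigma_sets.Basic exI[of _ u] exI[of _ B] ennreal_leI)
qed auto

text \<open>Right continuity makes the chain progressively measurable: \<open>r n u\<close>
  approximates \<open>u\<close> from above by multiples of \<open>1 / (n + 1)\<close>, so each
  approximant takes countably many time values. Clamping by \<open>c\<close> to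
  \<open>[0, t]\<close> keeps every time in the range known at \<open>t\<close> and, being monotone,
  preserves the approach from the right.\<close>

lemma xi_joint_measurable:
  assumes t: "0 \<le> t"
  shows "(\<lambda>(\<omega>, u). \<xi> (max 0 (min t u)) \<omega>) \<in> borel_measurable (F t \<Otimes>\<^sub>M borel)"
proof -
  define c where "c u = max 0 (min t u)" for u
  define r where "r n u = real_of_int \<lceil>real (Suc n) * u\<rceil> / real (Suc n)" for n u
  have c: "0 \<le> c u" "c u \<le> t" for u
    using t by (simp_all add: c_def)
  have r_ge: "u \<le> r n u" for n u
    unfolding r_def by (simp add: field_simps)
  have r_le: "r n u \<le> u + 1 / real (Suc n)" for n u
  proof -
    have "real_of_int \<lceil>real (Suc n) * u\<rceil> \<le> real (Suc n) * u + 1" by linarith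
    then have "r n u \<le> (real (Suc n) * u + 1) / real (Suc n)"
      unfolding r_def by (intro divide_right_mono) auto
    then show ?thesis by (simp add: add_divide_distrib)
  qed
  have r_lim: "(\<lambda>n. r n u) \<longlonglongrightarrow> u" for u
  proof (rule tendsto_sandwich[of "\<lambda>_. u" _ _ "\<lambda>n. u + 1 / real (Suc n)"])
    show "(\<lambda>n. u + 1 / real (Suc n)) \<longlonglongrightarrow> u"
      using tendsto_add[OF tendsto_const[of u] LIMSEQ_Suc[OF lim_1_over_n]] by simp
  qed (intro always_eventually allI r_ge r_le tendsto_const)+
  have "(\<lambda>p. \<xi> (c (snd p)) (fst p)) \<in> borel_measurable (F t \<Otimes>\<^sub>M borel)"
  proof (rule borel_measurable_LIMSEQ_real)
    fix p assume p: "p \<in> space (F t \<Otimes>\<^sub>M (borel :: real measure))"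
    then have w: "fst p \<in> space M" by (auto simp: space_pair_measure)
    have "(\<lambda>n. c (r n (snd p))) \<longlonglongrightarrow> c (snd p)"
      unfolding c_def by (intro tendsto_intros r_lim)
    moreover have "\<forall>n. c (r n (snd p)) \<in> {c (snd p)..}"
      using r_ge[of "snd p"] by (auto simp: c_def max_def min_def intro: order_trans)
    ultimately show "(\<lambda>n. \<xi> (c (r n (snd p))) (fst p)) \<longlonglongrightarrow> \<xi> (c (snd p)) (fst p)"
      using xi_right_tendsto[OF c(1) w, of "snd p"]
      by (intro continuous_within_tendsto_compose[where f = "\<lambda>u. \<xi> u (fst p)"])
         (auto simp: continuous_within)
  next
    fix n
    have "(\<lambda>p. \<xi> (c (real_of_int i / real (Suc n))) (fst p)) \<in> borel_measurable (F t \<Otimes>\<^sub>M borel)" for i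
      by (rule measurable_compose[OF measurable_fst xi_measurable_F]) (use c in auto)
    moreover have "(\<lambda>p. \<lceil>real (Suc n) * snd p\<rceil>) \<in> measurable (F t \<Otimes>\<^sub>M borel) (count_space UNIV)"
      by measurable
    ultimately show "(\<lambda>p. \<xi> (c (r n (snd p))) (fst p)) \<in> borel_measurable (F t \<Otimes>\<^sub>M borel)"
      unfolding r_def by (rule measurable_compose_countable)
  qed
  then show ?thesis by (simp add: c_def case_prod_beta')
qed


section \<open>The time integral of the chain\<close>

definition I :: "real \<Rightarrow> 'a \<Rightarrow> real" where
  "I t \<omega> = (LINT u:{0..t}|lborel. \<xi> u \<omega>)"

lemma xi_path_measurable:
  assumes "\<omega> \<in> space M" "0 \<le> b"
  shows "(\<lambda>u. \<xi> (max 0 (min b u)) \<omega>) \<in> borel_measurable borel"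
  using measurable_compose[OF measurable_Pair1'[of \<omega> "F b" borel] xi_joint_measurable[OF assms(2)]] assms(1)
  by simp

lemma path_integrable:
  assumes w: "\<omega> \<in> space M" and "0 \<le> a"
  shows "set_integrable lborel {a<..b} (\<lambda>u. \<xi> u \<omega> - c :: real)"
proof (cases "a \<le> b")
  case True
  then have b: "0 \<le> b" using assms(2) by simp
  note [measurable] = xi_path_measurable[OF w b]
  have eq: "indicator {a<..b} u *\<^sub>R (\<xi> u \<omega> - c) = indicator {a<..b} u *\<^sub>R (\<xi> (max 0 (min b u)) \<omega> - c)" for u
    using assms(2) by (auto simp: indicator_def max_def min_def)
  show ?thesis
    unfolding set_integrable_def eq
  proof (rule Bochner_Integration.integrable_bound)
    show "integrable lborel (\<lambda>u. indicator {a<..b} u *\<^sub>R (1 + \<bar>c\<bar>))"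
      using True by (intro integrable_scaleR_left) simp
    have le: "\<bar>\<xi> (max 0 (min b u)) \<omega> - c\<bar> \<le> 1 + \<bar>c\<bar>" for u
      using abs_xi[of "max 0 (min b u)" \<omega>] w by simp
    show "AE u in lborel. norm (indicator {a<..b} u *\<^sub>R (\<xi> (max 0 (min b u)) \<omega> - c)) \<le> norm (indicator {a<..b} u *\<^sub>R (1 + \<bar>c\<bar>))"
      using mult_left_mono[OF le indicator_pos_le] by (intro AE_I2) (simp add: abs_mult)
  qed measurable
qed (simp add: set_integrable_def)

lemma I_eq:
  assumes "0 \<le> t"
  shows "I t \<omega> = (LINT u|lborel. indicator {0..t} u * \<xi> (max 0 (min t u)) \<omega>)"
  unfolding I_def set_lebesgue_integral_def
  by (intro Bochner_Integration.integral_cong) (auto simp: indicator_def max_def min_def)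

lemma I_measurable_F:
  assumes t: "0 \<le> t"
  shows "I t \<in> borel_measurable (F t)"
proof -
  have [measurable]: "(\<lambda>p. \<xi> (max 0 (min t (snd p))) (fst p)) \<in> borel_measurable (F t \<Otimes>\<^sub>M borel)"
    using xi_joint_measurable[OF t] by (simp add: case_prod_beta')
  have "(\<lambda>\<omega>. LINT u|lborel. indicator {0..t} u * \<xi> (max 0 (min t u)) \<omega>) \<in> borel_measurable (F t)"
    by (rule lborel.borel_measurable_lebesgue_integral) (simp add: case_prod_beta')
  then show ?thesis
    using I_eq[OF t] by (simp cong: measurable_cong)
qed

lemma I_diff:
  assumes w: "\<omega> \<in> space M" and t: "0 \<le> t" "t \<le> t'"
  shows "I t' \<omega> - I t \<omega> = (LINT u:{t<..t'}|lborel. \<xi> u \<omega>)"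
proof -
  \<comment> \<open>Removing the null point 0 leaves half-open intervals, which split disjointly at
    \<open>t\<close>.\<close>
  have [simp]: "(LINT u:{0..r}|lborel. \<xi> u \<omega>) = (LINT u:{0<..r}|lborel. \<xi> u \<omega>)" for r
    by (rule set_integral_discrete_difference[of "{0}"]) auto
  have "{0<..t'} = {0<..t} \<union> {t<..t'}" using t by auto
  then have "(LINT u:{0<..t'}|lborel. \<xi> u \<omega>) = (LINT u:{0<..t}|lborel. \<xi> u \<omega>) + (LINT u:{t<..t'}|lborel. \<xi> u \<omega>)"
    using path_integrable[OF w, of 0 t 0] path_integrable[OF w, of t t' 0] t
    by (simp add: set_integral_Un)
  then show ?thesis by (simp add: I_def)
qed

lemma abs_I_increment_le:
  assumes w: "\<omega> \<in> space M" and t: "0 \<le> t" "t \<le> t'"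
  shows "\<bar>I t' \<omega> - I t \<omega> - (t' - t) * c\<bar> \<le> (LINT u:{t<..t'}|lborel. \<bar>\<xi> u \<omega> - c\<bar>)"
proof -
  have "(LINT u:{t<..t'}|lborel. \<xi> u \<omega> - c) = I t' \<omega> - I t \<omega> - (t' - t) * c"
    using path_integrable[OF w, of t t' 0] t
    by (subst set_integral_diff) (auto simp: I_diff[OF w t] set_integrable_def set_integral_const)
  then show ?thesis
    using set_integral_norm_bound[OF path_integrable[OF w t(1), of t' c]] by simp
qed

lemma abs_I_diff_le:
  assumes w: "\<omega> \<in> space M" and t: "0 \<le> t" "t \<le> t'"
  shows "\<bar>I t' \<omega> - I t \<omega>\<bar> \<le> t' - t"
proof -
  have "(LINT u:{t<..t'}|lborel. \<bar>\<xi> u \<omega>\<bar>) = (LINT u:{t<..t'}|lborel. 1)"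
    using abs_xi[OF _ w] t by (intro set_lebesgue_integral_cong) auto
  then show ?thesis
    using abs_I_increment_le[OF w t, of 0] t by (simp add: set_integral_const)
qed


section \<open>The Markov property at one future time\<close>

text \<open>The chain is specified by conditional probabilities of single states. Splitting
  according to the state at \<open>t + h\<close> extends this to payoffs \<open>g j\<close> that
  also depend on the past: each \<open>g j\<close> is \<open>F t\<close>-measurable and moves
  through the conditional expectation, while the bound \<open>K\<close> supplies
  integrability.\<close>

lemma markov:
  assumes t: "0 \<le> t" "0 \<le> h"
    and g: "\<And>j. j \<in> states \<Longrightarrow> g j \<in> borel_measurable (F t)"
    and bd: "\<And>j \<omega>. j \<in> states \<Longrightarrow> \<omega> \<in> space M \<Longrightarrow> \<bar>g j \<omega>\<bar> \<le> K"
  shows "(\<integral>\<omega>. g (\<xi> (t + h) \<omega>) \<omega> \<partial>M) = (\<integral>\<omega>. (\<Sum>j\<in>states. transition lam h (\<xi> t \<omega>) j * g j \<omega>) \<partial>M)"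
    and "integrable M (\<lambda>\<omega>. g (\<xi> (t + h) \<omega>) \<omega>)"
    and "integrable M (\<lambda>\<omega>. \<Sum>j\<in>states. transition lam h (\<xi> t \<omega>) j * g j \<omega>)"
proof -
  interpret finite_measure_subalgebra M "F t"
    by unfold_locales (rule subalgebra_F)
  define e where "e j = {\<omega> \<in> space M. \<xi> (t + h) \<omega> = j}" for j
  have [measurable]: "\<xi> (t + h) \<in> borel_measurable M" "\<xi> t \<in> borel_measurable M"
    using t by (auto intro: xi_measurable)
  have e [measurable]: "e j \<in> sets M" for j
    unfolding e_def by measurable
  have fin: "finite states" by (simp add: states_def)
  have gM: "g j \<in> borel_measurable M" if "j \<in> states" for j
    using g[OF that] by (rule measurable_F_imp)
  have int: "integrable M (\<lambda>\<omega>. g j \<omega> * indicator (e j) \<omega>)" if j: "j \<in> states" for j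
    using gM[OF j] bd[OF j] order_trans[OF abs_ge_zero bd[OF j]]
    by (intro integrable_const_bound[of _ K] AE_I2) (auto simp: abs_mult indicator_def)
  have AEc: "AE \<omega> in M. g j \<omega> * real_cond_exp M (F t) (indicator (e j)) \<omega> = transition lam h (\<xi> t \<omega>) j * g j \<omega>"
    if j: "j \<in> states" for j
  proof -
    have "AE \<omega> in M. real_cond_exp M (F t) (indicator (e j)) \<omega> = transition lam h (\<xi> t \<omega>) j"
      using chain t j unfolding switching_chain_def e_def by blast
    then show ?thesis by eventually_elim simp
  qed
  \<comment> \<open>Measurability in the real state argument of \<open>transition\<close> is not
    evident from its series; on \<open>space M\<close> the closed form replaces it.\<close>
  have tm: "(\<lambda>\<omega>. transition lam h (\<xi> t \<omega>) j * g j \<omega>) \<in> borel_measurable M" if j: "j \<in> states" for j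
  proof -
    have "(\<lambda>\<omega>. (1 + (if \<xi> t \<omega> = j then 1 else - 1) * exp (- 2 * lam * h)) / 2 * g j \<omega>) \<in> borel_measurable M"
      using gM[OF j] by measurable
    then show ?thesis
      by (rule measurable_cong[THEN iffD1, rotated])
         (simp add: transition_closed_form[OF xi_states[OF t(1)] j])
  qed
  have int2: "integrable M (\<lambda>\<omega>. transition lam h (\<xi> t \<omega>) j * g j \<omega>)"
    and eq: "(\<integral>\<omega>. transition lam h (\<xi> t \<omega>) j * g j \<omega> \<partial>M) = (\<integral>\<omega>. g j \<omega> * indicator (e j) \<omega> \<partial>M)"
    if j: "j \<in> states" for j
  proof -
    note c = real_cond_exp_intg[OF int[OF j] g[OF j], simplified]
    have m: "(\<lambda>\<omega>. g j \<omega> * real_cond_exp M (F t) (indicator (e j)) \<omega>) \<in> borel_measurable M"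
      using gM[OF j] by measurable
    show "integrable M (\<lambda>\<omega>. transition lam h (\<xi> t \<omega>) j * g j \<omega>)"
      using integrable_cong_AE[OF m tm[OF j] AEc[OF j]] c(1) by simp
    show "(\<integral>\<omega>. transition lam h (\<xi> t \<omega>) j * g j \<omega> \<partial>M) = (\<integral>\<omega>. g j \<omega> * indicator (e j) \<omega> \<partial>M)"
      using integral_cong_AE[OF m tm[OF j] AEc[OF j]] c(2) by simp
  qed
  have dec: "g (\<xi> (t + h) \<omega>) \<omega> = (\<Sum>j\<in>states. g j \<omega> * indicator (e j) \<omega>)" if "\<omega> \<in> space M" for \<omega>
  proof -
    have "(\<Sum>j\<in>states. g j \<omega> * indicator (e j) \<omega>) = (\<Sum>j\<in>states. if \<xi> (t + h) \<omega> = j then g j \<omega> else 0)"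
      using that by (intro sum.cong) (auto simp: e_def)
    then show ?thesis
      using xi_states[of "t + h" \<omega>] that t fin by simp
  qed
  show "integrable M (\<lambda>\<omega>. g (\<xi> (t + h) \<omega>) \<omega>)"
    using dec int by (simp cong: Bochner_Integration.integrable_cong)
  show "integrable M (\<lambda>\<omega>. \<Sum>j\<in>states. transition lam h (\<xi> t \<omega>) j * g j \<omega>)"
    using int2 by simp
  show "(\<integral>\<omega>. g (\<xi> (t + h) \<omega>) \<omega> \<partial>M) = (\<integral>\<omega>. (\<Sum>j\<in>states. transition lam h (\<xi> t \<omega>) j * g j \<omega>) \<partial>M)"
    using dec int int2 eq
    by (simp cong: Bochner_Integration.integral_cong)
qed

text \<open>The two states are at distance 2 and differ after time \<open>u - t\<close> with
  probability \<open>(1 - exp (- 2 * lam * (u - t))) / 2\<close>. This linear rate, integrated over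
  a step, is the source of the quadratic error.\<close>

lemma expectation_switch_le:
  assumes t: "0 \<le> t" "t \<le> u"
  shows "(\<integral>\<omega>. \<bar>\<xi> u \<omega> - \<xi> t \<omega>\<bar> \<partial>M) \<le> 2 * lam * (u - t)"
proof -
  have m: "(\<lambda>\<omega>. \<bar>j - \<xi> t \<omega>\<bar>) \<in> borel_measurable (F t)" for j
    using xi_measurable_F[of t t] t by measurable
  have b: "\<bar>\<bar>j - \<xi> t \<omega>\<bar>\<bar> \<le> 2" if "j \<in> states" "\<omega> \<in> space M" for j \<omega>
    using abs_xi[of t \<omega>] that t by (auto simp: mem_states_iff)
  note mk = markov[of t "u - t" "\<lambda>j \<omega>. \<bar>j - \<xi> t \<omega>\<bar>", OF _ _ m b, simplified]
  have "(\<integral>\<omega>. \<bar>\<xi> u \<omega> - \<xi> t \<omega>\<bar> \<partial>M)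
      = (\<integral>\<omega>. (\<Sum>j\<in>states. transition lam (u - t) (\<xi> t \<omega>) j * \<bar>j - \<xi> t \<omega>\<bar>) \<partial>M)"
    using mk(1) t by simp
  also have "\<dots> \<le> (\<integral>\<omega>. 2 * lam * (u - t) \<partial>M)"
  proof (rule integral_mono)
    fix \<omega> assume w: "\<omega> \<in> space M"
    have "1 - exp (- (2 * lam * (u - t))) \<le> 2 * lam * (u - t)"
      using exp_ge_add_one_self[of "- (2 * lam * (u - t))"] by simp
    then show "(\<Sum>j\<in>states. transition lam (u - t) (\<xi> t \<omega>) j * \<bar>j - \<xi> t \<omega>\<bar>) \<le> 2 * lam * (u - t)"
      using xi_states[OF t(1) w] unfolding mem_states_iff
      by (auto simp: transition_closed_form mem_states_iff) (auto simp: states_def transition_closed_form)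
  qed (use mk(3) t in auto)
  finally show ?thesis by (simp add: prob_space)
qed


text \<open>Fubini moves the expectation inside the time integral, where
  \<open>expectation_switch_le\<close> bounds the integrand uniformly by \<open>2 * lam * h\<close>;
  the length of the interval contributes the second factor \<open>h\<close>.\<close>

lemma expectation_path_deviation:
  assumes t: "0 \<le> t" "0 \<le> h"
  shows "integrable M (\<lambda>\<omega>. LINT u:{t<..t + h}|lborel. \<bar>\<xi> u \<omega> - \<xi> t \<omega>\<bar>)"
    and "(\<integral>\<omega>. (LINT u:{t<..t + h}|lborel. \<bar>\<xi> u \<omega> - \<xi> t \<omega>\<bar>) \<partial>M) \<le> 2 * lam * h\<^sup>2"
proof -
  interpret P: pair_sigma_finite M lborel
    by (intro pair_sigma_finite.intro sigma_finite_measure_axioms lborel.sigma_finite_measure_axioms)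
  \<comment> \<open>Clamping changes nothing on \<open>{t<..t + h}\<close> but makes the integrand
    jointly measurable on the whole product.\<close>
  define f where "f \<omega> u = indicator {t<..t + h} u * \<bar>\<xi> (max 0 (min (t + h) u)) \<omega> - \<xi> t \<omega>\<bar>" for \<omega> u
  have f_eq: "f \<omega> u = indicator {t<..t + h} u *\<^sub>R \<bar>\<xi> u \<omega> - \<xi> t \<omega>\<bar>" for \<omega> u
    using t by (auto simp: f_def indicator_def max_def min_def)
  have f_le: "f \<omega> u \<le> indicator {t<..t + h} u * 2" "0 \<le> f \<omega> u" if "\<omega> \<in> space M" for \<omega> u
    using abs_xi[of "max 0 (min (t + h) u)" \<omega>] abs_xi[of t \<omega>] that t
    by (auto simp: f_def indicator_def)
  have [measurable]: "(\<lambda>p. \<xi> (max 0 (min (t + h) (snd p))) (fst p)) \<in> borel_measurable (M \<Otimes>\<^sub>M lborel)"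
  proof -
    have "(\<lambda>p. (fst p, snd p)) \<in> measurable (M \<Otimes>\<^sub>M lborel) (F (t + h) \<Otimes>\<^sub>M borel)"
      by (intro measurable_Pair measurable_compose[OF measurable_fst id_measurable_F]) simp
    from measurable_compose[OF this xi_joint_measurable[of "t + h"]] t show ?thesis by simp
  qed
  have [measurable]: "\<xi> t \<in> borel_measurable M" using t by (auto intro: xi_measurable)
  have meas: "case_prod f \<in> borel_measurable (M \<Otimes>\<^sub>M lborel)"
    unfolding f_def by (simp add: case_prod_beta')
  have int: "integrable (M \<Otimes>\<^sub>M lborel) (case_prod f)"
  proof (rule Bochner_Integration.integrable_bound[OF _ meas])
    have "emeasure (M \<Otimes>\<^sub>M lborel) (space M \<times> {t<..t + h}) = ennreal h"
      using t by (subst lborel.emeasure_pair_measure_Times) (auto simp: emeasure_space_1)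
    then show "integrable (M \<Otimes>\<^sub>M lborel) (\<lambda>p. indicator (space M \<times> {t<..t + h}) p * (2 :: real))"
      by (intro integrable_mult_left integrable_real_indicator) auto
    show "AE p in M \<Otimes>\<^sub>M lborel. norm (case_prod f p) \<le> norm (indicator (space M \<times> {t<..t + h}) p * (2 :: real))"
    proof (rule AE_I2)
      fix p assume "p \<in> space (M \<Otimes>\<^sub>M (lborel :: real measure))"
      then obtain \<omega> u where p: "p = (\<omega>, u)" "\<omega> \<in> space M"
        by (auto simp: space_pair_measure)
      then show "norm (case_prod f p) \<le> norm (indicator (space M \<times> {t<..t + h}) p * (2 :: real))"
        using f_le[OF p(2), of u] by (simp add: indicator_times)
    qed
  qed
  show "integrable M (\<lambda>\<omega>. LINT u:{t<..t + h}|lborel. \<bar>\<xi> u \<omega> - \<xi> t \<omega>\<bar>)"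
    using P.integrable_fst[OF int] unfolding set_lebesgue_integral_def f_eq[symmetric] .
  have "(\<integral>\<omega>. (LINT u:{t<..t + h}|lborel. \<bar>\<xi> u \<omega> - \<xi> t \<omega>\<bar>) \<partial>M) = (\<integral>u. \<integral>\<omega>. f \<omega> u \<partial>M \<partial>lborel)"
    unfolding set_lebesgue_integral_def f_eq[symmetric] by (rule P.Fubini_integral[OF int, symmetric])
  also have "\<dots> \<le> (\<integral>u. indicator {t<..t + h} u * (2 * lam * h) \<partial>lborel)"
  proof (rule integral_mono)
    show "integrable lborel (\<lambda>u. \<integral>\<omega>. f \<omega> u \<partial>M)" by (rule P.integrable_snd[OF int])
    show "integrable lborel (\<lambda>u. indicator {t<..t + h} u * (2 * lam * h))"
      using t by (intro integrable_mult_left integrable_real_indicator) auto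
    fix u :: real
    show "(\<integral>\<omega>. f \<omega> u \<partial>M) \<le> indicator {t<..t + h} u * (2 * lam * h)"
    proof (cases "u \<in> {t<..t + h}")
      case True
      have "2 * lam * (u - t) \<le> 2 * lam * h"
        using True lam_pos by auto
      then show ?thesis
        using True expectation_switch_le[of t u] t unfolding f_eq by auto
    qed (simp add: f_eq)
  qed
  also have "\<dots> = 2 * lam * h\<^sup>2"
    using t by (simp add: power2_eq_square)
  finally show "(\<integral>\<omega>. (LINT u:{t<..t + h}|lborel. \<bar>\<xi> u \<omega> - \<xi> t \<omega>\<bar>) \<partial>M) \<le> 2 * lam * h\<^sup>2" .
qed

end

section \<open>The price over one time step\<close>

context switching
begin

context
  fixes \<mu> \<sigma> y :: real
  assumes y: "0 \<le> y" and mu: "0 < \<mu>" and sig: "0 < \<sigma>"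
begin

abbreviation Y :: "real \<Rightarrow> 'a \<Rightarrow> real" where
  "Y \<equiv> price \<mu> \<sigma> \<xi> y"

lemma Y_eq: "Y t \<omega> = y * exp (\<mu> * t + \<sigma> * I t \<omega>)"
  by (simp add: price_def I_def)

lemma Y_nonneg: "0 \<le> Y t \<omega>"
  using y by (simp add: Y_eq)

lemma I_0 [simp]: "I 0 \<omega> = 0"
  unfolding I_def by (subst set_integral_discrete_difference[of "{0}" _ "{}"]) (auto simp: set_lebesgue_integral_def)

lemma Y_le:
  assumes "\<omega> \<in> space M" "0 \<le> t"
  shows "Y t \<omega> \<le> y * exp ((\<mu> + \<sigma>) * t)"
  unfolding Y_eq
  using abs_I_diff_le[OF assms(1), of 0 t] assms(2) y sig
  by (auto intro!: mult_left_mono simp: algebra_simps)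

lemma Y_measurable_F: "0 \<le> t \<Longrightarrow> Y t \<in> borel_measurable (F t)"
  using I_measurable_F[of t] unfolding Y_eq[abs_def] by measurable

lemma Y_0: "Y 0 \<omega> = y"
  by (simp add: Y_eq)

lemma one_step:
  fixes w :: "real \<Rightarrow> real \<Rightarrow> real"
  assumes meas: "\<And>j. j \<in> states \<Longrightarrow> (\<lambda>x. w x j) \<in> borel_measurable borel"
    and lip: "\<And>j x x'. j \<in> states \<Longrightarrow> x \<in> {0..B} \<Longrightarrow> x' \<in> {0..B} \<Longrightarrow> \<bar>w x j - w x' j\<bar> \<le> L * \<bar>x - x'\<bar>"
    and bd: "\<And>j x. j \<in> states \<Longrightarrow> x \<in> {0..B} \<Longrightarrow> \<bar>w x j\<bar> \<le> W"
    and A: "A \<in> sets (F t)"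
    and t: "0 \<le> t" "0 \<le> h" and B: "y * exp ((\<mu> + \<sigma>) * (t + h)) \<le> B" and L: "0 \<le> L"
  shows "\<bar>(\<integral>\<omega>. indicator A \<omega> * w (Y (t + h) \<omega>) (\<xi> (t + h) \<omega>) \<partial>M) -
      (\<integral>\<omega>. indicator A \<omega> * (\<Sum>j\<in>states. transition lam h (\<xi> t \<omega>) j *
         w (Y t \<omega> * exp ((\<mu> + \<sigma> * \<xi> t \<omega>) * h)) j) \<partial>M)\<bar> \<le> 2 * lam * L * B * \<sigma> * h\<^sup>2"
    and "integrable M (\<lambda>\<omega>. indicator A \<omega> * w (Y (t + h) \<omega>) (\<xi> (t + h) \<omega>))"
    and "integrable M (\<lambda>\<omega>. indicator A \<omega> * (\<Sum>j\<in>states. transition lam h (\<xi> t \<omega>) j *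
         w (Y t \<omega> * exp ((\<mu> + \<sigma> * \<xi> t \<omega>) * h)) j))"
proof -
  define Z where "Z \<omega> = Y t \<omega> * exp ((\<mu> + \<sigma> * \<xi> t \<omega>) * h)" for \<omega>
  have th: "0 \<le> t + h" using t by simp
  have [measurable]: "\<xi> t \<in> borel_measurable (F t)" "Y t \<in> borel_measurable (F t)"
    using t by (auto intro: xi_measurable_F Y_measurable_F)
  have [measurable]: "\<xi> (t + h) \<in> borel_measurable M" "Y (t + h) \<in> borel_measurable M"
    using th by (auto intro: xi_measurable measurable_F_imp[OF Y_measurable_F])
  have [measurable]: "A \<in> sets M" using A sets_natural_filtration_le by blast
  have ZF: "Z \<in> borel_measurable (F t)"
    unfolding Z_def by measurable
  have B0: "0 \<le> B" using B y by (meson exp_ge_zero mult_nonneg_nonneg order_trans)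
  have Y_mem: "Y (t + h) \<omega> \<in> {0..B}" if "\<omega> \<in> space M" for \<omega>
    using Y_le[OF that th] B Y_nonneg by (auto intro: order_trans)
  have Z_eq: "Z \<omega> = y * exp (\<mu> * (t + h) + \<sigma> * (I t \<omega> + h * \<xi> t \<omega>))" for \<omega>
    unfolding Z_def Y_eq by (simp add: exp_add[symmetric] algebra_simps)
  have Z_mem: "Z \<omega> \<in> {0..B}" if w: "\<omega> \<in> space M" for \<omega>
  proof -
    have "\<bar>I t \<omega> + h * \<xi> t \<omega>\<bar> \<le> \<bar>I t \<omega>\<bar> + h * \<bar>\<xi> t \<omega>\<bar>"
      using t by (simp add: abs_mult abs_triangle_ineq[THEN order_trans])
    also have "\<dots> \<le> t + h"
      using abs_I_diff_le[OF w, of 0 t] abs_xi[OF t(1) w] t by simp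
    finally have "\<sigma> * (I t \<omega> + h * \<xi> t \<omega>) \<le> \<sigma> * (t + h)"
      using sig by (intro mult_left_mono) auto
    then have "Z \<omega> \<le> y * exp ((\<mu> + \<sigma>) * (t + h))"
      unfolding Z_eq using y by (intro mult_left_mono) (auto simp: algebra_simps)
    then show ?thesis using B y by (auto simp: Z_eq)
  qed
  have g: "(\<lambda>\<omega>. indicator A \<omega> * w (Z \<omega>) j) \<in> borel_measurable (F t)" if "j \<in> states" for j
    using A ZF measurable_compose[OF ZF meas[OF that]] by measurable
  have gbd: "\<bar>indicator A \<omega> * w (Z \<omega>) j\<bar> \<le> W" if "j \<in> states" "\<omega> \<in> space M" for j \<omega>
    using bd[OF that(1) Z_mem[OF that(2)]] by (auto simp: indicator_def)
  note mk = markov[OF t, of "\<lambda>j \<omega>. indicator A \<omega> * w (Z \<omega>) j", OF g gbd, simplified]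
  have eqs: "(\<Sum>j\<in>states. transition lam h (\<xi> t \<omega>) j * (indicator A \<omega> * w (Z \<omega>) j))
      = indicator A \<omega> * (\<Sum>j\<in>states. transition lam h (\<xi> t \<omega>) j * w (Z \<omega>) j)" for \<omega>
    by (simp add: sum_distrib_left algebra_simps)
  show "integrable M (\<lambda>\<omega>. indicator A \<omega> * (\<Sum>j\<in>states. transition lam h (\<xi> t \<omega>) j *
         w (Y t \<omega> * exp ((\<mu> + \<sigma> * \<xi> t \<omega>) * h)) j))"
    using mk(3) unfolding eqs Z_def[symmetric] .
  have wm: "(\<lambda>\<omega>. w (Y (t + h) \<omega>) (\<xi> (t + h) \<omega>)) \<in> borel_measurable M"
  proof -
    have "(\<lambda>\<omega>. if \<xi> (t + h) \<omega> = 1 then w (Y (t + h) \<omega>) 1 else w (Y (t + h) \<omega>) (-1)) \<in> borel_measurable M"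
      using measurable_compose[OF _ meas, of "Y (t + h)" M 1] measurable_compose[OF _ meas, of "Y (t + h)" M "-1"]
      by (auto simp: mem_states_iff)
    then show ?thesis
    proof (rule measurable_cong[THEN iffD1, rotated])
      fix \<omega> assume "\<omega> \<in> space M"
      from xi_states[OF th this]
      show "(if \<xi> (t + h) \<omega> = 1 then w (Y (t + h) \<omega>) 1 else w (Y (t + h) \<omega>) (-1)) = w (Y (t + h) \<omega>) (\<xi> (t + h) \<omega>)"
        by (auto simp: mem_states_iff)
    qed
  qed
  show int: "integrable M (\<lambda>\<omega>. indicator A \<omega> * w (Y (t + h) \<omega>) (\<xi> (t + h) \<omega>))"
  proof (rule integrable_const_bound[of _ W])
    show "AE \<omega> in M. norm (indicator A \<omega> * w (Y (t + h) \<omega>) (\<xi> (t + h) \<omega>)) \<le> W"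
      using bd[OF xi_states[OF th] Y_mem] order_trans[OF abs_ge_zero bd[OF xi_states[OF th] Y_mem]]
      by (intro AE_I2) (auto simp: indicator_def)
  qed (use wm in measurable)
  define V where "V \<omega> = (LINT u:{t<..t + h}|lborel. \<bar>\<xi> u \<omega> - \<xi> t \<omega>\<bar>)" for \<omega>
  have key: "\<bar>indicator A \<omega> * w (Y (t + h) \<omega>) (\<xi> (t + h) \<omega>) - indicator A \<omega> * w (Z \<omega>) (\<xi> (t + h) \<omega>)\<bar> \<le> L * B * \<sigma> * V \<omega>"
    if w: "\<omega> \<in> space M" for \<omega>
  proof -
    have V: "\<bar>I (t + h) \<omega> - I t \<omega> - h * \<xi> t \<omega>\<bar> \<le> V \<omega>"
      using abs_I_increment_le[OF w t(1), of "t + h" "\<xi> t \<omega>"] t by (simp add: V_def)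
    define p q where "p = \<mu> * (t + h) + \<sigma> * I (t + h) \<omega>" and "q = \<mu> * (t + h) + \<sigma> * (I t \<omega> + h * \<xi> t \<omega>)"
    have pq: "Y (t + h) \<omega> = y * exp p" "Z \<omega> = y * exp q"
      by (simp_all add: Y_eq Z_eq p_def q_def)
    have "\<bar>y * exp p - y * exp q\<bar> \<le> y * (max (exp p) (exp q) * \<bar>p - q\<bar>)"
      using abs_exp_diff_le[of p q] y by (simp add: right_diff_distrib[symmetric] abs_mult mult_left_mono)
    also have "\<dots> = max (y * exp p) (y * exp q) * \<bar>p - q\<bar>"
      using y by (simp add: max_mult_distrib_left)
    also have "\<dots> \<le> B * \<bar>p - q\<bar>"
      using Y_mem[OF w] Z_mem[OF w] pq by (intro mult_right_mono) auto
    also have "\<bar>p - q\<bar> = \<sigma> * \<bar>I (t + h) \<omega> - I t \<omega> - h * \<xi> t \<omega>\<bar>"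
    proof -
      have "p - q = \<sigma> * (I (t + h) \<omega> - I t \<omega> - h * \<xi> t \<omega>)"
        by (simp add: p_def q_def algebra_simps)
      then show ?thesis using sig by (simp add: abs_mult)
    qed
    also have "B * \<dots> \<le> B * (\<sigma> * V \<omega>)"
      using V B0 sig by (intro mult_left_mono) auto
    finally have "\<bar>Y (t + h) \<omega> - Z \<omega>\<bar> \<le> B * (\<sigma> * V \<omega>)" by (simp add: pq)
    then have "L * \<bar>Y (t + h) \<omega> - Z \<omega>\<bar> \<le> L * (B * (\<sigma> * V \<omega>))"
      using L by (rule mult_left_mono)
    moreover have "\<bar>w (Y (t + h) \<omega>) (\<xi> (t + h) \<omega>) - w (Z \<omega>) (\<xi> (t + h) \<omega>)\<bar> \<le> L * \<bar>Y (t + h) \<omega> - Z \<omega>\<bar>"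
      by (rule lip[OF xi_states[OF th w] Y_mem[OF w] Z_mem[OF w]])
    ultimately have "\<bar>w (Y (t + h) \<omega>) (\<xi> (t + h) \<omega>) - w (Z \<omega>) (\<xi> (t + h) \<omega>)\<bar> \<le> L * B * \<sigma> * V \<omega>"
      by (simp add: mult.assoc)
    moreover from this have "0 \<le> L * B * \<sigma> * V \<omega>" by linarith
    ultimately show ?thesis by (auto simp: indicator_def)
  qed
  note dev = expectation_path_deviation[OF t, folded V_def]
  have "\<bar>(\<integral>\<omega>. indicator A \<omega> * w (Y (t + h) \<omega>) (\<xi> (t + h) \<omega>) \<partial>M) - (\<integral>\<omega>. indicator A \<omega> * w (Z \<omega>) (\<xi> (t + h) \<omega>) \<partial>M)\<bar>
     = \<bar>\<integral>\<omega>. indicator A \<omega> * w (Y (t + h) \<omega>) (\<xi> (t + h) \<omega>) - indicator A \<omega> * w (Z \<omega>) (\<xi> (t + h) \<omega>) \<partial>M\<bar>"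
    using int mk(2) by simp
  also have "\<dots> \<le> (\<integral>\<omega>. \<bar>indicator A \<omega> * w (Y (t + h) \<omega>) (\<xi> (t + h) \<omega>) - indicator A \<omega> * w (Z \<omega>) (\<xi> (t + h) \<omega>)\<bar> \<partial>M)"
    by (rule integral_abs_bound)
  also have "\<dots> \<le> (\<integral>\<omega>. L * B * \<sigma> * V \<omega> \<partial>M)"
    using int mk(2) dev(1) key by (intro integral_mono) auto
  also have "\<dots> = L * B * \<sigma> * (\<integral>\<omega>. V \<omega> \<partial>M)" by simp
  also have "\<dots> \<le> L * B * \<sigma> * (2 * lam * h\<^sup>2)"
    using dev(2) L B0 sig by (intro mult_left_mono) auto
  finally show "\<bar>(\<integral>\<omega>. indicator A \<omega> * w (Y (t + h) \<omega>) (\<xi> (t + h) \<omega>) \<partial>M) -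
      (\<integral>\<omega>. indicator A \<omega> * (\<Sum>j\<in>states. transition lam h (\<xi> t \<omega>) j *
         w (Y t \<omega> * exp ((\<mu> + \<sigma> * \<xi> t \<omega>) * h)) j) \<partial>M)\<bar> \<le> 2 * lam * L * B * \<sigma> * h\<^sup>2"
    using mk(1) unfolding eqs Z_def[symmetric] by (simp add: mult_ac)
qed

end
end

section \<open>Verification\<close>

text \<open>This is the interface between analysis and probability. \<open>v_upper\<close> and
  \<open>v_lower\<close> state the generator inequality and its converse in integrated form along
  the flow with frozen state, so no derivative of \<open>v\<close> appears:
  \<open>(\<rho> + lam) * v x j - lam * v x (- j)\<close> is the rate prescribed by discounting and
  switching. Constants may depend on \<open>B\<close>, as the price is bounded only on finite
  horizons; \<open>B0\<close> bounds the excess of \<open>v\<close> over the price.\<close>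

locale verification =
  fixes lam \<mu> \<sigma> \<rho> a B0 :: real and v :: "real \<Rightarrow> real \<Rightarrow> real" and u :: "real \<Rightarrow> real"
  assumes lambda_pos: "0 < lam" and mu_pos: "0 < \<mu>" and sigma_pos: "0 < \<sigma>" and a_pos: "0 < a" and rho_gt: "\<mu> + \<sigma> < \<rho>"
    and v_measurable: "\<And>j. j \<in> states \<Longrightarrow> (\<lambda>x. v x j) \<in> borel_measurable borel"
    and v_ge: "\<And>x j. j \<in> states \<Longrightarrow> 0 \<le> x \<Longrightarrow> x - a \<le> v x j"
    and v_nonneg: "\<And>x j. j \<in> states \<Longrightarrow> 0 \<le> x \<Longrightarrow> 0 \<le> v x j"
    and v_le: "\<And>x j. j \<in> states \<Longrightarrow> 0 \<le> x \<Longrightarrow> v x j \<le> x + B0"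
    and v_lipschitz: "\<And>B. \<exists>L\<ge>0. \<forall>j\<in>states. \<forall>x\<in>{0..B}. \<forall>x'\<in>{0..B}. \<bar>v x j - v x' j\<bar> \<le> L * \<bar>x - x'\<bar>"
    and v_upper: "\<And>B. \<exists>K. \<forall>j\<in>states. \<forall>x\<in>{0..B}. \<forall>h\<in>{0..1}.
       v (x * exp ((\<mu> + \<sigma> * j) * h)) j \<le> v x j + h * ((\<rho> + lam) * v x j - lam * v x (- j)) + K * h\<^sup>2"
    and v_lower: "\<And>B. \<exists>K. \<forall>j\<in>states. \<forall>x\<in>{0..B}. \<forall>h\<in>{0..1}. x < u j \<longrightarrow>
       v (x * exp ((\<mu> + \<sigma> * j) * h)) j \<ge> v x j + h * ((\<rho> + lam) * v x j - lam * v x (- j)) - K * h\<^sup>2"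
    and v_stop: "\<And>x j. j \<in> states \<Longrightarrow> 0 \<le> x \<Longrightarrow> u j \<le> x \<Longrightarrow> v x j = x - a"
begin

section \<open>Local estimates for one grid step\<close>

lemma rho_pos: "0 < \<rho>"
  using mu_pos sigma_pos rho_gt by simp

text \<open>The quantity with which \<open>one_step\<close> compares the expectation: from
  \<open>(x, j)\<close> the price follows the flow of state \<open>j\<close> throughout the step,
  and the state at its end is drawn from \<open>transition\<close>.\<close>

definition grid_step :: "real \<Rightarrow> real \<Rightarrow> real \<Rightarrow> real" where
  "grid_step h x j = (\<Sum>k\<in>states. transition lam h j k * v (x * exp ((\<mu> + \<sigma> * j) * h)) k)"

text \<open>The switching probability is \<open>lam * h + O(h\<^sup>2)\<close>, and in the switching
  term the end point of the flow may be replaced by \<open>x\<close>, since that \<open>O(h)\<close>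
  change is multiplied by \<open>h\<close>. The term without switching keeps the end point; its
  expansion is left to \<open>v_upper\<close> and \<open>v_lower\<close>.\<close>

lemma grid_step_expansion:
  "\<exists>K\<ge>0. \<forall>j\<in>states. \<forall>x\<in>{0..B}. \<forall>h\<in>{0..1}.
     \<bar>grid_step h x j - (v (x * exp ((\<mu> + \<sigma> * j) * h)) j + h * lam * (v x (- j) - v x j))\<bar> \<le> K * h\<^sup>2"
proof -
  define c where "c = \<mu> + \<sigma>"
  have c: "0 \<le> c" using mu_pos sigma_pos by (simp add: c_def)
  define B' where "B' = \<bar>B\<bar> * exp c"
  obtain L where L: "0 \<le> L" "\<And>j x x'. j \<in> states \<Longrightarrow> x \<in> {0..B'} \<Longrightarrow> x' \<in> {0..B'} \<Longrightarrow> \<bar>v x j - v x' j\<bar> \<le> L * \<bar>x - x'\<bar>"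
    using v_lipschitz[of B'] by auto
  define W where "W = B' + \<bar>B0\<bar>"
  have W: "\<bar>v x j\<bar> \<le> W" if "j \<in> states" "x \<in> {0..B'}" for x j
    using v_nonneg[of j x] v_le[of j x] that by (auto simp: W_def)
  have W0: "0 \<le> W" by (simp add: W_def B'_def)
  define D where "D = \<bar>B\<bar> * exp c * c"
  have D0: "0 \<le> D" using c by (simp add: D_def)
  have "\<bar>grid_step h x j - (v (x * exp ((\<mu> + \<sigma> * j) * h)) j + h * lam * (v x (- j) - v x j))\<bar>
      \<le> (4 * W * lam\<^sup>2 + 2 * lam * L * D) * h\<^sup>2"
    if j: "j \<in> states" and x: "x \<in> {0..B}" and h: "h \<in> {0..1}" for j x h
  proof -
    define x' where "x' = x * exp ((\<mu> + \<sigma> * j) * h)"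
    define p where "p = (1 - exp (- 2 * lam * h)) / 2"
    have nj: "- j \<in> states" "j \<noteq> - j" using j by (auto simp: mem_states_iff)
    have st: "states = {j, - j}" using j by (auto simp: mem_states_iff states_def)
    have sg: "grid_step h x j = v x' j + p * (v x' (- j) - v x' j)"
      unfolding grid_step_def st x'_def[symmetric] using nj j
      by (simp add: transition_closed_form p_def field_simps)
    have cj: "\<bar>\<mu> + \<sigma> * j\<bar> \<le> c" using j mu_pos sigma_pos by (auto simp: mem_states_iff c_def)
    then have cjh: "\<bar>(\<mu> + \<sigma> * j) * h\<bar> \<le> c * h"
      using h by (simp add: abs_mult mult_right_mono)
    also have "c * h \<le> c" using c h by (simp add: mult_left_le)
    finally have ex: "exp ((\<mu> + \<sigma> * j) * h) \<le> exp c" by simp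
    have x0: "0 \<le> x" "x \<le> \<bar>B\<bar>" using x by auto
    have xm: "x \<in> {0..B'}"
      using x0 c mult_mono[of x "\<bar>B\<bar>" 1 "exp c"] by (auto simp: B'_def)
    have x'm: "x' \<in> {0..B'}"
      using x0 ex mult_mono[of x "\<bar>B\<bar>" "exp ((\<mu> + \<sigma> * j) * h)" "exp c"] by (auto simp: B'_def x'_def)
    have "\<bar>exp ((\<mu> + \<sigma> * j) * h) - exp 0\<bar> \<le> max (exp ((\<mu> + \<sigma> * j) * h)) (exp 0) * \<bar>(\<mu> + \<sigma> * j) * h - 0\<bar>"
      by (rule abs_exp_diff_le)
    also have "\<dots> \<le> exp c * (c * h)"
      using ex c cjh by (intro mult_mono) auto
    finally have e1: "\<bar>exp ((\<mu> + \<sigma> * j) * h) - 1\<bar> \<le> exp c * (c * h)" by simp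
    have "\<bar>x' - x\<bar> = x * \<bar>exp ((\<mu> + \<sigma> * j) * h) - 1\<bar>"
    proof -
      have "x' - x = x * (exp ((\<mu> + \<sigma> * j) * h) - 1)" by (simp add: x'_def algebra_simps)
      then show ?thesis using x0 by (simp add: abs_mult)
    qed
    also have "\<dots> \<le> \<bar>B\<bar> * (exp c * (c * h))"
      using x0 e1 by (intro mult_mono) auto
    finally have xx: "\<bar>x' - x\<bar> \<le> D * h" by (simp add: D_def mult_ac)
    have lv: "\<bar>v x' k - v x k\<bar> \<le> L * (D * h)" if "k \<in> states" for k
      using L(2)[OF that x'm xm] mult_left_mono[OF xx L(1)] by linarith
    have p1: "0 \<le> lam * h - p" 
      using exp_ge_add_one_self[of "- 2 * lam * h"] by (simp add: p_def field_simps)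
    have p2: "lam * h - p \<le> 2 * lam\<^sup>2 * h\<^sup>2"
    proof -
      have z: "0 \<le> 2 * lam * h" using lambda_pos h by simp
      \<comment> \<open>Since \<open>(1 - z + z\<^sup>2) * (1 + z) = 1 + z ^ 3\<close>, the bound
        follows from \<open>1 + z \<le> exp z\<close>; with \<open>z = 2 * lam * h\<close> it gives
        the second-order error of \<open>p\<close>.\<close>
      have "exp (- z) \<le> 1 - z + z\<^sup>2" if "0 \<le> z" for z :: real
      proof -
        have "exp (- z) * (1 + z) \<le> exp (- z) * exp z"
          using exp_ge_add_one_self[of z] by (intro mult_left_mono) auto
        also have "\<dots> \<le> (1 - z + z\<^sup>2) * (1 + z)"
          using that by (simp add: exp_minus algebra_simps power2_eq_square)
        finally show ?thesis
          using that by (simp add: mult_le_cancel_right)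
      qed
      from this[OF z] show ?thesis by (simp add: p_def power2_eq_square field_simps)
    qed
    \<comment> \<open>The first summand is the error in the switching probability, the second the
      error from evaluating at \<open>x\<close> instead of \<open>x'\<close>.\<close>
    have "grid_step h x j - (v x' j + h * lam * (v x (- j) - v x j))
        = (p - lam * h) * (v x' (- j) - v x' j) + lam * h * ((v x' (- j) - v x (- j)) - (v x' j - v x j))"
      unfolding sg by (simp add: algebra_simps)
    also have "\<bar>\<dots>\<bar> \<le> \<bar>p - lam * h\<bar> * \<bar>v x' (- j) - v x' j\<bar> + \<bar>lam * h\<bar> * \<bar>(v x' (- j) - v x (- j)) - (v x' j - v x j)\<bar>"
      by (metis abs_mult abs_triangle_ineq)
    also have "\<dots> \<le> (2 * lam\<^sup>2 * h\<^sup>2) * (2 * W) + (lam * h) * (2 * (L * (D * h)))"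
      using p1 p2 W[OF j x'm] W[OF nj(1) x'm] lv[OF j] lv[OF nj(1)] lambda_pos h W0 
      by (intro add_mono mult_mono) auto
    also have "\<dots> = (4 * W * lam\<^sup>2 + 2 * lam * L * D) * h\<^sup>2"
      by (simp add: power2_eq_square algebra_simps)
    finally show ?thesis by (simp add: x'_def)
  qed
  moreover have "0 \<le> 4 * W * lam\<^sup>2 + 2 * lam * L * D"
    using W0 D0 L(1) lambda_pos by simp
  ultimately show ?thesis by blast
qed

text \<open>The switching terms of the two expansions cancel and leave the growth factor
  \<open>1 + \<rho> * h\<close>, which discounting more than offsets because \<open>v\<close> is
  nonnegative.\<close>

lemma grid_step_upper:
  "\<exists>K\<ge>0. \<forall>j\<in>states. \<forall>x\<in>{0..B}. \<forall>h\<in>{0..1}. exp (- \<rho> * h) * grid_step h x j \<le> v x j + K * h\<^sup>2"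
proof -
  obtain K1 where K1: "0 \<le> K1" "\<And>j x h. j \<in> states \<Longrightarrow> x \<in> {0..B} \<Longrightarrow> h \<in> {0..1} \<Longrightarrow>
     \<bar>grid_step h x j - (v (x * exp ((\<mu> + \<sigma> * j) * h)) j + h * lam * (v x (- j) - v x j))\<bar> \<le> K1 * h\<^sup>2"
    using grid_step_expansion[of B] by auto
  obtain K2 where K2: "\<And>j x h. j \<in> states \<Longrightarrow> x \<in> {0..B} \<Longrightarrow> h \<in> {0..1} \<Longrightarrow>
     v (x * exp ((\<mu> + \<sigma> * j) * h)) j \<le> v x j + h * ((\<rho> + lam) * v x j - lam * v x (- j)) + K2 * h\<^sup>2"
    using v_upper[of B] by blast
  have "exp (- \<rho> * h) * grid_step h x j \<le> v x j + (K1 + \<bar>K2\<bar>) * h\<^sup>2"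
    if j: "j \<in> states" and x: "x \<in> {0..B}" and h: "h \<in> {0..1}" for j x h
  proof -
    have "K2 * h\<^sup>2 \<le> \<bar>K2\<bar> * h\<^sup>2" by (intro mult_right_mono) auto
    then have "grid_step h x j \<le> v x j * (1 + \<rho> * h) + (K1 + \<bar>K2\<bar>) * h\<^sup>2"
      using K1(2)[OF that] K2[OF that] by (simp add: algebra_simps abs_le_iff)
    then have "exp (- \<rho> * h) * grid_step h x j \<le> exp (- \<rho> * h) * (v x j * (1 + \<rho> * h) + (K1 + \<bar>K2\<bar>) * h\<^sup>2)"
      by (intro mult_left_mono) auto
    also have "\<dots> = v x j * ((1 + \<rho> * h) * exp (- \<rho> * h)) + exp (- \<rho> * h) * ((K1 + \<bar>K2\<bar>) * h\<^sup>2)"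
      by (simp add: algebra_simps)
    also have "\<dots> \<le> v x j * 1 + 1 * ((K1 + \<bar>K2\<bar>) * h\<^sup>2)"
    proof (intro add_mono mult_left_mono mult_right_mono)
      have "(1 + \<rho> * h) * exp (- \<rho> * h) \<le> exp (\<rho> * h) * exp (- \<rho> * h)"
        by (intro mult_right_mono) auto
      then show "(1 + \<rho> * h) * exp (- \<rho> * h) \<le> 1" by (simp add: exp_minus)
    qed (use v_nonneg[of j x] j x h rho_pos K1(1) in auto)
    finally show ?thesis by simp
  qed
  moreover have "0 \<le> K1 + \<bar>K2\<bar>" using K1(1) by simp
  ultimately show ?thesis by blast
qed

text \<open>Here discounting must not lose more than second order: \<open>(1 + \<rho> * h) * exp (-
  \<rho> * h) \<ge> 1 - \<rho>\<^sup>2 * h\<^sup>2\<close>, and the bound \<open>W\<close> on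
  \<open>v\<close> makes the loss uniform.\<close>

lemma grid_step_lower:
  "\<exists>K\<ge>0. \<forall>j\<in>states. \<forall>x\<in>{0..B}. \<forall>h\<in>{0..1}. x < u j \<longrightarrow> v x j - K * h\<^sup>2 \<le> exp (- \<rho> * h) * grid_step h x j"
proof -
  obtain K1 where K1: "0 \<le> K1" "\<And>j x h. j \<in> states \<Longrightarrow> x \<in> {0..B} \<Longrightarrow> h \<in> {0..1} \<Longrightarrow>
     \<bar>grid_step h x j - (v (x * exp ((\<mu> + \<sigma> * j) * h)) j + h * lam * (v x (- j) - v x j))\<bar> \<le> K1 * h\<^sup>2"
    using grid_step_expansion[of B] by auto
  obtain K2 where K2: "\<And>j x h. j \<in> states \<Longrightarrow> x \<in> {0..B} \<Longrightarrow> h \<in> {0..1} \<Longrightarrow> x < u j \<Longrightarrow>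
     v (x * exp ((\<mu> + \<sigma> * j) * h)) j \<ge> v x j + h * ((\<rho> + lam) * v x j - lam * v x (- j)) - K2 * h\<^sup>2"
    using v_lower[of B] by blast
  define W where "W = \<bar>B\<bar> + \<bar>B0\<bar>"
  have "v x j - (\<rho>\<^sup>2 * W + (K1 + \<bar>K2\<bar>)) * h\<^sup>2 \<le> exp (- \<rho> * h) * grid_step h x j"
    if j: "j \<in> states" and x: "x \<in> {0..B}" and h: "h \<in> {0..1}" and xu: "x < u j" for j x h
  proof -
    have vx: "0 \<le> v x j" "v x j \<le> W"
      using v_nonneg[of j x] v_le[of j x] j x by (auto simp: W_def)
    have "K2 * h\<^sup>2 \<le> \<bar>K2\<bar> * h\<^sup>2" by (intro mult_right_mono) auto
    then have "grid_step h x j \<ge> v x j * (1 + \<rho> * h) - (K1 + \<bar>K2\<bar>) * h\<^sup>2"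
      using K1(2)[OF j x h] K2[OF that] by (simp add: algebra_simps abs_le_iff)
    then have "exp (- \<rho> * h) * grid_step h x j \<ge> exp (- \<rho> * h) * (v x j * (1 + \<rho> * h) - (K1 + \<bar>K2\<bar>) * h\<^sup>2)"
      by (intro mult_left_mono) auto
    also have "exp (- \<rho> * h) * (v x j * (1 + \<rho> * h) - (K1 + \<bar>K2\<bar>) * h\<^sup>2)
        = v x j * ((1 + \<rho> * h) * exp (- \<rho> * h)) - exp (- \<rho> * h) * ((K1 + \<bar>K2\<bar>) * h\<^sup>2)"
      by (simp add: algebra_simps)
    finally have 1: "\<dots> \<le> exp (- \<rho> * h) * grid_step h x j" .
    have "v x j * ((1 + \<rho> * h) * exp (- \<rho> * h)) \<ge> v x j * ((1 + \<rho> * h) * (1 - \<rho> * h))"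
      using exp_ge_add_one_self[of "- \<rho> * h"] vx h rho_pos by (intro mult_left_mono) auto
    then have 2: "v x j * ((1 + \<rho> * h) * exp (- \<rho> * h)) \<ge> v x j - v x j * (\<rho>\<^sup>2 * h\<^sup>2)"
      by (simp add: algebra_simps power2_eq_square)
    have 3: "exp (- \<rho> * h) * ((K1 + \<bar>K2\<bar>) * h\<^sup>2) \<le> 1 * ((K1 + \<bar>K2\<bar>) * h\<^sup>2)"
      using K1(1) h rho_pos by (intro mult_right_mono) auto
    have 4: "v x j * (\<rho>\<^sup>2 * h\<^sup>2) \<le> W * (\<rho>\<^sup>2 * h\<^sup>2)"
      using vx by (intro mult_right_mono) auto
    show ?thesis using 1 2 3 4 by (simp add: algebra_simps)
  qed
  moreover have "0 \<le> \<rho>\<^sup>2 * W + (K1 + \<bar>K2\<bar>)" using K1(1) by (simp add: W_def)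
  ultimately show ?thesis by blast
qed

end

section \<open>Events of the completed filtration and the discounted candidate\<close>

text \<open>The sets that agree almost everywhere with an event of the natural filtration are closed
  under complements and countable unions and include the null sets. Stopping times of the completed
  filtration thereby reduce to events for which the transition condition is available.\<close>

lemma (in switching) completed_filtration_ex:
  assumes "A \<in> sets (completed_filtration M \<xi> t)"
  shows "\<exists>B\<in>sets (natural_filtration M \<xi> t). AE \<omega> in completion M. \<omega> \<in> A \<longleftrightarrow> \<omega> \<in> B"
proof -
  have "sets (natural_filtration M \<xi> t) \<union> null_sets (completion M) \<subseteq> Pow (space M)"
    using sets.sets_into_space[of _ "natural_filtration M \<xi> t"] sets.sets_into_space[of _ "completion M"]
    by fastforce
  then have "A \<in> sigma_sets (space M) (sets (natural_filtration M \<xi> t) \<union> null_sets (completion M))"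
    using assms by (simp add: completed_filtration_def sets_measure_of)
  then show ?thesis
  proof induction
    case (Basic A)
    then show ?case
    proof
      assume "A \<in> null_sets (completion M)"
      then have "AE \<omega> in completion M. \<omega> \<in> A \<longleftrightarrow> \<omega> \<in> {}"
        by (auto dest: AE_not_in)
      then show ?thesis by blast
    qed auto
  next
    case Empty
    then show ?case by (intro bexI[of _ "{}"]) auto
  next
    case (Compl A)
    then obtain B where B: "B \<in> sets (natural_filtration M \<xi> t)" "AE \<omega> in completion M. \<omega> \<in> A \<longleftrightarrow> \<omega> \<in> B"
      by blast
    have "AE \<omega> in completion M. \<omega> \<in> space M - A \<longleftrightarrow> \<omega> \<in> space M - B"
      using B(2) by eventually_elim auto
    moreover have "space M - B \<in> sets (natural_filtration M \<xi> t)"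
      using sets.compl_sets[OF B(1)] by simp
    ultimately show ?case by blast
  next
    case (Union A)
    then obtain B where B: "\<And>i. B i \<in> sets (natural_filtration M \<xi> t)"
      "\<And>i :: nat. AE \<omega> in completion M. \<omega> \<in> A i \<longleftrightarrow> \<omega> \<in> B i"
      by metis
    have "AE \<omega> in completion M. \<forall>i. \<omega> \<in> A i \<longleftrightarrow> \<omega> \<in> B i"
      using B(2) by (simp add: AE_all_countable)
    then have "AE \<omega> in completion M. \<omega> \<in> (\<Union>i. A i) \<longleftrightarrow> \<omega> \<in> (\<Union>i. B i)"
      by eventually_elim auto
    moreover have "(\<Union>i. B i) \<in> sets (natural_filtration M \<xi> t)"
      using B(1) by blast
    ultimately show ?case by blast
  qed
qed

locale verification_chain =
  verification lam \<mu> \<sigma> \<rho> a B0 v u + switching lam s M \<xi>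
  for lam \<mu> \<sigma> \<rho> a B0 :: real and v u s and M :: "'a measure" and \<xi> +
  fixes y :: real
  assumes y_nonneg: "0 \<le> y" and s_states: "s \<in> states"
begin

abbreviation "Yp \<equiv> price \<mu> \<sigma> \<xi> y"

definition Z :: "real \<Rightarrow> 'a \<Rightarrow> real" where
  "Z t \<omega> = exp (- \<rho> * t) * v (Yp t \<omega>) (\<xi> t \<omega>)"

lemmas Yp_nonneg = Y_nonneg[OF y_nonneg mu_pos sigma_pos]
lemmas Yp_le = Y_le[OF y_nonneg mu_pos sigma_pos]

lemma Z_nonneg: "0 \<le> t \<Longrightarrow> \<omega> \<in> space M \<Longrightarrow> 0 \<le> Z t \<omega>"
  using v_nonneg[OF xi_states Yp_nonneg] by (simp add: Z_def)

text \<open>Up to time \<open>T\<close> the price never exceeds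
  \<open>B = y * exp ((\<mu> + \<sigma>) * T)\<close>, so one constant \<open>K\<close> serves all
  \<open>t\<close>, \<open>h\<close> and \<open>A\<close>; its parts come from freezing the flow,
  from \<open>grid_step_upper\<close> and from \<open>grid_step_lower\<close>. Integrals over
  \<open>A\<close> take the place of conditional expectations.\<close>

lemma Z_step:
  assumes T: "0 \<le> T"
  obtains K where "0 \<le> K"
    "\<And>t h A. 0 \<le> t \<Longrightarrow> 0 \<le> h \<Longrightarrow> h \<le> 1 \<Longrightarrow> t + h \<le> T \<Longrightarrow> A \<in> sets (F t) \<Longrightarrow>
       integrable M (\<lambda>\<omega>. indicator A \<omega> * (Z (t + h) \<omega> - Z t \<omega>)) \<and>
       (\<integral>\<omega>. indicator A \<omega> * (Z (t + h) \<omega> - Z t \<omega>) \<partial>M) \<le> K * h\<^sup>2 \<and>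
       ((\<forall>\<omega>\<in>A. Yp t \<omega> < u (\<xi> t \<omega>)) \<longrightarrow> - (K * h\<^sup>2) \<le> (\<integral>\<omega>. indicator A \<omega> * (Z (t + h) \<omega> - Z t \<omega>) \<partial>M))"
proof -
  define B where "B = y * exp ((\<mu> + \<sigma>) * T)"
  have B0': "0 \<le> B" using y_nonneg by (simp add: B_def)
  obtain L where L: "0 \<le> L" "\<And>j x x'. j \<in> states \<Longrightarrow> x \<in> {0..B} \<Longrightarrow> x' \<in> {0..B} \<Longrightarrow> \<bar>v x j - v x' j\<bar> \<le> L * \<bar>x - x'\<bar>"
    using v_lipschitz[of B] by auto
  have W: "\<bar>v x j\<bar> \<le> B + \<bar>B0\<bar>" if "j \<in> states" "x \<in> {0..B}" for x j
    using v_nonneg[of j x] v_le[of j x] that by auto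
  obtain K1 where K1: "0 \<le> K1" "\<And>j x h. j \<in> states \<Longrightarrow> x \<in> {0..B} \<Longrightarrow> h \<in> {0..1} \<Longrightarrow>
      exp (- \<rho> * h) * grid_step h x j \<le> v x j + K1 * h\<^sup>2"
    using grid_step_upper[of B] by blast
  obtain K2 where K2: "0 \<le> K2" "\<And>j x h. j \<in> states \<Longrightarrow> x \<in> {0..B} \<Longrightarrow> h \<in> {0..1} \<Longrightarrow> x < u j \<Longrightarrow>
      v x j - K2 * h\<^sup>2 \<le> exp (- \<rho> * h) * grid_step h x j"
    using grid_step_lower[of B] by blast
  define K0 where "K0 = 2 * lam * L * B * \<sigma>"
  have K0: "0 \<le> K0" using lam_pos L(1) B0' sigma_pos by (simp add: K0_def)
  define K where "K = K0 + K1 + K2"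
  have K: "0 \<le> K" using K0 K1 K2 by (simp add: K_def)
  have "integrable M (\<lambda>\<omega>. indicator A \<omega> * (Z (t + h) \<omega> - Z t \<omega>)) \<and>
       (\<integral>\<omega>. indicator A \<omega> * (Z (t + h) \<omega> - Z t \<omega>) \<partial>M) \<le> K * h\<^sup>2 \<and>
       ((\<forall>\<omega>\<in>A. Yp t \<omega> < u (\<xi> t \<omega>)) \<longrightarrow> - (K * h\<^sup>2) \<le> (\<integral>\<omega>. indicator A \<omega> * (Z (t + h) \<omega> - Z t \<omega>) \<partial>M))"
    if t: "0 \<le> t" and h: "0 \<le> h" "h \<le> 1" and th: "t + h \<le> T" and A: "A \<in> sets (F t)" for t h A
  proof -
    have le_B: "y * exp ((\<mu> + \<sigma>) * (t + h)) \<le> B" "y * exp ((\<mu> + \<sigma>) * (t + 0)) \<le> B"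
      using th h y_nonneg mu_pos sigma_pos unfolding B_def by (auto intro!: mult_left_mono)
    have Ym: "Yp t \<omega> \<in> {0..B}" if "\<omega> \<in> space M" for \<omega>
      using Yp_le[OF that t] le_B(2) Yp_nonneg by (auto intro: order_trans)
    define E where "E = exp (- \<rho> * t)"
    have E: "0 \<le> E" "E \<le> 1" using t rho_pos by (auto simp: E_def)
    define P where "P = (\<lambda>\<omega>. indicator A \<omega> * v (Yp (t + h) \<omega>) (\<xi> (t + h) \<omega>))"
    define Q where "Q = (\<lambda>\<omega>. indicator A \<omega> * grid_step h (Yp t \<omega>) (\<xi> t \<omega>))"
    define R where "R = (\<lambda>\<omega>. indicator A \<omega> * v (Yp t \<omega>) (\<xi> t \<omega>))"
    note os = one_step[where w = v, OF y_nonneg mu_pos sigma_pos v_measurable L(2) W A t h(1) le_B(1) L(1), folded grid_step_def P_def Q_def K0_def]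
    \<comment> \<open>A step of length 0 yields integrability of the value at time
      \<open>t\<close>.\<close>
    have R: "integrable M R"
      using one_step(2)[where w = v, OF y_nonneg mu_pos sigma_pos v_measurable L(2) W A t order_refl le_B(2) L(1)]
      by (simp add: R_def)
    have eq: "indicator A \<omega> * (Z (t + h) \<omega> - Z t \<omega>) = E * (exp (- \<rho> * h) * P \<omega> - R \<omega>)" for \<omega>
    proof -
      have "exp (- \<rho> * (t + h)) = E * exp (- \<rho> * h)"
        by (simp add: E_def exp_add[symmetric] algebra_simps)
      then show ?thesis by (simp add: Z_def P_def R_def E_def algebra_simps)
    qed
    have int: "(\<integral>\<omega>. indicator A \<omega> * (Z (t + h) \<omega> - Z t \<omega>) \<partial>M) = E * (exp (- \<rho> * h) * (\<integral>\<omega>. P \<omega> \<partial>M) - (\<integral>\<omega>. R \<omega> \<partial>M))"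
      unfolding eq using os(2) R by simp
    have d: "\<bar>exp (- \<rho> * h) * (\<integral>\<omega>. P \<omega> \<partial>M) - exp (- \<rho> * h) * (\<integral>\<omega>. Q \<omega> \<partial>M)\<bar> \<le> K0 * h\<^sup>2"
    proof -
      have "exp (- \<rho> * h) * \<bar>(\<integral>\<omega>. P \<omega> \<partial>M) - (\<integral>\<omega>. Q \<omega> \<partial>M)\<bar> \<le> 1 * (K0 * h\<^sup>2)"
        using os(1) rho_pos h by (intro mult_mono) auto
      then show ?thesis by (simp add: abs_mult flip: right_diff_distrib)
    qed
    have up: "exp (- \<rho> * h) * (\<integral>\<omega>. Q \<omega> \<partial>M) \<le> (\<integral>\<omega>. R \<omega> \<partial>M) + K1 * h\<^sup>2"
    proof -
      have "(\<integral>\<omega>. exp (- \<rho> * h) * Q \<omega> \<partial>M) \<le> (\<integral>\<omega>. R \<omega> + K1 * h\<^sup>2 \<partial>M)"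
      proof (rule integral_mono)
        fix \<omega> assume w: "\<omega> \<in> space M"
        show "exp (- \<rho> * h) * Q \<omega> \<le> R \<omega> + K1 * h\<^sup>2"
          using K1(2)[OF xi_states[OF t w] Ym[OF w], of h] h K1(1) by (auto simp: Q_def R_def indicator_def)
      qed (use os(3) R in auto)
      then show ?thesis using R by (simp add: prob_space)
    qed
    have lo: "(\<integral>\<omega>. R \<omega> \<partial>M) - K2 * h\<^sup>2 \<le> exp (- \<rho> * h) * (\<integral>\<omega>. Q \<omega> \<partial>M)" if below: "\<forall>\<omega>\<in>A. Yp t \<omega> < u (\<xi> t \<omega>)"
    proof -
      have "(\<integral>\<omega>. R \<omega> - K2 * h\<^sup>2 \<partial>M) \<le> (\<integral>\<omega>. exp (- \<rho> * h) * Q \<omega> \<partial>M)"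
      proof (rule integral_mono)
        fix \<omega> assume w: "\<omega> \<in> space M"
        show "R \<omega> - K2 * h\<^sup>2 \<le> exp (- \<rho> * h) * Q \<omega>"
          using K2(2)[OF xi_states[OF t w] Ym[OF w], of h] h K2(1) below by (auto simp: Q_def R_def indicator_def)
      qed (use os(3) R in auto)
      then show ?thesis using R by (simp add: prob_space)
    qed
    have scale: "E * x \<le> c * h\<^sup>2" if "x \<le> c * h\<^sup>2" "0 \<le> c" for x c
    proof -
      have "E * x \<le> E * (c * h\<^sup>2)" using that E by (intro mult_left_mono) auto
      also have "\<dots> \<le> 1 * (c * h\<^sup>2)" using that E by (intro mult_right_mono) auto
      finally show ?thesis by simp
    qed
    have "integrable M (\<lambda>\<omega>. indicator A \<omega> * (Z (t + h) \<omega> - Z t \<omega>))"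
      unfolding eq using os(2) R by simp
    moreover have "E * (exp (- \<rho> * h) * (\<integral>\<omega>. P \<omega> \<partial>M) - (\<integral>\<omega>. R \<omega> \<partial>M)) \<le> K * h\<^sup>2"
      using d up mult_nonneg_nonneg[OF K2(1) zero_le_power2, of h] unfolding K_def distrib_right
      by (intro scale[OF _ K, unfolded K_def distrib_right]) linarith
    moreover have "- (K * h\<^sup>2) \<le> E * (exp (- \<rho> * h) * (\<integral>\<omega>. P \<omega> \<partial>M) - (\<integral>\<omega>. R \<omega> \<partial>M))" if below: "\<forall>\<omega>\<in>A. Yp t \<omega> < u (\<xi> t \<omega>)"
    proof -
      have "- (exp (- \<rho> * h) * (\<integral>\<omega>. P \<omega> \<partial>M) - (\<integral>\<omega>. R \<omega> \<partial>M)) \<le> K * h\<^sup>2"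
        using d lo[OF below] mult_nonneg_nonneg[OF K1(1) zero_le_power2, of h] unfolding K_def distrib_right by linarith
      from scale[OF this K] show ?thesis by (simp add: right_diff_distrib)
    qed
    ultimately show ?thesis
      unfolding int by blast
  qed
  with K that show ?thesis by blast
qed

lemma integral_Z_0: "integrable M (Z 0)" "(\<integral>\<omega>. Z 0 \<omega> \<partial>M) = v y s"
proof -
  have eq: "AE \<omega> in M. Z 0 \<omega> = v y s"
    using AE_xi_0 by eventually_elim (simp add: Z_def Y_0[OF y_nonneg mu_pos sigma_pos])
  have "Z 0 \<in> borel_measurable M"
  proof -
    have [measurable]: "\<xi> 0 \<in> borel_measurable M" by (rule xi_measurable) simp
    have "(\<lambda>\<omega>. if \<xi> 0 \<omega> = 1 then v y 1 else v y (- 1)) \<in> borel_measurable M" by measurable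
    then show ?thesis
    proof (rule measurable_cong[THEN iffD1, rotated])
      fix \<omega> assume "\<omega> \<in> space M"
      from xi_states[OF order_refl this]
      show "(if \<xi> 0 \<omega> = 1 then v y 1 else v y (- 1)) = Z 0 \<omega>"
        by (auto simp: mem_states_iff Z_def Y_0[OF y_nonneg mu_pos sigma_pos])
    qed
  qed
  then show "integrable M (Z 0)" "(\<integral>\<omega>. Z 0 \<omega> \<partial>M) = v y s"
    using eq integrable_cong_AE[of "Z 0" M "\<lambda>_. v y s"] integral_cong_AE[of "Z 0" M "\<lambda>_. v y s"]
    by (auto simp: prob_space)
qed

end

lemma (in switching) sets_completed_filtration_le:
  "sets (completed_filtration M \<xi> t) \<subseteq> sets (completion M)"
proof -
  have sub: "sets (natural_filtration M \<xi> t) \<union> null_sets (completion M) \<subseteq> sets (completion M)"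
    using sets_natural_filtration_le by auto
  then have "sets (natural_filtration M \<xi> t) \<union> null_sets (completion M) \<subseteq> Pow (space M)"
    by (rule order_trans) (use sets.space_closed[of "completion M"] in simp)
  then show ?thesis
    using sets.sigma_sets_subset[OF sub] by (simp add: completed_filtration_def sets_measure_of)
qed

lemma (in switching) space_completed_filtration: "space (completed_filtration M \<xi> t) = space M"
proof -
  have "sets (natural_filtration M \<xi> t) \<union> null_sets (completion M) \<subseteq> Pow (space M)"
    using sets.space_closed[of "natural_filtration M \<xi> t"] sets.space_closed[of "completion M"] by auto
  then show ?thesis
    by (simp add: completed_filtration_def space_measure_of)
qed

section \<open>Upper bound: no stopping time earns more than the candidate\<close>

context verification_chain
begin

text \<open>The integrals over an event and over its representative in the natural filtration agree.
  Only the upper bound is transferred: it must hold for arbitrary stopping times, whereas those used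
  for the lower bound are built from events of the natural filtration.\<close>

lemma Z_step_completed:
  assumes K: "\<And>A. A \<in> sets (F t) \<Longrightarrow> integrable M (\<lambda>\<omega>. indicator A \<omega> * (Z (t + h) \<omega> - Z t \<omega>)) \<and>
       (\<integral>\<omega>. indicator A \<omega> * (Z (t + h) \<omega> - Z t \<omega>) \<partial>M) \<le> c"
    and A: "A \<in> sets (completed_filtration M \<xi> (ennreal t))"
  shows "integrable (completion M) (\<lambda>\<omega>. indicator A \<omega> * (Z (t + h) \<omega> - Z t \<omega>))"
    and "(\<integral>\<omega>. indicator A \<omega> * (Z (t + h) \<omega> - Z t \<omega>) \<partial>completion M) \<le> c"
proof -
  obtain B where B: "B \<in> sets (F t)" "AE \<omega> in completion M. \<omega> \<in> A \<longleftrightarrow> \<omega> \<in> B"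
    using completed_filtration_ex[OF A] by blast
  have A' [measurable]: "A \<in> sets (completion M)"
    using A sets_completed_filtration_le by blast
  \<comment> \<open>Taking the whole space as event extracts measurability of the plain
    increment.\<close>
  have "integrable M (\<lambda>\<omega>. indicator (space M) \<omega> * (Z (t + h) \<omega> - Z t \<omega>))"
    using K[of "space M"] sets.top[of "F t"] by simp
  then have "(\<lambda>\<omega>. indicator (space M) \<omega> * (Z (t + h) \<omega> - Z t \<omega>)) \<in> borel_measurable M"
    by (rule borel_measurable_integrable)
  then have "(\<lambda>\<omega>. Z (t + h) \<omega> - Z t \<omega>) \<in> borel_measurable M"
    by (rule measurable_cong[THEN iffD1, rotated]) simp
  then have [measurable]: "(\<lambda>\<omega>. Z (t + h) \<omega> - Z t \<omega>) \<in> borel_measurable (completion M)"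
    by (rule measurable_completion)
  have Bi: "integrable M (\<lambda>\<omega>. indicator B \<omega> * (Z (t + h) \<omega> - Z t \<omega>))"
    using K[OF B(1)] by blast
  note mB = borel_measurable_integrable[OF Bi]
  have mA: "(\<lambda>\<omega>. indicator A \<omega> * (Z (t + h) \<omega> - Z t \<omega>)) \<in> borel_measurable (completion M)"
    by measurable
  have ae: "AE \<omega> in completion M. indicator A \<omega> * (Z (t + h) \<omega> - Z t \<omega>) = indicator B \<omega> * (Z (t + h) \<omega> - Z t \<omega>)"
    using B(2) by eventually_elim (simp add: indicator_def)
  show "integrable (completion M) (\<lambda>\<omega>. indicator A \<omega> * (Z (t + h) \<omega> - Z t \<omega>))"
    using integrable_cong_AE[OF mA measurable_completion[OF mB] ae] Bi
    by (simp add: integrable_completion[OF mB])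
  show "(\<integral>\<omega>. indicator A \<omega> * (Z (t + h) \<omega> - Z t \<omega>) \<partial>completion M) \<le> c"
    using integral_cong_AE[OF mA measurable_completion[OF mB] ae] K[OF B(1)]
    by (simp add: integral_completion[OF mB])
qed

abbreviation "rew \<equiv> reward \<mu> \<sigma> \<rho> a \<xi> y"

text \<open>The bound holds path by path, because the price grows at rate at most
  \<open>\<mu> + \<sigma> < \<rho>\<close>. It provides the deterministic tail estimate for the
  truncation at a finite horizon.\<close>

lemma discounted_price_le:
  assumes "\<omega> \<in> space M" "0 \<le> t" "t \<le> r"
  shows "exp (- \<rho> * r) * Yp r \<omega> \<le> y * exp (- (\<rho> - \<mu> - \<sigma>) * t)"
proof -
  have "exp (- \<rho> * r) * Yp r \<omega> \<le> exp (- \<rho> * r) * (y * exp ((\<mu> + \<sigma>) * r))"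
    using Yp_le[OF assms(1), of r] assms by (intro mult_left_mono) auto
  also have "\<dots> = y * exp (- (\<rho> - \<mu> - \<sigma>) * r)"
    by (simp add: exp_add[symmetric] algebra_simps)
  also have "\<dots> \<le> y * exp (- (\<rho> - \<mu> - \<sigma>) * t)"
    using assms rho_gt y_nonneg by (intro mult_left_mono) auto
  finally show ?thesis .
qed

text \<open>The reward cannot drop fast, since \<open>Y\<close> has bounded logarithmic slope.\<close>

lemma payoff_increment:
  assumes w: "\<omega> \<in> space M" and r: "0 \<le> r" "r \<le> r'" "r' \<le> r + h"
  shows "exp (- \<rho> * r) * (Yp r \<omega> - a) \<le> exp (- \<rho> * r') * (Yp r' \<omega> - a) + y * (\<rho> + \<sigma>) * h"
proof -
  define D where "D = exp (- \<rho> * r) * Yp r \<omega>"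
  have D: "0 \<le> D" "D \<le> y"
    using discounted_price_le[OF w _ r(1)] Yp_nonneg by (auto simp: D_def)
  have I: "\<bar>I r' \<omega> - I r \<omega>\<bar> \<le> r' - r" by (rule abs_I_diff_le[OF w r(1,2)])
  define e where "e = - \<rho> * (r' - r) + \<mu> * (r' - r) + \<sigma> * (I r' \<omega> - I r \<omega>)"
  have "\<sigma> * - (I r' \<omega> - I r \<omega>) \<le> \<sigma> * (r' - r)" using I sigma_pos by (intro mult_left_mono) auto
  moreover have "0 \<le> \<mu> * (r' - r)" using mu_pos r by simp
  moreover have "(\<rho> + \<sigma>) * (r' - r) \<le> (\<rho> + \<sigma>) * h"
    using rho_pos sigma_pos r by (intro mult_left_mono) auto
  ultimately have e: "- ((\<rho> + \<sigma>) * h) \<le> e" by (simp add: e_def algebra_simps)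
  have "exp (- \<rho> * r') * Yp r' \<omega> = D * exp e"
    by (simp add: D_def e_def Y_eq[OF y_nonneg mu_pos sigma_pos] exp_add[symmetric] algebra_simps)
  also have "D * exp e \<ge> D * (1 + e)"
    using D by (intro mult_left_mono) auto
  also have "D * (1 + e) \<ge> D * (1 - (\<rho> + \<sigma>) * h)"
    using D e by (intro mult_left_mono) auto
  finally have "D - D * ((\<rho> + \<sigma>) * h) \<le> exp (- \<rho> * r') * Yp r' \<omega>" by (simp add: algebra_simps)
  moreover have "D * ((\<rho> + \<sigma>) * h) \<le> y * ((\<rho> + \<sigma>) * h)"
    using D r rho_pos sigma_pos by (intro mult_right_mono) auto
  moreover have "exp (- \<rho> * r') * a \<le> exp (- \<rho> * r) * a"
    using r rho_pos a_pos by (intro mult_right_mono) auto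
  ultimately show ?thesis by (simp add: D_def algebra_simps)
qed

text \<open>The stopping time is rounded up to the grid: \<open>k * h < \<tau> \<omega>\<close> then
  says that \<open>k\<close> lies before the rounded index, and the sum telescopes to an increment
  of \<open>Z\<close>. The delay is paid for by \<open>payoff_increment\<close>. On paths that stop
  after \<open>T\<close>, the sum runs through to \<open>Z T \<ge> 0\<close> and the reward is
  covered by the exponential tail.\<close>

lemma reward_le_grid:
  fixes T n :: nat and \<tau> :: "'a \<Rightarrow> ennreal"
  assumes n: "0 < n" and w: "\<omega> \<in> space M"
  defines "h \<equiv> 1 / real n"
  shows "rew (\<tau> \<omega>) \<omega> \<le> Z 0 \<omega> + (\<Sum>k<T * n. indicator {\<omega> \<in> space M. ennreal (real k * h) < \<tau> \<omega>} \<omega> * (Z (real k * h + h) \<omega> - Z (real k * h) \<omega>))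
     + (y * (\<rho> + \<sigma>) * h + y * exp (- (\<rho> - \<mu> - \<sigma>) * T))"
proof -
  define N where "N = T * n"
  have h: "0 < h" using n by (simp add: h_def)
  have Nh: "real N * h = T" using n by (simp add: N_def h_def)
  define f where "f k = Z (real k * h) \<omega>" for k
  have rem: "0 \<le> y * (\<rho> + \<sigma>) * h" "0 \<le> y * exp (- (\<rho> - \<mu> - \<sigma>) * T)"
    using y_nonneg rho_pos sigma_pos h by auto
  have sum_eq: "(\<Sum>k<T * n. indicator {\<omega> \<in> space M. ennreal (real k * h) < \<tau> \<omega>} \<omega> * (Z (real k * h + h) \<omega> - Z (real k * h) \<omega>))
      = f \<kappa> - f 0" if \<kappa>: "\<kappa> \<le> N" and iff: "\<And>k. k < N \<Longrightarrow> ennreal (real k * h) < \<tau> \<omega> \<longleftrightarrow> k < \<kappa>" for \<kappa>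
  proof -
    have "(\<Sum>k<N. indicator {\<omega> \<in> space M. ennreal (real k * h) < \<tau> \<omega>} \<omega> * (Z (real k * h + h) \<omega> - Z (real k * h) \<omega>))
        = (\<Sum>k<N. if k < \<kappa> then f (Suc k) - f k else 0)"
      using w iff by (intro sum.cong) (auto simp: f_def indicator_def algebra_simps)
    then show ?thesis unfolding sum_telescope_stopped[OF \<kappa>] N_def[symmetric] .
  qed
  have f0: "f 0 = Z 0 \<omega>" by (simp add: f_def)
  show ?thesis
  proof (cases "\<tau> \<omega> \<le> ennreal T")
    case True
    then obtain r where r: "0 \<le> r" "\<tau> \<omega> = ennreal r" "r \<le> T"
      by (cases "\<tau> \<omega>") (auto simp: ennreal_le_iff top_unique)
    \<comment> \<open>The least index with \<open>r \<le> \<kappa> * h\<close>; stopping at time 0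
      gives the empty sum.\<close>
    define \<kappa> where "\<kappa> = nat \<lceil>r / h\<rceil>"
    have \<kappa>_ge: "r / h \<le> real \<kappa>" and \<kappa>_lt: "real \<kappa> < r / h + 1"
      using r h unfolding \<kappa>_def by (simp_all add: of_nat_ceiling) (linarith | simp)+
    have "r / h \<le> real N" using r Nh h by (simp add: divide_le_eq)
    then have \<kappa>N: "\<kappa> \<le> N" unfolding \<kappa>_def by (simp add: ceiling_le_iff)
    have iff: "ennreal (real k * h) < \<tau> \<omega> \<longleftrightarrow> k < \<kappa>" for k
    proof -
      have "ennreal (real k * h) < \<tau> \<omega> \<longleftrightarrow> real k * h < r"
        using r h by (simp add: ennreal_less_iff)
      also have "\<dots> \<longleftrightarrow> real k < r / h" using h by (simp add: less_divide_eq)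
      also have "\<dots> \<longleftrightarrow> k < \<kappa>" unfolding \<kappa>_def by (simp add: zless_nat_eq_int_zless less_ceiling_iff)
      finally show ?thesis .
    qed
    have k1: "r \<le> real \<kappa> * h" using \<kappa>_ge h by (simp add: divide_le_eq)
    have k2: "real \<kappa> * h \<le> r + h" using mult_right_mono[OF less_imp_le[OF \<kappa>_lt], of h] h by (simp add: distrib_right)
    have pos: "0 \<le> real \<kappa> * h" using h by simp
    have "rew (\<tau> \<omega>) \<omega> = exp (- \<rho> * r) * (Yp r \<omega> - a)"
      using r by (simp add: reward_def)
    also have "\<dots> \<le> exp (- \<rho> * (real \<kappa> * h)) * (Yp (real \<kappa> * h) \<omega> - a) + y * (\<rho> + \<sigma>) * h"
      by (rule payoff_increment[OF w r(1) k1 k2])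
    also have "exp (- \<rho> * (real \<kappa> * h)) * (Yp (real \<kappa> * h) \<omega> - a) \<le> f \<kappa>"
      unfolding f_def Z_def using v_ge[OF xi_states[OF pos w] Yp_nonneg] by (intro mult_left_mono) auto
    finally show ?thesis using sum_eq[OF \<kappa>N iff] rem f0 by simp
  next
    case False
    then have gt: "ennreal T < \<tau> \<omega>" by simp
    have iff: "ennreal (real k * h) < \<tau> \<omega> \<longleftrightarrow> k < N" if "k < N" for k
    proof -
      have "real k * h \<le> real N * h" using that h by (intro mult_right_mono) auto
      then have "ennreal (real k * h) \<le> ennreal T" unfolding Nh by (rule ennreal_leI)
      from le_less_trans[OF this gt] show ?thesis using that by simp
    qed
    have "0 \<le> f N" unfolding f_def using h w by (intro Z_nonneg) auto
    moreover have "rew (\<tau> \<omega>) \<omega> \<le> y * exp (- (\<rho> - \<mu> - \<sigma>) * T)"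
    proof (cases "\<tau> \<omega>")
      case (real r)
      then have "real T \<le> r" using gt by (simp add: ennreal_less_iff)
      then have "exp (- \<rho> * r) * Yp r \<omega> \<le> y * exp (- (\<rho> - \<mu> - \<sigma>) * T)"
        by (intro discounted_price_le[OF w]) auto
      moreover have "0 \<le> exp (- \<rho> * r) * a" using a_pos by simp
      ultimately show ?thesis using real by (simp add: reward_def right_diff_distrib)
    qed (use rem in \<open>simp add: reward_def\<close>)
    ultimately show ?thesis using sum_eq[OF order_refl iff] rem f0 by simp
  qed
qed

lemma expected_reward_le:
  assumes \<tau>: "stopping_time (completed_filtration M \<xi>) \<tau>"
  shows "(\<integral>\<omega>. rew (\<tau> \<omega>) \<omega> \<partial>completion M) \<le> v y s"
proof (cases "integrable (completion M) (\<lambda>\<omega>. rew (\<tau> \<omega>) \<omega>)")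
  \<comment> \<open>The integral of a non-integrable function is 0 by convention, and
    \<open>v\<close> is nonnegative.\<close>
  case False
  then show ?thesis
    using v_nonneg[OF s_states y_nonneg] by (simp add: not_integrable_integral_eq)
next
  case True
  have bound: "(\<integral>\<omega>. rew (\<tau> \<omega>) \<omega> \<partial>completion M) \<le> v y s + y * exp (- (\<rho> - \<mu> - \<sigma>) * T)" for T :: nat
  proof -
    obtain K where K0: "0 \<le> K" and step:
      "\<And>t h A. 0 \<le> t \<Longrightarrow> 0 \<le> h \<Longrightarrow> h \<le> 1 \<Longrightarrow> t + h \<le> real T \<Longrightarrow> A \<in> sets (F t) \<Longrightarrow>
       integrable M (\<lambda>\<omega>. indicator A \<omega> * (Z (t + h) \<omega> - Z t \<omega>)) \<and>
       (\<integral>\<omega>. indicator A \<omega> * (Z (t + h) \<omega> - Z t \<omega>) \<partial>M) \<le> K * h\<^sup>2 \<and>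
       ((\<forall>\<omega>\<in>A. Yp t \<omega> < u (\<xi> t \<omega>)) \<longrightarrow> - (K * h\<^sup>2) \<le> (\<integral>\<omega>. indicator A \<omega> * (Z (t + h) \<omega> - Z t \<omega>) \<partial>M))"
    proof (rule Z_step[OF of_nat_0_le_iff[of T]], goal_cases)
      case (1 K)
      show ?case by (rule 1(1)[OF 1(2,3)])
    qed
    have K: "integrable M (\<lambda>\<omega>. indicator A \<omega> * (Z (t + h) \<omega> - Z t \<omega>)) \<and>
       (\<integral>\<omega>. indicator A \<omega> * (Z (t + h) \<omega> - Z t \<omega>) \<partial>M) \<le> K * h\<^sup>2"
      if "0 \<le> t" "0 \<le> h" "h \<le> 1" "t + h \<le> real T" "A \<in> sets (F t)" for t h A
      using step[OF that] by (elim conjE) (intro conjI)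
    have grid: "(\<integral>\<omega>. rew (\<tau> \<omega>) \<omega> \<partial>completion M) \<le> v y s + y * exp (- (\<rho> - \<mu> - \<sigma>) * T) + (T * K + y * (\<rho> + \<sigma>)) * (1 / real n)"
      if n: "0 < n" for n :: nat
    proof -
      define h where "h = 1 / real n"
      define A where "A k = {\<omega> \<in> space M. ennreal (real k * h) < \<tau> \<omega>}" for k
      define c where "c = y * (\<rho> + \<sigma>) * h + y * exp (- (\<rho> - \<mu> - \<sigma>) * T)"
      have h: "0 < h" "h \<le> 1" using n by (auto simp: h_def)
      have Nh: "real (T * n) * h = T" using n by (simp add: h_def)
      have A: "A k \<in> sets (completed_filtration M \<xi> (ennreal (real k * h)))" for k
      proof -
        \<comment> \<open>The complement of this event is \<open>A k\<close>, which is therefore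
          known at time \<open>k * h\<close>.\<close>
        have "{\<omega> \<in> space M. \<tau> \<omega> \<le> ennreal (real k * h)} \<in> sets (completed_filtration M \<xi> (ennreal (real k * h)))"
          using \<tau> by (simp add: stopping_time_def pred_def space_completed_filtration)
        from sets.compl_sets[OF this] show ?thesis
          by (rule back_subst[where P = "\<lambda>S. S \<in> _"]) (auto simp: A_def space_completed_filtration)
      qed
      have step: "integrable (completion M) (\<lambda>\<omega>. indicator (A k) \<omega> * (Z (real k * h + h) \<omega> - Z (real k * h) \<omega>))"
        "(\<integral>\<omega>. indicator (A k) \<omega> * (Z (real k * h + h) \<omega> - Z (real k * h) \<omega>) \<partial>completion M) \<le> K * h\<^sup>2"
        if k: "k < T * n" for k
      proof -
        have "real (Suc k) \<le> real (T * n)" using k unfolding of_nat_le_iff by simp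
        then have "real (Suc k) * h \<le> real (T * n) * h"
          using h by (intro mult_right_mono) auto
        then have le: "real k * h + h \<le> T" unfolding Nh by (simp add: distrib_right)
        show "integrable (completion M) (\<lambda>\<omega>. indicator (A k) \<omega> * (Z (real k * h + h) \<omega> - Z (real k * h) \<omega>))"
          by (rule Z_step_completed(1)[OF K A]) (use h le in auto)
        show "(\<integral>\<omega>. indicator (A k) \<omega> * (Z (real k * h + h) \<omega> - Z (real k * h) \<omega>) \<partial>completion M) \<le> K * h\<^sup>2"
          by (rule Z_step_completed(2)[OF K A]) (use h le in auto)
      qed
      have Z0: "integrable (completion M) (Z 0)" "(\<integral>\<omega>. Z 0 \<omega> \<partial>completion M) = v y s"
        using integral_Z_0 borel_measurable_integrable[OF integral_Z_0(1)]
        by (simp_all add: integrable_completion integral_completion)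
      have "(\<integral>\<omega>. rew (\<tau> \<omega>) \<omega> \<partial>completion M)
          \<le> (\<integral>\<omega>. Z 0 \<omega> + (\<Sum>k<T * n. indicator (A k) \<omega> * (Z (real k * h + h) \<omega> - Z (real k * h) \<omega>)) + c \<partial>completion M)"
      proof (rule integral_mono[OF True])
        show "integrable (completion M) (\<lambda>\<omega>. Z 0 \<omega> + (\<Sum>k<T * n. indicator (A k) \<omega> * (Z (real k * h + h) \<omega> - Z (real k * h) \<omega>)) + c)"
          by (rule prob_space.integral_add_sum(1)[OF prob_space_completion Z0(1) step(1)])
        fix \<omega> assume "\<omega> \<in> space (completion M)"
        then show "rew (\<tau> \<omega>) \<omega> \<le> Z 0 \<omega> + (\<Sum>k<T * n. indicator (A k) \<omega> * (Z (real k * h + h) \<omega> - Z (real k * h) \<omega>)) + c"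
          using reward_le_grid[OF n, of \<omega> \<tau> T] by (simp add: A_def c_def h_def)
      qed
      also have "\<dots> = v y s + (\<Sum>k<T * n. \<integral>\<omega>. indicator (A k) \<omega> * (Z (real k * h + h) \<omega> - Z (real k * h) \<omega>) \<partial>completion M) + c"
        by (rule trans[OF prob_space.integral_add_sum(2)[OF prob_space_completion Z0(1) step(1)]])
           (simp_all only: Z0(2))
      also have "\<dots> \<le> v y s + (\<Sum>k<T * n. K * h\<^sup>2) + c"
        using step(2) by (intro add_mono sum_mono) auto
      also have "(\<Sum>k<T * n. K * h\<^sup>2) = (real (T * n) * h) * (K * h)"
        by (simp add: power2_eq_square)
      finally show ?thesis unfolding Nh by (simp add: c_def algebra_simps flip: h_def)
    qed
    show ?thesis
    proof (rule LIMSEQ_le_const)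
      show "(\<lambda>n. v y s + y * exp (- (\<rho> - \<mu> - \<sigma>) * T) + (T * K + y * (\<rho> + \<sigma>)) * (1 / real n)) \<longlonglongrightarrow> v y s + y * exp (- (\<rho> - \<mu> - \<sigma>) * T)"
        by real_asymp
      show "\<exists>N. \<forall>n\<ge>N. (\<integral>\<omega>. rew (\<tau> \<omega>) \<omega> \<partial>completion M) \<le> v y s + y * exp (- (\<rho> - \<mu> - \<sigma>) * T) + (T * K + y * (\<rho> + \<sigma>)) * (1 / real n)"
        using grid by (intro exI[of _ 1]) auto
    qed
  qed
  have d: "0 < \<rho> - \<mu> - \<sigma>" using rho_gt by simp
  have "(\<lambda>T. v y s + y * exp (- (\<rho> - \<mu> - \<sigma>) * real T)) \<longlonglongrightarrow> v y s"
    using d by real_asymp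
  then show ?thesis
    using bound by (intro LIMSEQ_le_const) auto
qed

end

section \<open>Lower bound: grid stopping times approach the candidate\<close>

context verification_chain
begin

text \<open>The first grid point \<open>k / n\<close> at which the pair is in the stopping region is optimal up to an
  error that vanishes with the mesh, although the region may be entered between grid points.\<close>

lemma expected_reward_grid:
  fixes T :: nat
  shows "\<exists>K. \<forall>n>0. \<exists>\<tau>. stopping_time (completed_filtration M \<xi>) \<tau> \<and>
     v y s - (y * exp (- (\<rho> - \<mu> - \<sigma>) * T) + \<bar>B0\<bar> * exp (- \<rho> * T)) - K * (1 / real n)
       \<le> (\<integral>\<omega>. rew (\<tau> \<omega>) \<omega> \<partial>completion M)"
proof -
  obtain K where K0: "0 \<le> K" and step:
    "\<And>t h A. 0 \<le> t \<Longrightarrow> 0 \<le> h \<Longrightarrow> h \<le> 1 \<Longrightarrow> t + h \<le> real (Suc T) \<Longrightarrow> A \<in> sets (F t) \<Longrightarrow>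
     integrable M (\<lambda>\<omega>. indicator A \<omega> * (Z (t + h) \<omega> - Z t \<omega>)) \<and>
     (\<integral>\<omega>. indicator A \<omega> * (Z (t + h) \<omega> - Z t \<omega>) \<partial>M) \<le> K * h\<^sup>2 \<and>
     ((\<forall>\<omega>\<in>A. Yp t \<omega> < u (\<xi> t \<omega>)) \<longrightarrow> - (K * h\<^sup>2) \<le> (\<integral>\<omega>. indicator A \<omega> * (Z (t + h) \<omega> - Z t \<omega>) \<partial>M))"
  proof (rule Z_step[OF of_nat_0_le_iff[of "Suc T"]], goal_cases)
    case (1 K)
    show ?case by (rule 1(1)[OF 1(2,3)])
  qed
  have "\<exists>\<tau>. stopping_time (completed_filtration M \<xi>) \<tau> \<and>
     v y s - (y * exp (- (\<rho> - \<mu> - \<sigma>) * T) + \<bar>B0\<bar> * exp (- \<rho> * T)) - (T * K) * (1 / real n)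
       \<le> (\<integral>\<omega>. rew (\<tau> \<omega>) \<omega> \<partial>completion M)" if n: "0 < n" for n :: nat
  proof -
    define h where "h = 1 / real n"
    define N where "N = T * n"
    have h: "0 < h" "h \<le> 1" using n by (auto simp: h_def)
    have Nh: "real N * h = T" using n by (simp add: h_def N_def)
    define D where "D k = {\<omega> \<in> space M. u (\<xi> (real k * h) \<omega>) \<le> Yp (real k * h) \<omega>}" for k
    \<comment> \<open>On paths that avoid the stopping region on the grid up to \<open>T\<close>,
      the value \<open>\<infinity>\<close> yields reward 0 instead of a possibly negative
      payoff.\<close>
    define \<tau> where "\<tau> \<omega> = (if \<exists>k\<le>N. \<omega> \<in> D k then ennreal (real (LEAST k. \<omega> \<in> D k) * h) else \<infinity>)" for \<omega>
    \<comment> \<open>\<open>E k\<close> also excludes stopping at \<open>k\<close> itself, so on it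
      the price lies strictly below the threshold at time \<open>k * h\<close>, as the lower half of
      \<open>Z_step\<close> demands; it is still an event known at that time.\<close>
    define E where "E k = space M - (\<Union>j\<le>k. D j)" for k
    have th: "0 \<le> real k * h" for k using h by simp
    have D: "D k \<in> sets (F (real k * h))" for k
    proof -
      have [measurable]: "\<xi> (real k * h) \<in> borel_measurable (F (real k * h))" "Yp (real k * h) \<in> borel_measurable (F (real k * h))"
        using xi_measurable_F[OF th order_refl] Y_measurable_F[OF y_nonneg mu_pos sigma_pos th] by auto
      have "{\<omega> \<in> space (F (real k * h)). (if \<xi> (real k * h) \<omega> = 1 then u 1 else u (- 1)) \<le> Yp (real k * h) \<omega>} \<in> sets (F (real k * h))"
        by measurable
      moreover have "(if \<xi> (real k * h) \<omega> = 1 then u 1 else u (- 1)) = u (\<xi> (real k * h) \<omega>)" if "\<omega> \<in> space M" for \<omega>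
        using xi_states[OF th that, of k] by (auto simp: mem_states_iff)
      ultimately show ?thesis unfolding D_def by (simp cong: conj_cong)
    qed
    have Dsub: "D k \<subseteq> space M" for k by (auto simp: D_def)
    have mono: "sets (F (real j * h)) \<subseteq> sets (F (real k * h))" if "j \<le> k" for j k
      using that h by (intro sets_natural_filtration_mono ennreal_leI mult_right_mono) auto
    have E: "E k \<in> sets (F (real k * h))" for k
    proof -
      have "(\<Union>j\<le>k. D j) \<in> sets (F (real k * h))"
        using D mono by (intro sets.finite_UN) auto
      from sets.compl_sets[OF this] show ?thesis by (simp add: E_def)
    qed
    \<comment> \<open>For \<open>t \<noteq> \<infinity>\<close> the event
      \<open>\<tau> \<omega> \<le> t\<close> thus becomes a finite union of sets \<open>D k\<close>
      with grid time at most \<open>t\<close>; at \<open>t = \<infinity>\<close> it is the whole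
      space.\<close>
    have \<tau>_le: "\<tau> \<omega> \<le> t \<longleftrightarrow> (\<exists>k\<le>N. \<omega> \<in> D k \<and> ennreal (real k * h) \<le> t)" if "t \<noteq> \<infinity>" for \<omega> t
    proof
      assume le: "\<tau> \<omega> \<le> t"
      then have ex: "\<exists>k\<le>N. \<omega> \<in> D k" using that by (auto simp: \<tau>_def top_unique split: if_splits)
      then obtain k where k: "k \<le> N" "\<omega> \<in> D k" by blast
      have "(LEAST k. \<omega> \<in> D k) \<le> N" using Least_le[of "\<lambda>k. \<omega> \<in> D k", OF k(2)] k(1) by simp
      then show "\<exists>k\<le>N. \<omega> \<in> D k \<and> ennreal (real k * h) \<le> t"
        using LeastI[of "\<lambda>k. \<omega> \<in> D k", OF k(2)] le ex by (auto simp: \<tau>_def)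
    next
      assume "\<exists>k\<le>N. \<omega> \<in> D k \<and> ennreal (real k * h) \<le> t"
      then obtain k where k: "k \<le> N" "\<omega> \<in> D k" "ennreal (real k * h) \<le> t" by blast
      have "ennreal (real (LEAST k. \<omega> \<in> D k) * h) \<le> ennreal (real k * h)"
        using Least_le[of "\<lambda>k. \<omega> \<in> D k", OF k(2)] h by (intro ennreal_leI mult_right_mono) auto
      then show "\<tau> \<omega> \<le> t" using k by (auto simp: \<tau>_def)
    qed
    have st: "stopping_time (completed_filtration M \<xi>) \<tau>"
      unfolding stopping_time_def pred_def space_completed_filtration
    proof
      fix t :: ennreal
      have sub: "sets (natural_filtration M \<xi> t) \<subseteq> sets (completed_filtration M \<xi> t)"
      proof -
        have "sets (natural_filtration M \<xi> t) \<union> null_sets (completion M) \<subseteq> Pow (space M)"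
          using sets.space_closed[of "natural_filtration M \<xi> t"] sets.space_closed[of "completion M"] by auto
        then show ?thesis by (auto simp: completed_filtration_def sets_measure_of)
      qed
      show "{\<omega> \<in> space M. \<tau> \<omega> \<le> t} \<in> sets (completed_filtration M \<xi> t)"
      proof (cases "t = \<infinity>")
        case True
        then show ?thesis using sets.top[of "completed_filtration M \<xi> t"] by (simp add: space_completed_filtration)
      next
        case False
        have "{\<omega> \<in> space M. \<tau> \<omega> \<le> t} = (\<Union>k\<in>{k. k \<le> N \<and> ennreal (real k * h) \<le> t}. D k)"
          using Dsub by (auto simp: \<tau>_le[OF False])
        also have "\<dots> \<in> sets (natural_filtration M \<xi> t)"
          using D sets_natural_filtration_mono[of _ t] by (intro sets.finite_UN) auto
        finally show ?thesis using sub by blast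
      qed
    qed
    \<comment> \<open>The sum telescopes to \<open>Z\<close> at the stopping time, or at
      \<open>T\<close> if there is none; the last term removes the value forfeited in that case.
      Equality with the reward is exact, because finite values of \<open>\<tau>\<close> are grid
      times and \<open>v\<close> is the payoff in the stopping region.\<close>
    define S where "S \<omega> = Z 0 \<omega> + (\<Sum>k<N. indicator (E k) \<omega> * (Z (real k * h + h) \<omega> - Z (real k * h) \<omega>)) - indicator (E N) \<omega> * Z T \<omega>" for \<omega>
    have rew_eq: "rew (\<tau> \<omega>) \<omega> = S \<omega>" if w: "\<omega> \<in> space M" for \<omega>
    proof -
      define f where "f k = Z (real k * h) \<omega>" for k
      have sum_eq: "(\<Sum>k<N. indicator (E k) \<omega> * (Z (real k * h + h) \<omega> - Z (real k * h) \<omega>)) = f \<kappa> - f 0"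
        if \<kappa>: "\<kappa> \<le> N" and iff: "\<And>k. k < N \<Longrightarrow> \<omega> \<in> E k \<longleftrightarrow> k < \<kappa>" for \<kappa>
      proof -
        have "(\<Sum>k<N. indicator (E k) \<omega> * (Z (real k * h + h) \<omega> - Z (real k * h) \<omega>))
            = (\<Sum>k<N. if k < \<kappa> then f (Suc k) - f k else 0)"
          using iff by (intro sum.cong) (auto simp: f_def indicator_def algebra_simps)
        then show ?thesis unfolding sum_telescope_stopped[OF \<kappa>] .
      qed
      show ?thesis
      proof (cases "\<exists>k\<le>N. \<omega> \<in> D k")
        case True
        define \<kappa> where "\<kappa> = (LEAST k. \<omega> \<in> D k)"
        obtain k where k: "k \<le> N" "\<omega> \<in> D k" using True by blast
        have \<kappa>: "\<omega> \<in> D \<kappa>" "\<kappa> \<le> N" unfolding \<kappa>_def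
          using LeastI[of "\<lambda>k. \<omega> \<in> D k", OF k(2)] Least_le[of "\<lambda>k. \<omega> \<in> D k", OF k(2)] k(1) by auto
        have iff: "\<omega> \<in> E k \<longleftrightarrow> k < \<kappa>" for k
          using \<kappa>(1) not_less_Least[of _ "\<lambda>k. \<omega> \<in> D k"] w unfolding E_def \<kappa>_def[symmetric]
          by (auto simp: not_le)
        have "v (Yp (real \<kappa> * h) \<omega>) (\<xi> (real \<kappa> * h) \<omega>) = Yp (real \<kappa> * h) \<omega> - a"
          using \<kappa>(1) v_stop[OF xi_states[OF th w] Yp_nonneg] by (simp add: D_def)
        then have "rew (\<tau> \<omega>) \<omega> = f \<kappa>"
          using True th[of \<kappa>] by (simp add: \<tau>_def reward_def f_def Z_def \<kappa>_def[symmetric])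
        moreover have "\<omega> \<notin> E N" using iff \<kappa>(2) by simp
        ultimately show ?thesis
          unfolding S_def sum_eq[OF \<kappa>(2) iff] by (simp add: f_def)
      next
        case False
        then have iff: "\<omega> \<in> E k \<longleftrightarrow> k < N" if "k < N" for k
          using that w by (auto simp: E_def)
        have \<tau>_inf: "\<tau> \<omega> = \<infinity>" unfolding \<tau>_def using False by (simp only: if_False)
        have "\<omega> \<in> E N" using False w by (auto simp: E_def)
        moreover have "(\<Sum>k<N. indicator (E k) \<omega> * (Z (real k * h + h) \<omega> - Z (real k * h) \<omega>)) = f N - f 0"
          by (rule sum_eq[OF order_refl]) (rule iff)
        ultimately show ?thesis
          unfolding S_def using \<tau>_inf by (simp add: f_def Nh reward_def)
      qed
    qed
    have step': "integrable M (\<lambda>\<omega>. indicator (E k) \<omega> * (Z (real k * h + h) \<omega> - Z (real k * h) \<omega>))"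
      "- (K * h\<^sup>2) \<le> (\<integral>\<omega>. indicator (E k) \<omega> * (Z (real k * h + h) \<omega> - Z (real k * h) \<omega>) \<partial>M)"
      if k: "k < N" for k
    proof -
      have "real (Suc k) \<le> real N" using k unfolding of_nat_le_iff by simp
      then have "real (Suc k) * h \<le> real N * h"
        using h by (intro mult_right_mono) auto
      then have le: "real k * h + h \<le> real (Suc T)" unfolding Nh by (simp add: distrib_right)
      have "\<forall>\<omega>\<in>E k. Yp (real k * h) \<omega> < u (\<xi> (real k * h) \<omega>)"
        by (auto simp: E_def D_def not_le)
      then show "integrable M (\<lambda>\<omega>. indicator (E k) \<omega> * (Z (real k * h + h) \<omega> - Z (real k * h) \<omega>))"
        "- (K * h\<^sup>2) \<le> (\<integral>\<omega>. indicator (E k) \<omega> * (Z (real k * h + h) \<omega> - Z (real k * h) \<omega>) \<partial>M)"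
        using step[OF th less_imp_le[OF h(1)] h(2) le E] by blast+
    qed
    define c where "c = y * exp (- (\<rho> - \<mu> - \<sigma>) * T) + \<bar>B0\<bar> * exp (- \<rho> * T)"
    have c: "0 \<le> c" using y_nonneg by (simp add: c_def)
    have ZT_le: "indicator (E N) \<omega> * Z T \<omega> \<le> c" if w: "\<omega> \<in> space M" for \<omega>
    proof -
      have "Z T \<omega> \<le> exp (- \<rho> * T) * (Yp T \<omega> + \<bar>B0\<bar>)"
        unfolding Z_def using v_le[OF xi_states[of T \<omega>] Yp_nonneg[of T \<omega>]] w
        by (intro mult_left_mono) auto
      then have "Z T \<omega> \<le> c"
        using discounted_price_le[OF w _ order_refl, of T] by (simp add: c_def algebra_simps)
      then show ?thesis using c by (simp add: indicator_def)
    qed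
    have ZT: "integrable M (\<lambda>\<omega>. indicator (E N) \<omega> * Z T \<omega>)"
    proof -
      \<comment> \<open>Integrability at grid times is built up from time 0 by adding increments
        over the whole space.\<close>
      have zk: "integrable M (Z (real k * h))" if "k \<le> N" for k
        using that
      proof (induction k)
        case 0
        then show ?case using integral_Z_0 by simp
      next
        case (Suc k)
        have "real (Suc k) * h \<le> real N * h"
          using h Suc.prems by (intro mult_right_mono) auto
        then have le: "real k * h + h \<le> real (Suc T)" unfolding Nh by (simp add: distrib_right)
        have "integrable M (\<lambda>\<omega>. indicator (space M) \<omega> * (Z (real k * h + h) \<omega> - Z (real k * h) \<omega>))"
          using step[OF th less_imp_le[OF h(1)] h(2) le, of "space M"] sets.top[of "F (real k * h)"] by simp
        then have "integrable M (\<lambda>\<omega>. Z (real k * h) \<omega> + indicator (space M) \<omega> * (Z (real k * h + h) \<omega> - Z (real k * h) \<omega>))"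
          using Suc by (intro Bochner_Integration.integrable_add) auto
        then show ?case
          by (rule Bochner_Integration.integrable_cong[THEN iffD1, rotated 2]) (auto simp: algebra_simps)
      qed
      have "E N \<in> sets M" using E[of N] sets_natural_filtration_le by blast
      from integrable_mult_indicator[OF this zk[OF order_refl]] show ?thesis by (simp add: Nh)
    qed
    \<comment> \<open>The trailing 0 fits the shape of \<open>integral_add_sum\<close>.\<close>
    define R where "R \<omega> = Z 0 \<omega> + (\<Sum>k<N. indicator (E k) \<omega> * (Z (real k * h + h) \<omega> - Z (real k * h) \<omega>)) + 0" for \<omega>
    have S_eq: "S = (\<lambda>\<omega>. R \<omega> - indicator (E N) \<omega> * Z T \<omega>)"
      by (rule ext) (simp only: S_def R_def add_0_right)
    have R: "integrable M R"
      unfolding R_def by (rule integral_add_sum(1)[OF integral_Z_0(1) step'(1)])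
    have R': "(\<integral>\<omega>. R \<omega> \<partial>M) = v y s + (\<Sum>k<N. \<integral>\<omega>. indicator (E k) \<omega> * (Z (real k * h + h) \<omega> - Z (real k * h) \<omega>) \<partial>M) + 0"
      unfolding R_def
      by (rule trans[OF integral_add_sum(2)[OF integral_Z_0(1) step'(1)]]) (simp_all only: integral_Z_0(2))
    have S: "integrable M S"
      unfolding S_eq using R ZT by (rule Bochner_Integration.integrable_diff)
    have "(\<integral>\<omega>. rew (\<tau> \<omega>) \<omega> \<partial>completion M) = (\<integral>\<omega>. S \<omega> \<partial>completion M)"
      using rew_eq by (intro Bochner_Integration.integral_cong) auto
    also have "\<dots> = (\<integral>\<omega>. S \<omega> \<partial>M)"
      using S by (intro integral_completion) auto
    also have "\<dots> = v y s + (\<Sum>k<N. \<integral>\<omega>. indicator (E k) \<omega> * (Z (real k * h + h) \<omega> - Z (real k * h) \<omega>) \<partial>M) - (\<integral>\<omega>. indicator (E N) \<omega> * Z T \<omega> \<partial>M)"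
      unfolding S_eq using R R' ZT by (simp only: Bochner_Integration.integral_diff add_0_right)
    also have "\<dots> \<ge> v y s + (\<Sum>k<N. - (K * h\<^sup>2)) - c"
    proof (intro add_mono diff_mono sum_mono order_refl)
      have "(\<integral>\<omega>. indicator (E N) \<omega> * Z T \<omega> \<partial>M) \<le> (\<integral>\<omega>. c \<partial>M)"
        using ZT ZT_le by (intro integral_mono) auto
      then show "(\<integral>\<omega>. indicator (E N) \<omega> * Z T \<omega> \<partial>M) \<le> c" by (simp add: prob_space)
    qed (use step'(2) in auto)
    also have "(\<Sum>k<N. - (K * h\<^sup>2)) = - ((real N * h) * (K * h))"
      by (simp add: power2_eq_square)
    finally have "v y s - c - (T * K) * h \<le> (\<integral>\<omega>. rew (\<tau> \<omega>) \<omega> \<partial>completion M)"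
      unfolding Nh by (simp add: algebra_simps)
    with st show ?thesis unfolding c_def h_def by blast
  qed
  then show ?thesis by blast
qed

text \<open>The premise ties the fixed measure \<open>M\<close> of the context to the family
  \<open>P\<close>. Both errors in \<open>expected_reward_grid\<close> vanish, the mesh error for
  fixed \<open>T\<close> and then the tail, so the supremum reaches \<open>v y s\<close> without
  exhibiting an optimal stopping time.\<close>

lemma value_function_eq:
  assumes "M = P s"
  shows "value_function \<mu> \<sigma> \<rho> a P \<xi> y s = ereal (v y s)"
proof -
  define G where "G = (SUP \<tau> \<in> {\<tau>. stopping_time (completed_filtration M \<xi>) \<tau>}.
        ereal (\<integral>\<omega>. rew (\<tau> \<omega>) \<omega> \<partial>completion M))"
  have "G \<le> ereal (v y s)"
    unfolding G_def by (intro SUP_least) (use expected_reward_le in auto)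
  moreover have "ereal (v y s) \<le> G"
  proof -
    have low: "ereal (v y s - (y * exp (- (\<rho> - \<mu> - \<sigma>) * T) + \<bar>B0\<bar> * exp (- \<rho> * T))) \<le> G" for T :: nat
    proof -
      define c where "c = v y s - (y * exp (- (\<rho> - \<mu> - \<sigma>) * T) + \<bar>B0\<bar> * exp (- \<rho> * T))"
      obtain K where K: "\<And>n :: nat. 0 < n \<Longrightarrow> \<exists>\<tau>. stopping_time (completed_filtration M \<xi>) \<tau> \<and>
         c - K * (1 / real n) \<le> (\<integral>\<omega>. rew (\<tau> \<omega>) \<omega> \<partial>completion M)"
        using expected_reward_grid[of T] unfolding c_def by blast
      have le: "ereal (c - K * (1 / real n)) \<le> G" if "0 < n" for n :: nat
      proof -
        obtain \<tau> where "stopping_time (completed_filtration M \<xi>) \<tau>"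
          "c - K * (1 / real n) \<le> (\<integral>\<omega>. rew (\<tau> \<omega>) \<omega> \<partial>completion M)"
          using K[OF \<open>0 < n\<close>] by blast
        then show ?thesis unfolding G_def by (intro SUP_upper2[of \<tau>]) auto
      qed
      have "(\<lambda>n. c - K * (1 / real n)) \<longlonglongrightarrow> c" by real_asymp
      then have "(\<lambda>n. ereal (c - K * (1 / real n))) \<longlonglongrightarrow> ereal c" by simp
      then have "ereal c \<le> G"
        by (rule LIMSEQ_le_const2) (use le in \<open>auto intro!: exI[of _ 1]\<close>)
      then show ?thesis by (simp add: c_def)
    qed
    have d: "0 < \<rho> - \<mu> - \<sigma>" using rho_gt by simp
    have e: "(\<lambda>T :: nat. exp (- r * real T)) \<longlonglongrightarrow> 0" if "0 < r" for r :: real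
      using that by real_asymp
    have "(\<lambda>T. v y s - (y * exp (- (\<rho> - \<mu> - \<sigma>) * real T) + \<bar>B0\<bar> * exp (- \<rho> * real T))) \<longlonglongrightarrow> v y s - (y * 0 + \<bar>B0\<bar> * 0)"
      by (intro tendsto_intros e d rho_pos)
    then have "(\<lambda>T. ereal (v y s - (y * exp (- (\<rho> - \<mu> - \<sigma>) * real T) + \<bar>B0\<bar> * exp (- \<rho> * real T)))) \<longlonglongrightarrow> ereal (v y s)"
      by simp
    then show ?thesis
      by (rule LIMSEQ_le_const2) (use low in auto)
  qed
  ultimately show ?thesis
    unfolding value_function_def G_def assms by (rule antisym)
qed

end

section \<open>The candidate value function\<close>

locale two_state =
  fixes lam \<mu> \<sigma> \<rho> a :: real
  assumes lambda_pos: "0 < lam" and mu_pos: "0 < \<mu>" and sigma_pos: "0 < \<sigma>" and a_pos: "0 < a"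
    and rho_gt: "\<mu> + \<sigma> < \<rho>" and mu_less: "\<mu> < \<sigma>"
begin

lemma rho_pos: "0 < \<rho>"
  using mu_pos sigma_pos rho_gt by simp

abbreviation "b \<equiv> b_const lam \<mu> \<sigma> \<rho>"
abbreviation "Om \<equiv> Omega lam \<mu> \<sigma> \<rho>"
abbreviation "Om_m \<equiv> Omega_minus lam \<mu> \<sigma> \<rho>"
abbreviation "om_m \<equiv> omega_minus lam \<mu> \<sigma> \<rho>"

definition up :: real where "up = a * (\<rho> / (\<rho> - \<mu> - \<sigma>))"
definition C :: real where "C = (1 - b) / (Om * up powr (Om - 1))"
text \<open>The affine part is a particular solution and \<open>y powr Om\<close> the homogeneous
  solution of \<open>(\<mu> + \<sigma>) * y * f' = (\<rho> + lam) * f - lam * (y - a)\<close>, the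
  equation of state 1 while state -1 already stops. \<open>C\<close> is chosen so that the slope at
  \<open>up\<close> is 1.\<close>

definition mid :: "real \<Rightarrow> real" where "mid y = b * y - a * (lam / (lam + \<rho>)) + C * y powr Om"
definition mid' :: "real \<Rightarrow> real" where "mid' y = b + C * (Om * y powr (Om - 1))"

lemma D_neg: "\<mu>\<^sup>2 - \<sigma>\<^sup>2 < 0"
  using mu_pos mu_less by (simp add: power2_eq_square mult_strict_mono)

text \<open>The squares differ by \<open>(\<sigma>\<^sup>2 - \<mu>\<^sup>2) * (\<rho>\<^sup>2 + 2 *
  lam * \<rho>)\<close>. As the common denominator is negative, this decides the signs of both
  exponents.\<close>

lemma discriminant_gt:
  "((lam + \<rho>) * \<mu>) < sqrt (lam\<^sup>2 * \<mu>\<^sup>2 + \<sigma>\<^sup>2 * (\<rho>\<^sup>2 + 2 * lam * \<rho>))"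
proof (rule real_less_rsqrt)
  have "0 < (\<sigma>\<^sup>2 - \<mu>\<^sup>2) * (\<rho>\<^sup>2 + 2 * lam * \<rho>)"
    using D_neg rho_pos lambda_pos by (intro mult_pos_pos add_pos_pos) auto
  then show "((lam + \<rho>) * \<mu>)\<^sup>2 < lam\<^sup>2 * \<mu>\<^sup>2 + \<sigma>\<^sup>2 * (\<rho>\<^sup>2 + 2 * lam * \<rho>)"
    by (simp add: power2_eq_square algebra_simps)
qed

lemma Om_m_pos: "0 < Om_m"
  unfolding Omega_minus_def using D_neg discriminant_gt by (intro divide_neg_neg) auto

lemma Omega_plus_neg: "Omega_plus lam \<mu> \<sigma> \<rho> < 0"
proof -
  have "0 < (lam + \<rho>) * \<mu>" using lambda_pos rho_pos mu_pos by simp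
  then show ?thesis
    unfolding Omega_plus_def using D_neg discriminant_gt by (intro divide_pos_neg) linarith+
qed

text \<open>Characteristic equation of the coupled linear system below both thresholds: a nonzero
  pair of multiples of \<open>y powr r\<close> solves both equations only if the two diagonal
  coefficients multiply to \<open>lam\<^sup>2\<close>.\<close>

lemma Om_m_root: "(\<rho> + lam - (\<mu> + \<sigma>) * Om_m) * (\<rho> + lam - (\<mu> - \<sigma>) * Om_m) = lam\<^sup>2"
proof -
  define D where "D = \<mu>\<^sup>2 - \<sigma>\<^sup>2"
  define S where "S = sqrt (lam\<^sup>2 * \<mu>\<^sup>2 + \<sigma>\<^sup>2 * (\<rho>\<^sup>2 + 2 * lam * \<rho>))"
  have S: "S\<^sup>2 = lam\<^sup>2 * \<mu>\<^sup>2 + \<sigma>\<^sup>2 * (\<rho>\<^sup>2 + 2 * lam * \<rho>)"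
    unfolding S_def using lambda_pos rho_pos by (intro real_sqrt_pow2) auto
  have D: "D \<noteq> 0" using D_neg by (simp add: D_def)
  define p where "p = (lam + \<rho>) * \<mu>"
  have DO: "D * Om_m = p - S" using D by (simp add: Omega_minus_def D_def S_def p_def)
  have "D * ((\<rho> + lam - (\<mu> + \<sigma>) * Om_m) * (\<rho> + lam - (\<mu> - \<sigma>) * Om_m))
      = D * (\<rho> + lam)\<^sup>2 - 2 * p * (D * Om_m) + (D * Om_m)\<^sup>2"
    unfolding D_def p_def by (simp add: power2_eq_square algebra_simps)
  also have "\<dots> = D * (\<rho> + lam)\<^sup>2 - p\<^sup>2 + S\<^sup>2"
    unfolding DO by (simp add: power2_eq_square algebra_simps)
  also have "\<dots> = D * lam\<^sup>2"
    unfolding S unfolding D_def p_def by (simp add: power2_eq_square algebra_simps)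
  finally show ?thesis using D by simp
qed

text \<open>The second factor in \<open>Om_m_root\<close> is nonnegative because
  \<open>\<mu> < \<sigma>\<close>, so a nonpositive first factor would contradict the value
  \<open>lam\<^sup>2\<close>.\<close>

lemma Om_m_less_Om: "(\<mu> + \<sigma>) * Om_m < lam + \<rho>"
proof (rule ccontr)
  assume "\<not> ?thesis"
  moreover have "0 \<le> \<rho> + lam - (\<mu> - \<sigma>) * Om_m"
    using mult_neg_pos[of "\<mu> - \<sigma>" Om_m] mu_less Om_m_pos rho_pos lambda_pos by simp
  ultimately have "(\<rho> + lam - (\<mu> + \<sigma>) * Om_m) * (\<rho> + lam - (\<mu> - \<sigma>) * Om_m) \<le> 0"
    by (intro mult_nonpos_nonneg) auto
  then show False using Om_m_root lambda_pos by simp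
qed

text \<open>With an exponent at most 1 both factors in \<open>Om_m_root\<close> would exceed
  \<open>lam\<close>, the first because \<open>\<rho> > \<mu> + \<sigma>\<close>. Strict convexity
  of the power branches rests on this bound.\<close>

lemma Om_m_gt_1: "1 < Om_m"
proof (rule ccontr)
  assume "\<not> ?thesis"
  then have le: "Om_m \<le> 1" by simp
  have "(\<mu> + \<sigma>) * Om_m \<le> (\<mu> + \<sigma>) * 1" using le mu_pos sigma_pos by (intro mult_left_mono) auto
  then have 1: "lam < \<rho> + lam - (\<mu> + \<sigma>) * Om_m" using rho_gt by simp
  have 2: "lam < \<rho> + lam - (\<mu> - \<sigma>) * Om_m"
    using mult_neg_pos[of "\<mu> - \<sigma>" Om_m] mu_less Om_m_pos rho_pos by simp
  have "lam * lam < (\<rho> + lam - (\<mu> + \<sigma>) * Om_m) * (\<rho> + lam - (\<mu> - \<sigma>) * Om_m)"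
    using 1 2 lambda_pos by (intro mult_strict_mono) auto
  then show False using Om_m_root by (simp add: power2_eq_square)
qed

text \<open>\<open>om_m\<close> is the ratio of the state -1 component to the state 1 component of
  the power solution; this is its equation in state 1, and \<open>om_m_eq\<close> the one in state
  -1.\<close>

lemma lam_om_m: "lam * om_m = lam + \<rho> - (\<mu> + \<sigma>) * Om_m"
  using lambda_pos by (simp add: omega_minus_def field_simps)

lemma om_m_pos: "0 < om_m"
  using lam_om_m Om_m_less_Om lambda_pos by (metis diff_gt_0_iff_gt zero_less_mult_pos)

lemma om_m_eq: "om_m * (\<rho> + lam - (\<mu> - \<sigma>) * Om_m) = lam"
proof -
  have "lam * (om_m * (\<rho> + lam - (\<mu> - \<sigma>) * Om_m)) = lam * lam"
    using Om_m_root lam_om_m by (metis (no_types, opaque_lifting) add.commute mult.assoc power2_eq_square)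
  then show ?thesis using lambda_pos by simp
qed

lemma om_m_less_1: "om_m < 1"
proof (rule ccontr)
  assume "\<not> ?thesis"
  moreover have "lam < \<rho> + lam - (\<mu> - \<sigma>) * Om_m"
    using mult_neg_pos[of "\<mu> - \<sigma>" Om_m] mu_less Om_m_pos rho_pos by simp
  ultimately have "1 * lam < om_m * (\<rho> + lam - (\<mu> - \<sigma>) * Om_m)"
    using lambda_pos by (intro mult_le_less_imp_less) auto
  then show False using om_m_eq by simp
qed

lemma b_eq: "b * (lam + \<rho> - (\<mu> + \<sigma>)) = lam"
  using rho_gt lambda_pos by (simp add: b_const_def diff_diff_eq[symmetric])

lemma b_pos: "0 < b" and b_less_1: "b < 1"
  using rho_gt lambda_pos by (auto simp: b_const_def)

lemma Om_gt_1: "1 < Om"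
  using rho_gt lambda_pos mu_pos sigma_pos by (simp add: Omega_def)

lemma Om_eq: "(\<mu> + \<sigma>) * Om = lam + \<rho>"
  using mu_pos sigma_pos by (simp add: Omega_def)

lemma up_eq: "(\<rho> - (\<mu> + \<sigma>)) * up = a * \<rho>"
  using rho_gt by (simp add: up_def diff_diff_eq[symmetric])

lemma a_less_up: "a < up"
proof -
  have "(\<rho> - (\<mu> + \<sigma>)) * a < (\<rho> - (\<mu> + \<sigma>)) * up"
    unfolding up_eq using mult_pos_pos[OF add_pos_pos[OF mu_pos sigma_pos] a_pos] by (simp add: algebra_simps)
  then show ?thesis using rho_gt by (simp add: mult_less_cancel_left_pos)
qed

lemma up_pos: "0 < up" using a_less_up a_pos by simp

lemma C_pos: "0 < C"
  using b_less_1 Om_gt_1 up_pos by (simp add: C_def)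

lemma DERIV_mid: "0 < y \<Longrightarrow> (mid has_real_derivative mid' y) (at y)"
  unfolding mid_def[abs_def] mid'_def by (auto intro!: derivative_eq_intros)

lemma mid'_up: "mid' up = 1"
  using Om_gt_1 up_pos by (simp add: mid'_def C_def)

lemma mid'_pos: "0 < y \<Longrightarrow> 0 < mid' y"
  unfolding mid'_def using b_pos C_pos Om_gt_1 by (intro add_pos_pos mult_pos_pos) auto

lemma mid'_less:
  assumes "0 < y" "y < up"
  shows "mid' y < 1"
proof -
  have "mid' y < mid' up"
    unfolding mid'_def using C_pos Om_gt_1 assms
    by (intro add_strict_left_mono mult_strict_left_mono powr_less_mono2) auto
  then show ?thesis by (simp add: mid'_up)
qed

lemma mid'_le: "0 < y \<Longrightarrow> y \<le> up \<Longrightarrow> mid' y \<le> 1"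
  using mid'_less[of y] mid'_up by (cases "y = up") auto

lemma mid_ode:
  assumes "0 < y"
  shows "(\<mu> + \<sigma>) * y * mid' y = (\<rho> + lam) * mid y - lam * (y - a)"
proof -
  have p: "y * y powr (Om - 1) = y powr Om"
    using assms by (simp add: powr_diff)
  define l where "l = lam / (lam + \<rho>)"
  have l: "(lam + \<rho>) * l = lam" using lambda_pos rho_pos by (simp add: l_def)
  have "(\<mu> + \<sigma>) * y * mid' y = (\<mu> + \<sigma>) * b * y + C * ((\<mu> + \<sigma>) * Om) * (y * y powr (Om - 1))"
    by (simp add: mid'_def algebra_simps)
  also have "\<dots> = (\<mu> + \<sigma>) * b * y + C * (lam + \<rho>) * y powr Om"
    by (simp only: p Om_eq)
  also have "(\<mu> + \<sigma>) * b * y = (lam + \<rho>) * b * y - lam * y"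
  proof -
    have "(\<mu> + \<sigma>) * b = (lam + \<rho>) * b - lam"
      using b_eq by (simp add: algebra_simps)
    then show ?thesis by (simp only: left_diff_distrib)
  qed
  finally have "(\<mu> + \<sigma>) * y * mid' y = (lam + \<rho>) * b * y - lam * y + C * (lam + \<rho>) * y powr Om" .
  moreover have "(\<rho> + lam) * mid y = (lam + \<rho>) * b * y - a * ((lam + \<rho>) * l) + C * (lam + \<rho>) * y powr Om"
    unfolding mid_def l_def[symmetric] by (simp add: algebra_simps)
  ultimately show ?thesis unfolding l by (simp add: algebra_simps)
qed

text \<open>The value at \<open>up\<close> is not imposed: slope 1 inserted into
  \<open>mid_ode\<close> forces it, because \<open>up\<close> is where the payoff itself satisfies
  \<open>(\<mu> + \<sigma>) * y = \<rho> * (y - a)\<close>.\<close>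

lemma mid_up: "mid up = up - a"
proof -
  have "(\<rho> + lam) * mid up = (\<mu> + \<sigma>) * up + lam * (up - a)"
    using mid_ode[OF up_pos] by (simp add: mid'_up)
  also have "\<dots> = (\<rho> + lam) * (up - a)"
    using up_eq by (simp add: algebra_simps)
  finally show ?thesis using rho_pos lambda_pos by simp
qed

lemma continuous_mid: "continuous_on {0..} mid"
  unfolding mid_def[abs_def] using Om_gt_1 by (intro continuous_intros continuous_on_powr') auto

text \<open>\<open>mid y - y\<close> strictly decreases to its value \<open>- a\<close> at
  \<open>up\<close>, because the slope of \<open>mid\<close> stays below 1 until then.\<close>

lemma mid_gt:
  assumes "0 < y" "y < up"
  shows "y - a < mid y"
proof -
  have "mid up - up < mid y - y"
  proof (rule DERIV_neg_imp_decreasing_open[OF assms(2)])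
    show "\<exists>z. ((\<lambda>y. mid y - y) has_real_derivative z) (at x) \<and> z < 0" if "y < x" "x < up" for x
      using that assms mid'_less[of x] by (intro exI[of _ "mid' x - 1"]) (auto intro!: derivative_eq_intros DERIV_mid)
    show "continuous_on {y..up} (\<lambda>y. mid y - y)"
      using assms by (intro continuous_intros continuous_on_subset[OF continuous_mid]) auto
  qed
  then show ?thesis by (simp add: mid_up)
qed

section \<open>The lower threshold\<close>

text \<open>Continuity at the lower threshold requires
  \<open>Cm * om_m * y powr Om_m = y - a\<close> and \<open>Cm * y powr Om_m = mid y\<close>;
  eliminating \<open>Cm\<close> gives \<open>H y = 0\<close>.\<close>

definition H :: "real \<Rightarrow> real" where "H y = y - a - om_m * mid y"

lemma H_iff:
  "H y = 0 \<longleftrightarrow> y - C * om_m / (1 - b * om_m) * y powr Om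
     = a * ((1 - lam / (lam + \<rho>) * om_m) / (1 - b * om_m))"
proof -
  have "b * om_m < 1 * 1" using b_pos b_less_1 om_m_pos om_m_less_1 by (intro mult_strict_mono) auto
  then have ne: "1 - b * om_m \<noteq> 0" by simp
  have aux: "(x - c / e * p = k * (r / e)) \<longleftrightarrow> e * x - c * p = k * r" if "e \<noteq> 0" for c e k p r x :: real
    using that by (auto simp: field_simps)
  define l where "l = lam / (lam + \<rho>)"
  show ?thesis
    unfolding aux[OF ne] H_def mid_def l_def[symmetric] by (auto simp: algebra_simps)
qed

text \<open>\<open>mid y\<close> exceeds the payoff, which is nonpositive here, and
  \<open>om_m < 1\<close>. The point 0 is separate because \<open>mid_gt\<close> needs a positive
  argument.\<close>

lemma H_neg: "0 \<le> y \<Longrightarrow> y \<le> a \<Longrightarrow> H y < 0"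
proof (cases "y = 0")
  case True
  have "om_m * (lam / (lam + \<rho>)) < 1 * 1"
    using om_m_pos om_m_less_1 lambda_pos rho_pos by (intro mult_strict_mono) auto
  then have "a * (om_m * (lam / (lam + \<rho>))) < a * 1" using a_pos by (intro mult_strict_left_mono) auto
  then show ?thesis using True Om_gt_1 by (simp add: H_def mid_def mult_ac)
next
  case False
  assume y: "0 \<le> y" "y \<le> a"
  have "om_m * (y - a) < om_m * mid y"
    using mid_gt[of y] False y a_less_up om_m_pos by (intro mult_strict_left_mono) auto
  moreover have "(1 - om_m) * (y - a) \<le> 0" using om_m_less_1 y by (intro mult_nonneg_nonpos) auto
  ultimately show ?thesis by (simp add: H_def algebra_simps)
qed

lemma H_up: "0 < H up"
proof -
  have "0 < (1 - om_m) * (up - a)" using om_m_less_1 a_less_up by simp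
  then show ?thesis by (simp add: H_def mid_up algebra_simps)
qed

text \<open>\<open>H\<close> is negative at 0 and positive at \<open>up\<close>, so the roots in
  \<open>[0, up]\<close> form a nonempty compact set, whose minimum is also the smallest root
  overall. A negative derivative there would make \<open>H\<close> positive slightly to the left and
  produce a smaller root. The last conclusion is this sign condition rewritten by means of
  \<open>mid_ode\<close>.\<close>

lemma smallest_root:
  obtains um where "a < um" "um < up" "H um = 0" "\<And>y. 0 \<le> y \<Longrightarrow> H y = 0 \<Longrightarrow> um \<le> y" "Om_m * (um - a) \<le> um"
proof -
  have contH: "continuous_on {0..} H"
    unfolding H_def[abs_def] by (intro continuous_intros continuous_mid)
  define U where "U = {y \<in> {0..up}. H y = 0}"
  have cl: "compact U"
  proof -
    have "closed U" unfolding U_def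
      by (rule continuous_closed_preimage_constant[OF continuous_on_subset[OF contH]]) auto
    moreover have "bounded U" by (rule bounded_subset[of "{0..up}"]) (auto simp: U_def)
    ultimately show ?thesis by (simp add: compact_eq_bounded_closed)
  qed
  have ex: "\<exists>x\<ge>0. x \<le> y \<and> H x = 0" if "0 \<le> y" "0 \<le> H y" for y
    using IVT'[of H 0 0 y] H_neg[of 0] a_pos that continuous_on_subset[OF contH, of "{0..y}"] by auto
  have "U \<noteq> {}" using ex[of up] up_pos H_up by (auto simp: U_def)
  then obtain um where um: "um \<in> U" "\<And>y. y \<in> U \<Longrightarrow> um \<le> y"
    using compact_attains_inf[OF cl] by auto
  have min: "um \<le> y" if "0 \<le> y" "H y = 0" for y
    using um that by (cases "y \<le> up") (auto simp: U_def)
  have um0: "0 \<le> um" "um \<le> up" "H um = 0" using um(1) by (auto simp: U_def)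
  have gt: "a < um" using H_neg[of um] um0 by (cases "um \<le> a") auto
  have lt: "um < up" using um0 H_up by (cases "um = up") auto
  have um_pos: "0 < um" using gt a_pos by simp
  have "om_m * mid' um \<le> 1"
  proof (rule ccontr)
    assume "\<not> ?thesis"
    then have neg: "1 - om_m * mid' um < 0" by simp
    have "(H has_real_derivative 1 - om_m * mid' um) (at um)"
      unfolding H_def[abs_def] using DERIV_mid[OF um_pos] by (auto intro!: derivative_eq_intros)
    from DERIV_neg_dec_left[OF this neg] obtain e where e: "0 < e" "\<And>h. 0 < h \<Longrightarrow> h < e \<Longrightarrow> H um < H (um - h)"
      by auto
    define h where "h = min (e / 2) (um / 2)"
    have h: "0 < h" "h < e" "0 \<le> um - h" using e(1) um_pos by (auto simp: h_def min_def)
    obtain x where "0 \<le> x" "x \<le> um - h" "H x = 0"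
      using ex[OF h(3)] e(2)[OF h(1,2)] um0 by auto
    then show False using min[of x] h by simp
  qed
  \<comment> \<open>At a root of \<open>H\<close> the slope of \<open>om_m * mid\<close> equals
    \<open>Om_m * (um - a) / um\<close>, which is also the left slope at \<open>um\<close> of the
    power branch in state -1.\<close>
  moreover have "(\<mu> + \<sigma>) * (um * (om_m * mid' um)) = (\<mu> + \<sigma>) * (Om_m * (um - a))"
  proof -
    have r: "om_m * mid um = um - a" using um0(3) by (simp add: H_def)
    have "(\<mu> + \<sigma>) * (um * (om_m * mid' um)) = om_m * ((\<mu> + \<sigma>) * um * mid' um)" by (simp add: mult_ac)
    also have "\<dots> = (\<rho> + lam) * (om_m * mid um) - lam * om_m * (um - a)"
      unfolding mid_ode[OF um_pos] by (simp add: algebra_simps)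
    also have "\<dots> = (\<mu> + \<sigma>) * (Om_m * (um - a))"
      unfolding r lam_om_m by (simp add: algebra_simps)
    finally show ?thesis .
  qed
  moreover have "\<mu> + \<sigma> \<noteq> 0" using mu_pos sigma_pos by simp
  ultimately have "Om_m * (um - a) \<le> um"
    using mult_left_mono[of "om_m * mid' um" 1 um] um_pos by simp
  with gt lt um0 min that show thesis by blast
qed

end

section \<open>The glued candidate and its regularity\<close>

locale candidate = two_state +
  fixes um :: real
  assumes a_less_um: "a < um" and um_less_up: "um < up" and H_um: "H um = 0"
    and slope_um: "Om_m * (um - a) \<le> um"
begin

definition Cm :: real where "Cm = (um - a) / (om_m * um powr Om_m)"

definition vp :: "real \<Rightarrow> real" where
  "vp y = (if y \<le> um then Cm * y powr Om_m else if y \<le> up then mid y else y - a)"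

definition vm :: "real \<Rightarrow> real" where
  "vm y = (if y \<le> um then Cm * om_m * y powr Om_m else y - a)"

definition v :: "real \<Rightarrow> real \<Rightarrow> real" where
  "v y j = (if j = 1 then vp y else vm y)"

definition thr :: "real \<Rightarrow> real" where
  "thr j = (if j = 1 then up else um)"

definition vp' :: "real \<Rightarrow> real" where
  "vp' y = (if y < um then Cm * (Om_m * y powr (Om_m - 1)) else if y < up then mid' y else 1)"

definition vm' :: "real \<Rightarrow> real" where
  "vm' y = (if y < um then Cm * om_m * (Om_m * y powr (Om_m - 1)) else 1)"

lemma um_pos: "0 < um"
  using a_less_um a_pos by simp

lemma Cm_pos: "0 < Cm"
  using a_less_um um_pos om_m_pos by (simp add: Cm_def)

lemma Cm_um: "Cm * om_m * um powr Om_m = um - a"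
  using um_pos om_m_pos by (simp add: Cm_def)

lemma mid_um: "om_m * mid um = um - a"
  using H_um by (simp add: H_def)

text \<open>\<open>H um = 0\<close> is exactly what glues the power branch of state 1 to
  \<open>mid\<close>, once \<open>Cm\<close> is fixed by state -1.\<close>

lemma Cm_mid: "Cm * um powr Om_m = mid um"
proof -
  have "om_m * (Cm * um powr Om_m) = om_m * mid um"
    using Cm_um mid_um by (simp add: mult_ac)
  then show ?thesis using om_m_pos by simp
qed

lemma DERIV_power: "0 < y \<Longrightarrow> ((\<lambda>y. k * y powr Om_m) has_real_derivative k * (Om_m * y powr (Om_m - 1))) (at y)"
  by (auto intro!: derivative_eq_intros)

lemma DERIV_vp: "0 < y \<Longrightarrow> y \<notin> {um, up} \<Longrightarrow> (vp has_real_derivative vp' y) (at y)"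
proof -
  assume y: "0 < y" "y \<notin> {um, up}"
  consider "y < um" | "um < y" "y < up" | "up < y" using y um_less_up by force
  then show ?thesis
  proof cases
    case 1
    show ?thesis
      by (rule has_field_derivative_transform_within_open[where S = "{..<um}" and f = "\<lambda>y. Cm * y powr Om_m"])
         (use 1 DERIV_power[OF y(1)] in \<open>auto simp: vp_def vp'_def\<close>)
  next
    case 2
    show ?thesis
      by (rule has_field_derivative_transform_within_open[where S = "{um<..<up}" and f = mid])
         (use 2 DERIV_mid[OF y(1)] in \<open>auto simp: vp_def vp'_def\<close>)
  next
    case 3
    show ?thesis
      by (rule has_field_derivative_transform_within_open[where S = "{up<..}" and f = "\<lambda>y. y - a"])
         (use 3 um_less_up in \<open>auto simp: vp_def vp'_def intro!: derivative_eq_intros\<close>)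
  qed
qed

lemma DERIV_vm: "0 < y \<Longrightarrow> y \<notin> {um, up} \<Longrightarrow> (vm has_real_derivative vm' y) (at y)"
proof -
  assume y: "0 < y" "y \<notin> {um, up}"
  consider "y < um" | "um < y" using y by force
  then show ?thesis
  proof cases
    case 1
    show ?thesis
      by (rule has_field_derivative_transform_within_open[where S = "{..<um}" and f = "\<lambda>y. Cm * om_m * y powr Om_m"])
         (use 1 DERIV_power[OF y(1)] in \<open>auto simp: vm_def vm'_def\<close>)
  next
    case 2
    show ?thesis
      by (rule has_field_derivative_transform_within_open[where S = "{um<..}" and f = "\<lambda>y. y - a"])
         (use 2 in \<open>auto simp: vm_def vm'_def intro!: derivative_eq_intros\<close>)
  qed
qed

lemma continuous_power: "continuous_on {0..} (\<lambda>y. k * y powr Om_m)"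
  using Om_m_pos by (intro continuous_intros continuous_on_powr') auto

lemma continuous_vp: "continuous_on {0..} vp"
proof -
  have 1: "continuous_on ({um..up} \<union> {up..}) (\<lambda>y. if y \<le> up then mid y else y - a)"
    using um_pos mid_up
    by (intro continuous_on_If continuous_intros continuous_on_subset[OF continuous_mid]) auto
  have "continuous_on ({0..um} \<union> ({um..up} \<union> {up..})) (\<lambda>y. if y \<le> um then Cm * y powr Om_m else if y \<le> up then mid y else y - a)"
    using um_less_up Cm_mid
    by (intro continuous_on_If 1 continuous_on_subset[OF continuous_power]) auto
  moreover have "{0..um} \<union> ({um..up} \<union> {up..}) = {0..}" using um_pos um_less_up by auto
  ultimately show ?thesis by (simp add: vp_def[abs_def])
qed

lemma continuous_vm: "continuous_on {0..} vm"
proof -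
  have "continuous_on ({0..um} \<union> {um..}) (\<lambda>y. if y \<le> um then Cm * om_m * y powr Om_m else y - a)"
    using Cm_um by (intro continuous_on_If continuous_intros continuous_on_subset[OF continuous_power]) auto
  moreover have "{0..um} \<union> {um..} = {0..}" using um_pos by auto
  ultimately show ?thesis by (simp add: vm_def[abs_def])
qed

text \<open>The exponent exceeds 1, so the slope increases towards \<open>um\<close>, where it is
  \<open>Om_m * (um - a) / um\<close>; \<open>slope_um\<close> bounds that by 1.\<close>

lemma slope_vm:
  assumes "0 < y" "y < um"
  shows "Cm * om_m * (Om_m * y powr (Om_m - 1)) < 1"
proof -
  have "Cm * om_m * (Om_m * y powr (Om_m - 1)) < Cm * om_m * (Om_m * um powr (Om_m - 1))"
    using Cm_pos om_m_pos Om_m_gt_1 assms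
    by (intro mult_strict_left_mono powr_less_mono2 mult_pos_pos) auto
  also have "\<dots> = Om_m * (Cm * om_m * um powr Om_m) / um"
    using um_pos by (simp add: powr_diff)
  also have "\<dots> \<le> 1" unfolding Cm_um using slope_um um_pos by simp
  finally show ?thesis .
qed

lemma vm_gt:
  assumes "0 \<le> y" "y < um"
  shows "y - a < vm y"
proof -
  have "vm um - um < vm y - y"
  proof (rule DERIV_neg_imp_decreasing_open[OF assms(2)])
    fix x assume x: "y < x" "x < um"
    then have "(vm has_real_derivative vm' x) (at x)" using assms um_less_up by (intro DERIV_vm) auto
    moreover have "vm' x < 1" using slope_vm[of x] x assms by (simp add: vm'_def)
    ultimately show "\<exists>z. ((\<lambda>y. vm y - y) has_real_derivative z) (at x) \<and> z < 0"
      by (intro exI[of _ "vm' x - 1"]) (auto intro!: derivative_eq_intros)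
  next
    show "continuous_on {y..um} (\<lambda>y. vm y - y)"
      using assms by (intro continuous_intros continuous_on_subset[OF continuous_vm]) auto
  qed
  then show ?thesis using Cm_um by (simp add: vm_def)
qed

lemma vm_ge: "0 \<le> y \<Longrightarrow> y - a \<le> vm y"
  using vm_gt[of y] Cm_um by (cases "y < um") (auto simp: vm_def)

lemma vm_nonneg: "0 \<le> vm y"
  using Cm_pos om_m_pos a_less_um by (simp add: vm_def)

text \<open>State 1 is the more favourable one, by \<open>om_m < 1\<close> below \<open>um\<close>
  and by \<open>mid_gt\<close> between the thresholds. Lower bounds for \<open>vm\<close> thereby
  carry over to \<open>vp\<close>.\<close>

lemma vm_le_vp: "0 \<le> y \<Longrightarrow> vm y \<le> vp y"
proof -
  assume y: "0 \<le> y"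
  have "Cm * om_m * y powr Om_m \<le> Cm * y powr Om_m"
    using mult_right_mono[of om_m 1 "Cm * y powr Om_m"] om_m_less_1 Cm_pos by (simp add: mult_ac)
  then show ?thesis
    using mid_gt[of y] mid_up um_pos by (cases "y = up") (auto simp: vm_def vp_def)
qed

lemma vp_gt:
  assumes "0 \<le> y" "y < up"
  shows "y - a < vp y"
proof (cases "y \<le> um")
  case True
  show ?thesis
  proof (cases "y = um")
    case True
    then show ?thesis using mid_gt[of um] um_pos um_less_up Cm_mid by (simp add: vp_def)
  next
    case False
    then show ?thesis using vm_gt[of y] vm_le_vp[of y] assms True by simp
  qed
next
  case False
  then show ?thesis using mid_gt[of y] assms um_pos by (simp add: vp_def)
qed

lemma mid_mono: "0 < x \<Longrightarrow> x \<le> y \<Longrightarrow> mid x \<le> mid y"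
  unfolding mid_def using b_pos C_pos Om_gt_1 a_pos
  by (intro add_mono diff_mono mult_left_mono powr_mono2) auto

text \<open>Both curved branches increase and end at the value \<open>up - a\<close> at
  \<open>up\<close>; this crude bound supplies \<open>B0 = up\<close>.\<close>

lemma vp_le: "0 \<le> y \<Longrightarrow> vp y \<le> y + up"
proof -
  assume y: "0 \<le> y"
  have "Cm * y powr Om_m \<le> up" if "y \<le> um"
  proof -
    have "Cm * y powr Om_m \<le> Cm * um powr Om_m"
      using that y Cm_pos Om_m_pos by (intro mult_left_mono powr_mono2) auto
    also have "\<dots> = mid um" by (rule Cm_mid)
    also have "\<dots> \<le> mid up" using um_pos um_less_up by (intro mid_mono) auto
    finally show ?thesis using mid_up a_pos by simp
  qed
  moreover have "mid y \<le> up" if "um < y" "y \<le> up"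
    using mid_mono[of y up] that um_pos mid_up a_pos by simp
  ultimately show ?thesis using y a_pos up_pos by (auto simp: vp_def intro: order_trans)
qed

lemma abs_vp'_le: "0 < y \<Longrightarrow> \<bar>vp' y\<bar> \<le> Cm * (Om_m * um powr (Om_m - 1)) + 1"
proof -
  assume y: "0 < y"
  have 0: "0 \<le> Cm * (Om_m * z powr (Om_m - 1))" for z using Cm_pos Om_m_pos by simp
  have 1: "Cm * (Om_m * y powr (Om_m - 1)) \<le> Cm * (Om_m * um powr (Om_m - 1))" if "y < um"
    using that y Cm_pos Om_m_gt_1 by (intro mult_left_mono powr_mono2) auto
  show ?thesis
    using 0[of y] 0[of um] 1 mid'_pos[OF y] mid'_le[OF y] by (auto simp: vp'_def)
qed

lemma abs_vm'_le: "0 < y \<Longrightarrow> \<bar>vm' y\<bar> \<le> 1"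
proof -
  assume y: "0 < y"
  have "0 \<le> Cm * om_m * (Om_m * y powr (Om_m - 1))" using Cm_pos om_m_pos Om_m_pos by simp
  then show ?thesis using slope_vm[OF y] by (auto simp: vm'_def)
qed

lemma vp_lipschitz: "0 \<le> x \<Longrightarrow> 0 \<le> x' \<Longrightarrow> \<bar>vp x - vp x'\<bar> \<le> (Cm * (Om_m * um powr (Om_m - 1)) + 1) * \<bar>x - x'\<bar>"
  by (rule lipschitz_finite[where S = "{um, up}", OF _ continuous_vp DERIV_vp]) (auto intro: abs_vp'_le)

lemma vm_lipschitz: "0 \<le> x \<Longrightarrow> 0 \<le> x' \<Longrightarrow> \<bar>vm x - vm x'\<bar> \<le> 1 * \<bar>x - x'\<bar>"
  by (rule lipschitz_finite[where S = "{um, up}", OF _ continuous_vm DERIV_vm]) (auto intro: abs_vm'_le)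

section \<open>Generator equations and inequalities\<close>

lemma mult_powr_pred: "0 < y \<Longrightarrow> y * y powr (Om_m - 1) = y powr Om_m"
  by (simp add: powr_diff)

text \<open>Below \<open>um\<close> this is the state 1 equation of the power solution,
  \<open>lam_om_m\<close>; between the thresholds it is \<open>mid_ode\<close>, where state -1
  contributes the payoff.\<close>

lemma vp_ode:
  assumes y: "0 < y" "y < up" "y \<noteq> um"
  shows "(\<mu> + \<sigma>) * y * vp' y = (\<rho> + lam) * vp y - lam * vm y"
proof (cases "y < um")
  case True
  have "(\<mu> + \<sigma>) * y * vp' y = (\<mu> + \<sigma>) * Om_m * Cm * (y * y powr (Om_m - 1))"
    using True by (simp add: vp'_def)
  also have "\<dots> = (lam + \<rho> - lam * om_m) * Cm * y powr Om_m"
    unfolding mult_powr_pred[OF y(1)] lam_om_m by simp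
  finally show ?thesis using True by (simp add: vp_def vm_def algebra_simps)
next
  case False
  then show ?thesis using mid_ode[OF y(1)] y by (simp add: vp'_def vp_def vm_def)
qed

text \<open>Beyond \<open>up\<close> both components are the payoff and the inequality reads
  \<open>(\<rho> - (\<mu> + \<sigma>)) * y \<ge> a * \<rho>\<close>, with equality at
  \<open>up\<close>.\<close>

lemma vp_supersolution:
  assumes y: "0 < y" "y \<notin> {um, up}"
  shows "(\<mu> + \<sigma>) * y * vp' y \<le> (\<rho> + lam) * vp y - lam * vm y"
proof (cases "y < up")
  case True
  then show ?thesis using vp_ode[of y] y by simp
next
  case False
  then have "up < y" using y by simp
  then have "(\<rho> - (\<mu> + \<sigma>)) * up \<le> (\<rho> - (\<mu> + \<sigma>)) * y" using rho_gt by (intro mult_left_mono) auto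
  then show ?thesis using \<open>up < y\<close> um_less_up unfolding up_eq by (simp add: vp'_def vp_def vm_def algebra_simps)
qed

lemma vm_ode:
  assumes y: "0 < y" "y < um"
  shows "(\<mu> - \<sigma>) * y * vm' y = (\<rho> + lam) * vm y - lam * vp y"
proof -
  have "(\<mu> - \<sigma>) * y * vm' y = ((\<mu> - \<sigma>) * Om_m * om_m) * Cm * (y * y powr (Om_m - 1))"
    using y by (simp add: vm'_def)
  also have "(\<mu> - \<sigma>) * Om_m * om_m = (\<rho> + lam) * om_m - lam"
    using om_m_eq by (simp add: algebra_simps)
  finally show ?thesis
    using y unfolding mult_powr_pred[OF y(1)] by (simp add: vm_def vp_def algebra_simps)
qed

text \<open>The generator inequality at \<open>um\<close> in state \<open>-1\<close> amounts to the left slope of \<open>vm\<close> being at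
  most 1; it propagates to the right because \<open>mid' \<le> 1\<close> makes the defect decreasing.\<close>

lemma vm_supersolution:
  assumes y: "0 < y" "y \<notin> {um, up}"
  shows "(\<mu> - \<sigma>) * y * vm' y \<le> (\<rho> + lam) * vm y - lam * vp y"
proof -
  consider "y < um" | "um < y" "y < up" | "up < y" using y by force
  then show ?thesis
  proof cases
    case 1
    then show ?thesis using vm_ode[OF y(1)] by simp
  next
    case 2
    define R where "R x = (\<mu> - \<sigma>) * x - (\<rho> + lam) * (x - a) + lam * mid x" for x
    have "R y \<le> R um"
    proof (rule DERIV_nonpos_imp_nonincreasing[of um y R])
      fix x assume x: "um \<le> x" "x \<le> y"
      have "(R has_real_derivative (\<mu> - \<sigma>) - (\<rho> + lam) + lam * mid' x) (at x)"
        unfolding R_def using x um_pos by (auto intro!: derivative_eq_intros DERIV_mid)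
      moreover have "lam * mid' x \<le> lam * 1"
        using x 2 um_pos lambda_pos by (intro mult_left_mono mid'_le) auto
      ultimately show "\<exists>z. (R has_real_derivative z) (at x) \<and> z \<le> 0"
        using mu_less rho_pos by (intro exI[of _ "(\<mu> - \<sigma>) - (\<rho> + lam) + lam * mid' x"]) auto
    qed (use 2 in auto)
    also have "R um \<le> 0"
    proof -
      \<comment> \<open>\<open>om_m_eq\<close> expresses \<open>lam\<close> through the exponent, so
        the defect at \<open>um\<close> becomes the negative factor \<open>\<mu> - \<sigma>\<close>
        times the nonnegative gap in \<open>slope_um\<close>.\<close>
      have "lam * mid um = (\<rho> + lam - (\<mu> - \<sigma>) * Om_m) * (om_m * mid um)"
        using om_m_eq by (metis mult.assoc mult.commute)
      then have "R um = (\<mu> - \<sigma>) * (um - Om_m * (um - a))"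
        unfolding mid_um by (simp add: R_def algebra_simps)
      also have "\<dots> \<le> 0" using mu_less slope_um by (intro mult_nonpos_nonneg) auto
      finally show ?thesis .
    qed
    finally show ?thesis using 2 by (simp add: R_def vm'_def vm_def vp_def algebra_simps)
  next
    case 3
    have "(\<rho> - (\<mu> + \<sigma>)) * up \<le> (\<rho> - (\<mu> + \<sigma>)) * y" using rho_gt 3 by (intro mult_left_mono) auto
    moreover have "0 \<le> \<sigma> * y" using sigma_pos y by simp
    ultimately show ?thesis using 3 um_less_up unfolding up_eq by (simp add: vm'_def vp_def vm_def algebra_simps)
  qed
qed

section \<open>Expansion of the candidate along the flow\<close>

lemma flow_at_0: "vp 0 = 0" "vm 0 = 0"
  using um_pos by (auto simp: vp_def vm_def)

definition Lv :: real where "Lv = Cm * (Om_m * um powr (Om_m - 1)) + 1"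

lemma Lv_ge_1: "1 \<le> Lv"
  using Cm_pos Om_m_pos by (simp add: Lv_def)

lemma generator_lipschitz:
  assumes "0 \<le> x" "0 \<le> x'"
  shows "\<bar>((\<rho> + lam) * vp x - lam * vm x) - ((\<rho> + lam) * vp x' - lam * vm x')\<bar> \<le> (\<rho> + 2 * lam) * Lv * \<bar>x - x'\<bar>"
    and "\<bar>((\<rho> + lam) * vm x - lam * vp x) - ((\<rho> + lam) * vm x' - lam * vp x')\<bar> \<le> (\<rho> + 2 * lam) * Lv * \<bar>x - x'\<bar>"
proof -
  have p: "\<bar>vp x - vp x'\<bar> \<le> Lv * \<bar>x - x'\<bar>" using vp_lipschitz[OF assms] by (simp add: Lv_def)
  have m: "\<bar>vm x - vm x'\<bar> \<le> Lv * \<bar>x - x'\<bar>"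
    using vm_lipschitz[OF assms] mult_right_mono[OF Lv_ge_1, of "\<bar>x - x'\<bar>"] by simp
  have *: "\<bar>(\<rho> + lam) * s - lam * t\<bar> \<le> (\<rho> + 2 * lam) * K" if "\<bar>s\<bar> \<le> K" "\<bar>t\<bar> \<le> K" for s t K
  proof -
    have "\<bar>(\<rho> + lam) * s - lam * t\<bar> \<le> \<bar>(\<rho> + lam) * s\<bar> + \<bar>lam * t\<bar>" by (rule abs_triangle_ineq4)
    also have "\<dots> = (\<rho> + lam) * \<bar>s\<bar> + lam * \<bar>t\<bar>" using rho_pos lambda_pos by (simp add: abs_mult)
    also have "\<dots> \<le> (\<rho> + lam) * K + lam * K" using that rho_pos lambda_pos by (intro add_mono mult_left_mono) auto
    finally show ?thesis by (simp add: algebra_simps)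
  qed
  show "\<bar>((\<rho> + lam) * vp x - lam * vm x) - ((\<rho> + lam) * vp x' - lam * vm x')\<bar> \<le> (\<rho> + 2 * lam) * Lv * \<bar>x - x'\<bar>"
    using *[OF p m] by (simp add: algebra_simps)
  show "\<bar>((\<rho> + lam) * vm x - lam * vp x) - ((\<rho> + lam) * vm x' - lam * vp x')\<bar> \<le> (\<rho> + 2 * lam) * Lv * \<bar>x - x'\<bar>"
    using *[OF m p] by (simp add: algebra_simps)
qed

lemma generator_Lv_nonneg: "0 \<le> (\<rho> + 2 * lam) * Lv"
  using rho_pos lambda_pos Lv_ge_1 by simp

lemma flow_upper:
  "\<exists>K. \<forall>j\<in>states. \<forall>x\<in>{0..B}. \<forall>h\<in>{0..1}.
     v (x * exp ((\<mu> + \<sigma> * j) * h)) j \<le> v x j + h * ((\<rho> + lam) * v x j - lam * v x (- j)) + K * h\<^sup>2"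
proof -
  \<comment> \<open>The leading 0 is the slack \<open>E\<close> of \<open>flow_step\<close>: the
    generator inequalities hold without defect away from the kinks.\<close>
  define k where "k c = 0 + (\<rho> + 2 * lam) * Lv * (B * exp \<bar>c\<bar> * \<bar>c\<bar>)" for c
  define K where "K = \<bar>k (\<mu> + \<sigma>)\<bar> + \<bar>k (\<mu> - \<sigma>)\<bar>"
  have K: "k (\<mu> + \<sigma>) * h\<^sup>2 \<le> K * h\<^sup>2" "k (\<mu> - \<sigma>) * h\<^sup>2 \<le> K * h\<^sup>2" for h
    by (auto simp: K_def intro!: mult_right_mono)
  have K0: "0 \<le> K * h\<^sup>2" for h by (simp add: K_def)
  have "v (x * exp ((\<mu> + \<sigma> * j) * h)) j \<le> v x j + h * ((\<rho> + lam) * v x j - lam * v x (- j)) + K * h\<^sup>2"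
    if j: "j \<in> states" and x: "x \<in> {0..B}" and h: "h \<in> {0..1}" for j x h
  proof (cases "x = 0")
    \<comment> \<open>The origin is fixed under the flow and both components vanish there;
      \<open>flow_step\<close> needs a positive start.\<close>
    case True
    then show ?thesis using K0[of h] by (simp add: v_def flow_at_0)
  next
    case False
    have p: "vp (x * exp ((\<mu> + \<sigma>) * h)) \<le> vp x + h * ((\<rho> + lam) * vp x - lam * vm x) + k (\<mu> + \<sigma>) * h\<^sup>2"
      unfolding k_def
      by (rule flow_step[where S = "{um, up}", OF _ _ continuous_vp DERIV_vp generator_lipschitz(1) generator_Lv_nonneg])
         (use False x h mu_pos sigma_pos vp_supersolution in auto)
    have m: "vm (x * exp ((\<mu> - \<sigma>) * h)) \<le> vm x + h * ((\<rho> + lam) * vm x - lam * vp x) + k (\<mu> - \<sigma>) * h\<^sup>2"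
      unfolding k_def
      by (rule flow_step[where S = "{um, up}", OF _ _ continuous_vm DERIV_vm generator_lipschitz(2) generator_Lv_nonneg])
         (use False x h mu_less vm_supersolution in auto)
    show ?thesis
      using j p m K[of h] by (auto simp: mem_states_iff v_def)
  qed
  then show ?thesis by blast
qed


text \<open>\<open>flow_step\<close> is applied to the negated components. In state -1 the price
  falls and stays below \<open>um\<close>, where the equation is exact. In state 1 the flow may pass
  \<open>up\<close> within the step; the equation then fails by
  \<open>(\<rho> - (\<mu> + \<sigma>)) * (X - up)\<close>, and the overshoot is of order
  \<open>h\<close>.\<close>

lemma flow_lower:
  "\<exists>K. \<forall>j\<in>states. \<forall>x\<in>{0..B}. \<forall>h\<in>{0..1}. x < thr j \<longrightarrow>
     v (x * exp ((\<mu> + \<sigma> * j) * h)) j \<ge> v x j + h * ((\<rho> + lam) * v x j - lam * v x (- j)) - K * h\<^sup>2"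
proof -
  \<comment> \<open>The overshoot beyond \<open>up\<close> is at most
    \<open>up * (exp (\<mu> + \<sigma>) * (\<mu> + \<sigma>)) * h\<close>; the first factor of
    \<open>E\<close> turns it into the defect of the equation.\<close>
  define E where "E = (\<rho> - (\<mu> + \<sigma>)) * (up * (exp (\<mu> + \<sigma>) * (\<mu> + \<sigma>)))"
  have E: "0 \<le> E" using rho_gt up_pos mu_pos sigma_pos by (simp add: E_def)
  define k where "k c = E + (\<rho> + 2 * lam) * Lv * (B * exp \<bar>c\<bar> * \<bar>c\<bar>)" for c
  define K where "K = \<bar>k (\<mu> + \<sigma>)\<bar> + \<bar>k (\<mu> - \<sigma>)\<bar>"
  have K: "k (\<mu> + \<sigma>) * h\<^sup>2 \<le> K * h\<^sup>2" "k (\<mu> - \<sigma>) * h\<^sup>2 \<le> K * h\<^sup>2" for h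
    by (auto simp: K_def intro!: mult_right_mono)
  have K0: "0 \<le> K * h\<^sup>2" for h by (simp add: K_def)
  have "v (x * exp ((\<mu> + \<sigma> * j) * h)) j \<ge> v x j + h * ((\<rho> + lam) * v x j - lam * v x (- j)) - K * h\<^sup>2"
    if j: "j \<in> states" and x: "x \<in> {0..B}" and h: "h \<in> {0..1}" and xu: "x < thr j" for j x h
  proof (cases "x = 0")
    case True
    then show ?thesis using K0[of h] by (simp add: v_def flow_at_0)
  next
    case False
    then have x0: "0 < x" using x by simp
    have p: "- vp (x * exp ((\<mu> + \<sigma>) * h)) \<le> - vp x + h * (- ((\<rho> + lam) * vp x - lam * vm x)) + k (\<mu> + \<sigma>) * h\<^sup>2"
      if xu: "x < up"
      unfolding k_def
    proof (rule flow_step[where S = "{um, up}" and R = "\<lambda>x. - ((\<rho> + lam) * vp x - lam * vm x)" and \<phi> = "\<lambda>x. - vp x" and \<phi>' = "\<lambda>x. - vp' x",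
            OF _ _ continuous_on_minus[OF continuous_vp] DERIV_minus[OF DERIV_vp] _ generator_Lv_nonneg])
      show "\<bar>- ((\<rho> + lam) * vp X - lam * vm X) - - ((\<rho> + lam) * vp x - lam * vm x)\<bar> \<le> (\<rho> + 2 * lam) * Lv * \<bar>X - x\<bar>" if "0 \<le> X" for X
        using generator_lipschitz(1)[OF that, of x] x by (simp add: abs_le_iff)
    next
      fix t assume t: "0 < t" "t < h" "x * exp ((\<mu> + \<sigma>) * t) \<notin> {um, up}"
      define X where "X = x * exp ((\<mu> + \<sigma>) * t)"
      have X: "0 < X" "X \<noteq> um" "X \<noteq> up" using x0 t by (auto simp: X_def)
      have Eh: "0 \<le> E * h" using E h by simp
      have "(\<rho> + lam) * vp X - lam * vm X \<le> (\<mu> + \<sigma>) * X * vp' X + E * h"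
      proof (cases "X < up")
        case True
        then show ?thesis using vp_ode[of X] X Eh by simp
      next
        case False
        define c where "c = \<mu> + \<sigma>"
        have c: "0 < c" using mu_pos sigma_pos by (simp add: c_def)
        have "exp (c * t) - 1 \<le> exp (c * t) * (c * t)"
          using mult_left_mono[OF exp_ge_add_one_self[of "- (c * t)"], of "exp (c * t)"] by (simp add: exp_minus algebra_simps)
        also have "\<dots> \<le> exp c * (c * h)"
          using c t h by (intro mult_mono) (auto intro: mult_left_le)
        finally have e: "exp (c * t) - 1 \<le> exp c * (c * h)" .
        have "X \<le> up * exp (c * t)" using xu by (simp add: X_def c_def)
        then have "X - up \<le> up * (exp (c * t) - 1)" by (simp add: algebra_simps)
        also have "\<dots> \<le> up * (exp c * (c * h))" using e up_pos by (intro mult_left_mono) auto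
        finally have "(\<rho> - c) * (X - up) \<le> (\<rho> - c) * (up * (exp c * (c * h)))"
          using rho_gt by (intro mult_left_mono) (auto simp: c_def)
        then have "(\<rho> - c) * X - (\<rho> - c) * up \<le> E * h" by (simp add: E_def c_def[symmetric] algebra_simps)
        then have "\<rho> * (X - a) - c * X \<le> E * h"
          using up_eq by (simp add: c_def algebra_simps)
        then show ?thesis using False X um_less_up by (simp add: vp'_def vp_def vm_def c_def algebra_simps)
      qed
      then show "(\<mu> + \<sigma>) * (x * exp ((\<mu> + \<sigma>) * t)) * - vp' (x * exp ((\<mu> + \<sigma>) * t))
        \<le> - ((\<rho> + lam) * vp (x * exp ((\<mu> + \<sigma>) * t)) - lam * vm (x * exp ((\<mu> + \<sigma>) * t))) + E * h"
        unfolding X_def[symmetric] by simp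
    qed (use False x h mu_pos sigma_pos in auto)
    have m: "- vm (x * exp ((\<mu> - \<sigma>) * h)) \<le> - vm x + h * (- ((\<rho> + lam) * vm x - lam * vp x)) + k (\<mu> - \<sigma>) * h\<^sup>2"
      if xu: "x < um"
      unfolding k_def
    proof (rule flow_step[where S = "{um, up}" and R = "\<lambda>x. - ((\<rho> + lam) * vm x - lam * vp x)" and \<phi> = "\<lambda>x. - vm x" and \<phi>' = "\<lambda>x. - vm' x",
            OF _ _ continuous_on_minus[OF continuous_vm] DERIV_minus[OF DERIV_vm] _ generator_Lv_nonneg])
      show "\<bar>- ((\<rho> + lam) * vm X - lam * vp X) - - ((\<rho> + lam) * vm x - lam * vp x)\<bar> \<le> (\<rho> + 2 * lam) * Lv * \<bar>X - x\<bar>" if "0 \<le> X" for X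
        using generator_lipschitz(2)[OF that, of x] x by (simp add: abs_le_iff)
    next
      fix t assume t: "0 < t" "t < h" "x * exp ((\<mu> - \<sigma>) * t) \<notin> {um, up}"
      define X where "X = x * exp ((\<mu> - \<sigma>) * t)"
      have "exp ((\<mu> - \<sigma>) * t) \<le> 1" using mult_neg_pos[of "\<mu> - \<sigma>" t] mu_less t by simp
      then have "X \<le> x" using x0 by (simp add: X_def mult_left_le)
      then have X: "X < um" using xu by simp
      have X0: "0 < X" using x0 by (simp add: X_def)
      have "0 \<le> E * h" using E h by simp
      then show "(\<mu> - \<sigma>) * (x * exp ((\<mu> - \<sigma>) * t)) * - vm' (x * exp ((\<mu> - \<sigma>) * t))
        \<le> - ((\<rho> + lam) * vm (x * exp ((\<mu> - \<sigma>) * t)) - lam * vp (x * exp ((\<mu> - \<sigma>) * t))) + E * h"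
        unfolding X_def[symmetric] using vm_ode[OF X0 X] by simp
    qed (use False x h mu_less in auto)
    have p': "vp x + h * ((\<rho> + lam) * vp x - lam * vm x) - K * h\<^sup>2 \<le> vp (x * exp ((\<mu> + \<sigma>) * h))" if "x < up"
      using p[OF that] K(1)[of h] unfolding mult_minus_right by linarith
    have m': "vm x + h * ((\<rho> + lam) * vm x - lam * vp x) - K * h\<^sup>2 \<le> vm (x * exp ((\<mu> - \<sigma>) * h))" if "x < um"
      using m[OF that] K(2)[of h] unfolding mult_minus_right by linarith
    show ?thesis
      using j p' m' xu by (auto simp: mem_states_iff v_def thr_def)
  qed
  then show ?thesis by blast
qed

section \<open>From the candidate to the theorem\<close>

lemma verification: "verification lam \<mu> \<sigma> \<rho> a up v thr"
proof
  show "0 < lam" "0 < \<mu>" "0 < \<sigma>" "0 < a" "\<mu> + \<sigma> < \<rho>"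
    by (rule lambda_pos mu_pos sigma_pos a_pos rho_gt)+
  show "(\<lambda>x. v x j) \<in> borel_measurable borel" for j
    unfolding v_def vp_def vm_def mid_def by measurable
  show "x - a \<le> v x j" if "j \<in> states" "0 \<le> x" for x j
    using vm_ge[OF that(2)] vm_le_vp[OF that(2)] by (simp add: v_def)
  show "0 \<le> v x j" if "j \<in> states" "0 \<le> x" for x j
    using vm_nonneg[of x] vm_le_vp[OF that(2)] by (simp add: v_def)
  show "v x j \<le> x + up" if "j \<in> states" "0 \<le> x" for x j
    using vp_le[OF that(2)] vm_le_vp[OF that(2)] by (simp add: v_def)
  show "\<exists>L\<ge>0. \<forall>j\<in>states. \<forall>x\<in>{0..B}. \<forall>x'\<in>{0..B}. \<bar>v x j - v x' j\<bar> \<le> L * \<bar>x - x'\<bar>" for B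
  proof (intro exI[of _ Lv] conjI ballI)
    fix j x x' assume xs: "x \<in> {0..B}" "x' \<in> {0..B}"
    show "\<bar>v x j - v x' j\<bar> \<le> Lv * \<bar>x - x'\<bar>"
      using xs vp_lipschitz[of x x'] vm_lipschitz[of x x'] mult_right_mono[OF Lv_ge_1, of "\<bar>x - x'\<bar>"]
      by (auto simp: v_def Lv_def[symmetric])
  qed (use Lv_ge_1 in simp)
  show "\<exists>K. \<forall>j\<in>states. \<forall>x\<in>{0..B}. \<forall>h\<in>{0..1}.
     v (x * exp ((\<mu> + \<sigma> * j) * h)) j \<le> v x j + h * ((\<rho> + lam) * v x j - lam * v x (- j)) + K * h\<^sup>2" for B
    by (rule flow_upper)
  show "\<exists>K. \<forall>j\<in>states. \<forall>x\<in>{0..B}. \<forall>h\<in>{0..1}. x < thr j \<longrightarrow>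
     v (x * exp ((\<mu> + \<sigma> * j) * h)) j \<ge> v x j + h * ((\<rho> + lam) * v x j - lam * v x (- j)) - K * h\<^sup>2" for B
    by (rule flow_lower)
  show "v x j = x - a" if "j \<in> states" "0 \<le> x" "thr j \<le> x" for x j
    using that um_less_up mid_up Cm_um by (auto simp: v_def vp_def vm_def thr_def mem_states_iff split: if_splits)
qed

text \<open>Below the thresholds \<open>vp_gt\<close> and \<open>vm_gt\<close> are strict, so the
  set where value and payoff agree is exactly \<open>{thr j..}\<close> and its infimum is
  attained.\<close>

lemma threshold_eq:
  assumes g: "\<And>y. 0 \<le> y \<Longrightarrow> g y j = ereal (v y j)" and j: "j \<in> states"
  shows "threshold a g j = ereal (thr j)"
proof -
  have thr0: "0 \<le> thr j" using um_pos up_pos by (simp add: thr_def)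
  have "{y. 0 \<le> y \<and> g y j = ereal (y - a)} = {thr j..}"
  proof (intro set_eqI iffI)
    fix y assume "y \<in> {y. 0 \<le> y \<and> g y j = ereal (y - a)}"
    then have "0 \<le> y" "v y j = y - a" using g by auto
    then show "y \<in> {thr j..}"
      using j vp_gt[of y] vm_gt[of y] by (force simp: mem_states_iff v_def thr_def)
  next
    fix y assume "y \<in> {thr j..}"
    then show "y \<in> {y. 0 \<le> y \<and> g y j = ereal (y - a)}"
      using verification.v_stop[OF verification j, of y] g[of y] thr0 by auto
  qed
  moreover have "Inf (ereal ` {thr j..}) = ereal (thr j)"
    by (intro cInf_eq_minimum) auto
  ultimately show ?thesis by (simp add: threshold_def)
qed

end

text \<open>Division by \<open>y powr Omega_plus\<close> turns the two representations into
  \<open>(Cm - k1) * y powr r = k2\<close> with \<open>r > 0\<close>. A nonzero \<open>k2\<close>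
  would make the left side a nonzero constant, which strict monotonicity of the power refutes at
  \<open>um / 2\<close> and \<open>um\<close>. The origin cannot decide this, since
  \<open>0 powr r = 0\<close> for negative exponents too.\<close>

lemma (in candidate) general_representation_Cp:
  assumes g: "\<And>y. 0 \<le> y \<Longrightarrow> y \<le> um \<Longrightarrow> g y 1 = ereal (Cm * y powr Om_m)"
    and rep: "general_representation lam \<mu> \<sigma> \<rho> a g (ereal um) w k1 k2 k3"
  shows "k2 = 0"
proof (rule ccontr)
  assume k2: "k2 \<noteq> 0"
  define Op where "Op = Omega_plus lam \<mu> \<sigma> \<rho>"
  have eq: "(Cm - k1) * y powr (Om_m - Op) = k2" if y: "0 < y" "y \<le> um" for y
  proof -
    have "Cm * y powr Om_m = k1 * y powr Om_m + k2 * y powr Op"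
      using rep g[of y] y by (auto simp: general_representation_def Op_def)
    then have "(Cm - k1) * y powr Om_m = k2 * y powr Op" by (simp add: algebra_simps)
    moreover have "y powr Om_m = y powr (Om_m - Op) * y powr Op"
      by (simp add: powr_add[symmetric])
    ultimately show ?thesis using y by simp
  qed
  have "Cm - k1 \<noteq> 0" using eq[of um] um_pos k2 by auto
  moreover have "(Cm - k1) * um powr (Om_m - Op) = (Cm - k1) * (um / 2) powr (Om_m - Op)"
    using eq[of um] eq[of "um / 2"] um_pos by simp
  ultimately have "um powr (Om_m - Op) = (um / 2) powr (Om_m - Op)" by simp
  moreover have "(um / 2) powr (Om_m - Op) < um powr (Om_m - Op)"
    using um_pos Om_m_pos Omega_plus_neg by (intro powr_less_mono2) (auto simp: Op_def)
  ultimately show False by simp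
qed

theorem theorem13:
  fixes lam \<mu> \<sigma> a \<rho> :: real
    and P :: "real \<Rightarrow> 'a measure" and \<xi> :: "real \<Rightarrow> 'a \<Rightarrow> real"
  assumes "lam > 0" "\<mu> > 0" "\<sigma> > 0" "a > 0" "\<rho> > 0"
    and chain: "\<And>s. s \<in> states \<Longrightarrow> switching_chain lam s (P s) \<xi>"
    and "\<rho> > \<mu> + \<sigma>" and "\<mu> - \<sigma> < 0"
  shows
    "let g = value_function \<mu> \<sigma> \<rho> a P \<xi>;
         b = b_const lam \<mu> \<sigma> \<rho>;
         Om = Omega lam \<mu> \<sigma> \<rho>;
         Om_m = Omega_minus lam \<mu> \<sigma> \<rho>;
         om_m = omega_minus lam \<mu> \<sigma> \<rho>;
         u_p = a * (\<rho> / (\<rho> - \<mu> - \<sigma>));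
         C = (1 - b) / (Om * u_p powr (Om - 1));
         a_hat = a * ((1 - lam / (lam + \<rho>) * om_m) / (1 - b * om_m));
         solutions = {u. 0 \<le> u \<and> u - C * om_m / (1 - b * om_m) * u powr Om = a_hat}
     in threshold a g 1 = ereal u_p \<and>
        (\<exists>u_m. threshold a g (- 1) = ereal u_m \<and>
           u_m \<in> solutions \<and> (\<forall>v\<in>solutions. u_m \<le> v) \<and>
           (let C_m = (u_m - a) / (om_m * u_m powr Om_m)
            in (\<forall>y. 0 \<le> y \<and> y \<le> u_m \<longrightarrow> g y (- 1) = ereal (C_m * om_m * y powr Om_m)) \<and>
               (\<forall>y. u_m \<le> y \<longrightarrow> g y (- 1) = ereal (y - a)) \<and>
               (\<forall>y. 0 \<le> y \<and> y \<le> u_m \<longrightarrow> g y 1 = ereal (C_m * y powr Om_m)) \<and>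
               (\<forall>y. u_m \<le> y \<and> y \<le> u_p \<longrightarrow>
                  g y 1 = ereal (b * y - a * (lam / (lam + \<rho>)) + C * y powr Om)) \<and>
               (\<forall>y. u_p \<le> y \<longrightarrow> g y 1 = ereal (y - a)))) \<and>
        (\<forall>C_m' C_p' C'. general_representation lam \<mu> \<sigma> \<rho> a g
           (threshold a g (- 1)) (threshold a g 1) C_m' C_p' C' \<longrightarrow> C_p' = 0)"
proof -
  interpret T: two_state lam \<mu> \<sigma> \<rho> a
    by unfold_locales (use assms in auto)
  obtain um where um: "a < um" "um < T.up" "T.H um = 0" "\<And>y. 0 \<le> y \<Longrightarrow> T.H y = 0 \<Longrightarrow> um \<le> y"
    "Omega_minus lam \<mu> \<sigma> \<rho> * (um - a) \<le> um"
  proof (rule T.smallest_root, goal_cases)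
    case (1 um)
    show ?case by (rule 1(1)[OF 1(2-6)])
  qed
  interpret V: candidate lam \<mu> \<sigma> \<rho> a um
    by unfold_locales (use um in auto)
  define g where "g = value_function \<mu> \<sigma> \<rho> a P \<xi>"
  \<comment> \<open>The verification is run anew for every starting pair, since the measure depends
    on \<open>s\<close> and the price process on \<open>y\<close>; the thresholds of
    \<open>g\<close> are identified only afterwards.\<close>
  have g: "g y s = ereal (V.v y s)" if "0 \<le> y" "s \<in> states" for y s
  proof -
    interpret switching lam s "P s" \<xi>
      by unfold_locales (use chain that assms in auto)
    interpret W: verification_chain lam \<mu> \<sigma> \<rho> a T.up V.v V.thr s "P s" \<xi> y
      by (intro verification_chain.intro V.verification switching_axioms verification_chain_axioms.intro that)
    show ?thesis unfolding g_def by (rule W.value_function_eq) simp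
  qed
  have st: "1 \<in> states" "- 1 \<in> states" by (auto simp: states_def)
  have t: "threshold a g 1 = ereal T.up" "threshold a g (- 1) = ereal um"
    using V.threshold_eq[of g 1] V.threshold_eq[of g "- 1"] g st by (auto simp: V.thr_def)
  have g1: "g y 1 = ereal (V.vp y)" and g2: "g y (- 1) = ereal (V.vm y)" if "0 \<le> y" for y
    using g[OF that] st by (simp_all add: V.v_def)
  note pos = T.up_pos V.um_pos
  \<comment> \<open>The claim is stated through \<open>H\<close>, \<open>mid\<close> and
    \<open>Cm\<close>; the closing step folds the explicit formulas into these, with
    \<open>H_iff\<close> translating membership in the solution set.\<close>
  have main: "threshold a g 1 = ereal T.up \<and>
    (threshold a g (- 1) = ereal um \<and> (0 \<le> um \<and> T.H um = 0) \<and> (\<forall>v. 0 \<le> v \<and> T.H v = 0 \<longrightarrow> um \<le> v) \<and>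
      (\<forall>y. 0 \<le> y \<and> y \<le> um \<longrightarrow> g y (- 1) = ereal (V.Cm * omega_minus lam \<mu> \<sigma> \<rho> * y powr Omega_minus lam \<mu> \<sigma> \<rho>)) \<and>
      (\<forall>y. um \<le> y \<longrightarrow> g y (- 1) = ereal (y - a)) \<and>
      (\<forall>y. 0 \<le> y \<and> y \<le> um \<longrightarrow> g y 1 = ereal (V.Cm * y powr Omega_minus lam \<mu> \<sigma> \<rho>)) \<and>
      (\<forall>y. um \<le> y \<and> y \<le> T.up \<longrightarrow> g y 1 = ereal (T.mid y)) \<and>
      (\<forall>y. T.up \<le> y \<longrightarrow> g y 1 = ereal (y - a))) \<and>
    (\<forall>C_m' C_p' C'. general_representation lam \<mu> \<sigma> \<rho> a g
           (threshold a g (- 1)) (threshold a g 1) C_m' C_p' C' \<longrightarrow> C_p' = 0)"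
  proof (intro conjI allI impI)
    fix y assume "um \<le> y"
    then show "g y (- 1) = ereal (y - a)"
      using g2[of y] pos V.Cm_um by (cases "y = um") (auto simp: V.vm_def)
  next
    fix y assume "um \<le> y \<and> y \<le> T.up"
    then show "g y 1 = ereal (T.mid y)"
      using g1[of y] pos V.Cm_mid by (cases "y = um") (auto simp: V.vp_def)
  next
    fix y assume "T.up \<le> y"
    then show "g y 1 = ereal (y - a)"
      using g1[of y] pos T.mid_up um(2) by (cases "y = T.up") (auto simp: V.vp_def)
  next
    fix k1 k2 k3 assume "general_representation lam \<mu> \<sigma> \<rho> a g (threshold a g (- 1)) (threshold a g 1) k1 k2 k3"
    then show "k2 = 0"
      unfolding t by (intro V.general_representation_Cp[of g]) (auto simp: g1 V.vp_def)
  qed (use t um pos g1 g2 in \<open>auto simp: V.vp_def V.vm_def\<close>)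
  show ?thesis
    unfolding Let_def g_def[symmetric] T.up_def[symmetric] T.C_def[symmetric] T.mid_def[symmetric] Ball_def mem_Collect_eq T.H_iff[symmetric]
    using main by (intro conjI exI[of _ um]) (simp_all add: V.Cm_def[symmetric])
qed

end
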